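(* Let $X$ be a shift space with language $\mathcal L$, and suppose there is $\mathcal G\subset\mathcal L$ having $(W)$-specification such that $\mathcal L$ is edit approachable by $\mathcal G$. Then for every $\alpha\in[0,h_{\rm top}(\sigma,X))$ the set $$\mathcal M_e(X,\sigma,\alpha)=\{\mu\in\mathcal M^e_\sigma(X):h_\mu(\sigma)=\alpha\}$$ is a residual subset of the compact metric space $\mathcal M^\alpha(X,\sigma)=\{\mu\in\mathcal M_\sigma(X):h_\mu(\sigma)\ge\alpha\}$ (with the weak* topology).
   Context: $\mathcal A=\{1,\dots,m\}$, $\mathcal A^{\mathbb N}$ with metric $d(x,y)=\sum_j|x_j-y_j|2^{-j}$ and left shift $\sigma$; a shift space is a nonempty compact $\sigma$-invariant $X\subset\mathcal A^{\mathbb N}$ with language $\mathcal L$. $\mathcal G\subset\mathcal L$ has $(W)$-specification if there is $\tau\in\mathbb N$ such that for all $u,v\in\mathcal G$ there is $w\in\mathcal L$ with $|w|\le\tau$ and $uwv\in\mathcal G$. The edit distance $\hat d(v,w)$ is the minimal number of single-symbol substitutions, insertions or deletions transforming $v$ into $w$; $\mathcal L$ is edit approachable by $\mathcal G$ if there is a nondecreasing $g:\mathbb N\to\mathbb N$ with $g(n)/n\to0$ such that every $w\in\mathcal L$ has $v\in\mathcal G$ with $\hat d(w,v)\le g(|w|)$. $\mathcal M_\sigma(X)$, $\mathcal M^e_\sigma(X)$: invariant and ergodic invariant Borel probability measures; $h_\mu(\sigma)$ measure-theoretic entropy; $h_{\rm top}(\sigma,X)$ topological entropy. *)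

theory Defs
  imports "HOL-Probability.Probability"
begin

type_synonym seq = "nat \<Rightarrow> nat"

text \<open>Full shift over the alphabet {1..m}; the space nat => nat carries the product
  topology (Function_Topology), which on {1..m}^N coincides with the topology of the
  metric d(x,y) = sum_j |x_j - y_j| 2^(-j).\<close>

definition full_shift :: "nat \<Rightarrow> seq set" where
  "full_shift m = {x. \<forall>j. x j \<in> {1..m}}"

definition shift :: "seq \<Rightarrow> seq" ("\<sigma>") where
  "shift x = (\<lambda>j. x (Suc j))"

definition shift_space :: "nat \<Rightarrow> seq set \<Rightarrow> bool" where
  "shift_space m X \<longleftrightarrow> X \<noteq> {} \<and> X \<subseteq> full_shift m \<and> compact X \<and> shift ` X \<subseteq> X"

definition language :: "seq set \<Rightarrow> nat list set" where
  "language X = {w. \<exists>x\<in>X. \<exists>i. w = map x [i..<i + length w]}"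

definition language_n :: "seq set \<Rightarrow> nat \<Rightarrow> nat list set" where
  "language_n X n = {w \<in> language X. length w = n}"

definition W_specification :: "seq set \<Rightarrow> nat list set \<Rightarrow> bool" where
  "W_specification X G \<longleftrightarrow>
     (\<exists>\<tau>::nat. \<forall>u\<in>G. \<forall>v\<in>G. \<exists>w\<in>language X. length w \<le> \<tau> \<and> u @ w @ v \<in> G)"

definition edit_step :: "'a list \<Rightarrow> 'a list \<Rightarrow> bool" where
  "edit_step v w \<longleftrightarrow> (\<exists>xs ys a b.
      (v = xs @ [a] @ ys \<and> w = xs @ [b] @ ys) \<or>
      (v = xs @ ys \<and> w = xs @ [a] @ ys) \<or>
      (v = xs @ [a] @ ys \<and> w = xs @ ys))"

definition edit_dist :: "'a list \<Rightarrow> 'a list \<Rightarrow> nat" where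
  "edit_dist v w = (LEAST n. (edit_step ^^ n) v w)"

definition edit_approachable :: "seq set \<Rightarrow> nat list set \<Rightarrow> bool" where
  "edit_approachable X G \<longleftrightarrow>
     (\<exists>g::nat \<Rightarrow> nat. mono g \<and> (\<lambda>n. real (g n) / real n) \<longlonglongrightarrow> 0 \<and>
        (\<forall>w\<in>language X. \<exists>v\<in>G. edit_dist w v \<le> g (length w)))"

definition htop :: "seq set \<Rightarrow> real" where
  "htop X = lim (\<lambda>n. ln (real (card (language_n X n))) / real n)"

definition borel_prob_on :: "seq set \<Rightarrow> seq measure set" where
  "borel_prob_on X = {\<mu>. prob_space \<mu> \<and> space \<mu> = X \<and> sets \<mu> = sets (restrict_space borel X)}"

definition invariant_measures :: "seq set \<Rightarrow> seq measure set" where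
  "invariant_measures X = {\<mu> \<in> borel_prob_on X.
      \<forall>A\<in>sets \<mu>. emeasure \<mu> (shift -` A \<inter> X) = emeasure \<mu> A}"

definition ergodic_measures :: "seq set \<Rightarrow> seq measure set" where
  "ergodic_measures X = {\<mu> \<in> invariant_measures X.
      \<forall>A\<in>sets \<mu>. shift -` A \<inter> X = A \<longrightarrow> measure \<mu> A = 0 \<or> measure \<mu> A = 1}"

definition eta :: "real \<Rightarrow> real" where
  "eta t = (if t = 0 then 0 else - t * ln t)"

definition finite_partition :: "'a measure \<Rightarrow> 'a set set \<Rightarrow> bool" where
  "finite_partition \<mu> P \<longleftrightarrow> finite P \<and> P \<subseteq> sets \<mu> \<and> \<Union>P = space \<mu> \<and> disjoint P"

definition part_entropy :: "'a measure \<Rightarrow> 'a set set \<Rightarrow> real" where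
  "part_entropy \<mu> P = (\<Sum>A\<in>P. eta (measure \<mu> A))"

definition join_iter :: "seq set \<Rightarrow> nat \<Rightarrow> seq set set \<Rightarrow> seq set set" where
  "join_iter X n P = {X \<inter> (\<Inter>i<n. (shift ^^ i) -` f i) | f. \<forall>i<n. f i \<in> P}"

definition partition_entropy_rate :: "seq set \<Rightarrow> seq measure \<Rightarrow> seq set set \<Rightarrow> real" where
  "partition_entropy_rate X \<mu> P = lim (\<lambda>n. part_entropy \<mu> (join_iter X n P) / real n)"

definition ks_entropy :: "seq set \<Rightarrow> seq measure \<Rightarrow> real" where
  "ks_entropy X \<mu> = (SUP P\<in>{P. finite_partition \<mu> P}. partition_entropy_rate X \<mu> P)"

definition weak_star_topology :: "seq set \<Rightarrow> seq measure topology" where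
  "weak_star_topology X = topology_generated_by
     {{\<mu>. (\<integral>x. f x \<partial>\<mu>) \<in> U} | (f :: seq \<Rightarrow> real) U. continuous_on X f \<and> open U}"

definition residual_in :: "'a topology \<Rightarrow> 'a set \<Rightarrow> bool" where
  "residual_in T S \<longleftrightarrow> S \<subseteq> topspace T \<and>
     (\<exists>F. countable F \<and> (\<forall>U\<in>F. openin T U \<and> T closure_of U = topspace T) \<and>
          topspace T \<inter> \<Inter>F \<subseteq> S)"

end

theory Submission
  imports Defs "HOL-Library.Sublist"
begin

text \<open>
  Entropy is upper semicontinuous on the invariant measures, so the sets \<open>{h < \<alpha> + 1/n}\<close> are open in \<open>M\<^sup>\<alpha>\<close>. So are
  the sets of all \<open>\<mu>\<close> for which there is a window length \<open>M\<close> such that the frequencies of the words of length \<open>k\<close> in a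
  window of length \<open>M\<close> have variance less than \<open>1/j\<close> with respect to \<open>\<mu>\<close>. A measure in all of these sets is ergodic of
  entropy \<open>\<alpha>\<close>, so only their density in \<open>M\<^sup>\<alpha>\<close> is needed, and ergodic decomposition is avoided.

  Fix a large \<open>n\<close>. A sequence of words of length \<open>n\<close> is coded by a point of \<open>X\<close>: replace each word by an edit-close
  element of \<open>G\<close> and glue with (W)-specification. Draw the words independently according to \<open>\<mu>\<close>. By the weak law of large
  numbers the limits of the empirical measures of the coded points have small variances and are close to \<open>\<mu>\<close>, and
  since the coding has subexponential fibres, Misiurewicz' argument bounds their entropy below by nearly \<open>h(\<mu>)\<close>. For
  \<open>h(\<mu>) = \<alpha>\<close> one first mixes \<open>\<mu>\<close> with a measure of entropy greater than \<open>\<alpha>\<close>. Coding instead a periodic sequence with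
  the right frequencies gives a measure close to \<open>\<mu>\<close> of almost zero entropy. Entropy being affine, a mixture of
  that measure with \<open>\<mu>\<close> has entropy exactly \<open>\<alpha>\<close>.
\<close>

section \<open>Entropy of finite-valued functions\<close>

text \<open>One integral serves both density steps. For c = \<mu>([p]), the integral of
  (\<open>freq M p\<close> - c)^2 over an invariant \<nu> is the variance of the frequency under
  \<nu> plus (\<nu>([p]) - c)^2. A single estimate thus gives small variance and closeness to \<mu>.
  The obstacle is that edits change lengths: the coded words start at irregular places that depend
  on the sequence. Frequencies are therefore compared over windows of r consecutive words of length
  n. The two ends of a window cost about 1/r, the accumulated drift costs about (g(n) + const)/n.
  This fixes the order of choice: r, then n, and then the number of coded words tends to infinity.
  Entropy is only upper semicontinuous, so a lower bound does not simply pass to a weak limit; it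
  goes through block entropies of averaged finite laws, by concavity. An upper bound needs only one
  block length, because the entropy rate is the infimum of the block entropies per symbol.
  Neighbourhoods in the weak* topology enter only through finitely many cylinder measures.\<close>

lemma fekete:
  fixes a :: "nat \<Rightarrow> real"
  assumes sub: "\<And>n k. a (n + k) \<le> a n + a k" and nn: "\<And>n. 0 \<le> a n"
  shows "\<exists>l. (\<lambda>n. a n / real n) \<longlonglongrightarrow> l \<and> (\<forall>n. l * real n \<le> a n)"
proof -
  define l where "l = (INF n\<in>{1..}. a n / real n)"
  have bdd: "bdd_below ((\<lambda>n. a n / real n) ` {1..})"
    by (intro bdd_belowI2[of _ 0]) (simp add: nn)
  have low: "l \<le> a n / real n" if "n \<ge> 1" for n
    unfolding l_def using bdd that by (intro cINF_lower) auto
  have mult: "a (q * k + s) \<le> real q * a k + a s" for q k s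
  proof (induction q)
    case (Suc q)
    have "a (Suc q * k + s) = a (k + (q * k + s))" by (simp add: algebra_simps)
    also have "\<dots> \<le> a k + a (q * k + s)" by (rule sub)
    finally show ?case using Suc by (simp add: algebra_simps)
  qed simp
  have "(\<lambda>n. a n / real n) \<longlonglongrightarrow> l"
  proof (rule LIMSEQ_I)
    fix e :: real assume e: "e > 0"
    have "\<exists>k\<in>{1..}. a k / real k < l + e / 2"
    proof (rule ccontr)
      assume "\<not> ?thesis"
      hence "l + e / 2 \<le> l" unfolding l_def[symmetric]
        by (subst (2) l_def) (intro cINF_greatest, auto simp: not_less)
      thus False using e by simp
    qed
    then obtain k where k: "k \<ge> 1" "a k / real k < l + e / 2" by auto
    \<comment> \<open>\<open>B\<close> bounds every remainder term a (n mod k) at once, so it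
      disappears after division by \<open>n\<close>.\<close>
    define B where "B = (\<Sum>s<k. a s)"
    have B: "a s \<le> B" if "s < k" for s
      unfolding B_def using that nn by (intro member_le_sum) auto
    have B0: "B \<ge> 0" unfolding B_def by (intro sum_nonneg) (simp add: nn)
    obtain n0 :: nat where n0: "B / (e / 2) < real n0" using reals_Archimedean2 by blast
    show "\<exists>no. \<forall>n\<ge>no. norm (a n / real n - l) < e"
    proof (intro exI allI impI)
      fix n assume n: "n \<ge> max 1 n0"
      have n1: "real n > 0" using n by auto
      have "a n = a ((n div k) * k + n mod k)" by simp
      also have "\<dots> \<le> real (n div k) * a k + a (n mod k)" by (rule mult)
      also have "\<dots> \<le> real (n div k) * a k + B" using k by (intro add_left_mono B) simp
      also have "real (n div k) * a k \<le> (real n / real k) * a k"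
        using nn by (intro mult_right_mono) (simp_all add: of_nat_div_le_of_nat)
      finally have "a n / real n \<le> a k / real k + B / real n"
        using n1 by (simp add: field_simps)
      moreover have "B / real n < e / 2"
      proof -
        have "B / (e / 2) < real n" using n0 n by linarith
        thus ?thesis using e n1 by (simp add: field_simps)
      qed
      ultimately have "a n / real n < l + e" using k by linarith
      moreover have "l \<le> a n / real n" using low n by auto
      ultimately show "norm (a n / real n - l) < e" by simp
    qed
  qed
  moreover have "l * real n \<le> a n" for n
    using low[of n] nn[of n] by (cases "n = 0") (auto simp: field_simps)
  ultimately show ?thesis by blast
qed

section \<open>The function -t ln t\<close>

lemma eta_0 [simp]: "eta 0 = 0" by (simp add: eta_def)

lemma eta_nonneg: "0 \<le> t \<Longrightarrow> t \<le> 1 \<Longrightarrow> 0 \<le> eta t"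
  by (auto simp: eta_def mult_nonneg_nonpos)

text \<open>The right side is the tangent of \<open>eta\<close> at \<open>s\<close>, so this is
  concavity in a form that includes y = 0. Each entropy inequality below comes from a choice of
  \<open>s\<close>: the mean for Jensen's inequality, a product of marginals for subadditivity, an
  even split for the fibre bound.\<close>

lemma eta_tangent:
  assumes "y \<ge> 0" "s > 0"
  shows "eta y \<le> - y * ln s + (s - y)"
proof (cases "y = 0")
  case False
  hence y: "y > 0" using assms by simp
  have "ln (s / y) \<le> s / y - 1" using y assms by (intro ln_le_minus_one) simp
  hence "y * ln (s / y) \<le> s - y" using y by (simp add: field_simps)
  thus ?thesis using y assms by (simp add: eta_def ln_div algebra_simps)
qed (use assms in simp)

lemma eta_subadd:
  assumes "a \<ge> 0" "b \<ge> 0" shows "eta (a + b) \<le> eta a + eta b"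
proof (cases "a = 0 \<or> b = 0")
  case False
  hence ab: "a > 0" "b > 0" using assms by auto
  hence "a * ln a \<le> a * ln (a + b)" "b * ln b \<le> b * ln (a + b)" by (auto intro!: mult_left_mono)
  hence "a * ln a + b * ln b \<le> a * ln (a + b) + b * ln (a + b)" by (rule add_mono)
  thus ?thesis using ab by (simp add: eta_def algebra_simps)
qed auto

lemma eta_sum_subadd:
  assumes "finite S" "\<And>i. i \<in> S \<Longrightarrow> f i \<ge> 0"
  shows "eta (\<Sum>i\<in>S. f i) \<le> (\<Sum>i\<in>S. eta (f i))"
  using assms
proof (induction S)
  case (insert x S)
  have "eta (f x + (\<Sum>i\<in>S. f i)) \<le> eta (f x) + eta (\<Sum>i\<in>S. f i)"
    using insert by (intro eta_subadd sum_nonneg) auto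
  thus ?case using insert by fastforce
qed simp

text \<open>Take the tangent at the mean; after averaging, its linear terms cancel. A zero mean is
  separated because there is no tangent at 0.\<close>

lemma eta_concave:
  assumes "finite S" "\<And>i. i \<in> S \<Longrightarrow> 0 \<le> c i" "(\<Sum>i\<in>S. c i) = 1" "\<And>i. i \<in> S \<Longrightarrow> y i \<ge> 0"
  shows "(\<Sum>i\<in>S. c i * eta (y i)) \<le> eta (\<Sum>i\<in>S. c i * y i)"
proof -
  define s where "s = (\<Sum>i\<in>S. c i * y i)"
  have s0: "s \<ge> 0" unfolding s_def using assms by (intro sum_nonneg) auto
  show ?thesis
  proof (cases "s = 0")
    case True
    hence "\<forall>i\<in>S. c i * y i = 0" unfolding s_def using assms
      by (subst (asm) sum_nonneg_eq_0_iff) auto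
    hence "(\<Sum>i\<in>S. c i * eta (y i)) = 0" by (intro sum.neutral) auto
    thus ?thesis using True by (simp add: s_def)
  next
    case False
    hence s: "s > 0" using s0 by simp
    have "(\<Sum>i\<in>S. c i * eta (y i)) \<le> (\<Sum>i\<in>S. c i * (- y i * ln s + (s - y i)))"
      using assms s by (intro sum_mono mult_left_mono eta_tangent) auto
    also have "\<dots> = - ln s * (\<Sum>i\<in>S. c i * y i) + s * (\<Sum>i\<in>S. c i) - (\<Sum>i\<in>S. c i * y i)"
      by (simp add: sum_distrib_left sum.distrib sum_subtractf algebra_simps sum_negf)
    also have "\<dots> = eta s" using assms False by (simp add: s_def[symmetric] eta_def)
    finally show ?thesis by (simp add: s_def)
  qed
qed

lemma eta_mult: "a \<ge> 0 \<Longrightarrow> b \<ge> 0 \<Longrightarrow> eta (a * b) = a * eta b + b * eta a"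
  by (cases "a = 0"; cases "b = 0") (auto simp: eta_def ln_mult algebra_simps)

lemma continuous_eta: "continuous_on {0..} eta"
proof -
  \<comment> \<open>Only continuity at 0 needs work. The inequality ln u <= u - 1 at u = 1 / sqrt t
    bounds -ln t by 2 / sqrt t, and multiplication by t leaves 2 sqrt t.\<close>
  have le: "norm (eta t) \<le> 2 * sqrt t" if "0 < t" "t < 1" for t :: real
  proof -
    have "ln (1 / sqrt t) \<le> 1 / sqrt t - 1" using that by (intro ln_le_minus_one) simp
    hence "- ln t \<le> 2 * (1 / sqrt t)" using that by (simp add: ln_div ln_sqrt)
    hence "t * (- ln t) \<le> t * (2 * (1 / sqrt t))" using that by (intro mult_left_mono) auto
    also have "\<dots> = 2 * (t / sqrt t)" by simp
    also have "t / sqrt t = sqrt t" using that by (intro real_div_sqrt) simp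
    finally show ?thesis using eta_nonneg[of t] that by (simp add: eta_def)
  qed
  have "((\<lambda>t. 2 * sqrt t) \<longlongrightarrow> 2 * sqrt 0) (at_right 0)" by (intro tendsto_intros)
  hence lim0: "((\<lambda>t. 2 * sqrt t) \<longlongrightarrow> 0) (at_right 0)" by simp
  have "eventually (\<lambda>t. norm (eta t) \<le> 2 * sqrt t) (at_right 0)"
    unfolding eventually_at_right_field using le by (intro exI[of _ 1]) auto
  from Lim_null_comparison[OF this lim0] have r: "(eta \<longlongrightarrow> 0) (at_right 0)" .
  have "(eta \<longlongrightarrow> eta x) (at x within {0..})" if x: "x \<ge> 0" for x
  proof (cases "x = 0")
    case True
    thus ?thesis using True r by (simp add: at_within_Ici_at_right)
  next
    case False
    hence x: "x > 0" using x by simp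
    have "((\<lambda>t::real. - t * ln t) \<longlongrightarrow> - x * ln x) (at x within {0..})"
      using x by (intro tendsto_intros) auto
    moreover have "eventually (\<lambda>t. - t * ln t = eta t) (at x within {0..})"
      unfolding eta_def eventually_at_filter by (auto)
    ultimately show ?thesis using x by (auto simp: eta_def intro: Lim_transform_eventually)
  qed
  thus ?thesis by (simp add: continuous_on)
qed

text \<open>The entropy of the partition into fibres of \<open>Y\<close>. With labelling functions
  in place of partitions, a join is just a pair or a list of labels.\<close>

definition ent :: "'a measure \<Rightarrow> ('a \<Rightarrow> 'b) \<Rightarrow> real" where
  "ent M Y = (\<Sum>v\<in>Y ` space M. eta (measure M (Y -` {v} \<inter> space M)))"

section \<open>Subadditivity and fibre bounds\<close>

context prob_space
begin

lemma ent_superset: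
  assumes "finite S" "Y ` space M \<subseteq> S"
  shows "ent M Y = (\<Sum>v\<in>S. eta (prob (Y -` {v} \<inter> space M)))"
  unfolding ent_def
proof (rule sum.mono_neutral_left[OF assms], safe)
  fix v assume "v \<notin> Y ` space M"
  hence "Y -` {v} \<inter> space M = {}" by auto
  thus "eta (prob (Y -` {v} \<inter> space M)) = 0" by simp
qed

lemma ent_nonneg: "0 \<le> ent M Y"
  unfolding ent_def by (intro sum_nonneg eta_nonneg) auto

lemma prob_fibre_sum:
  assumes "simple_function M Y" "simple_function M Z"
  shows "(\<Sum>z\<in>Z ` space M. prob (Y -` {y} \<inter> Z -` {z} \<inter> space M)) = prob (Y -` {y} \<inter> space M)"
proof -
  have fZ: "finite (Z ` space M)" using assms simple_functionD(1) by blast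
  have "prob (\<Union>z\<in>Z ` space M. Y -` {y} \<inter> Z -` {z} \<inter> space M)
      = (\<Sum>z\<in>Z ` space M. prob (Y -` {y} \<inter> Z -` {z} \<inter> space M))"
  proof (rule finite_measure_finite_Union[OF fZ])
    have "Y -` {y} \<inter> Z -` {z} \<inter> space M = (Y -` {y} \<inter> space M) \<inter> (Z -` {z} \<inter> space M)" for z by auto
    moreover have "(Y -` {y} \<inter> space M) \<inter> (Z -` {z} \<inter> space M) \<in> events" for z
      using sets.Int[OF simple_functionD(2)[OF assms(1)] simple_functionD(2)[OF assms(2)]] by blast
    ultimately show "(\<lambda>z. Y -` {y} \<inter> Z -` {z} \<inter> space M) ` Z ` space M \<subseteq> events"
      by (simp add: image_subset_iff)
    show "disjoint_family_on (\<lambda>z. Y -` {y} \<inter> Z -` {z} \<inter> space M) (Z ` space M)"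
      by (auto simp: disjoint_family_on_def)
  qed
  moreover have "(\<Union>z\<in>Z ` space M. Y -` {y} \<inter> Z -` {z} \<inter> space M) = Y -` {y} \<inter> space M" by auto
  ultimately show ?thesis by simp
qed

lemma prob_sum_1:
  assumes "simple_function M Y" shows "(\<Sum>y\<in>Y ` space M. prob (Y -` {y} \<inter> space M)) = 1"
  using prob_fibre_sum[OF simple_function_const[of M "()"] assms, of "()"] prob_space
  by (simp add: vimage_def)

lemma ent_pair_eq:
  assumes "simple_function M Y" "simple_function M Z"
  shows "ent M (\<lambda>x. (Y x, Z x)) =
    (\<Sum>y\<in>Y ` space M. \<Sum>z\<in>Z ` space M. eta (prob (Y -` {y} \<inter> Z -` {z} \<inter> space M)))"
proof -
  have "ent M (\<lambda>x. (Y x, Z x)) = (\<Sum>v\<in>Y ` space M \<times> Z ` space M. eta (prob ((\<lambda>x. (Y x, Z x)) -` {v} \<inter> space M)))"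
    using simple_functionD(1)[OF assms(1)] simple_functionD(1)[OF assms(2)] by (intro ent_superset) auto
  also have "\<dots> = (\<Sum>v\<in>Y ` space M \<times> Z ` space M. eta (prob (Y -` {fst v} \<inter> Z -` {snd v} \<inter> space M)))"
    by (intro sum.cong refl arg_cong[where f = "\<lambda>A. eta (prob A)"]) auto
  finally show ?thesis by (simp add: sum.cartesian_product case_prod_unfold)
qed

text \<open>Gibbs' inequality: for each pair of values the tangent is taken at the product of the
  marginals. The correction terms p y * q z - r y z sum to 1 - 1 = 0, and the logarithm of the
  product separates into the two entropies.\<close>

lemma ent_pair_le:
  assumes Y: "simple_function M Y" and Z: "simple_function M Z"
  shows "ent M (\<lambda>x. (Y x, Z x)) \<le> ent M Y + ent M Z"
proof -
  define r where "r y z = prob (Y -` {y} \<inter> Z -` {z} \<inter> space M)" for y z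
  define p where "p y = prob (Y -` {y} \<inter> space M)" for y
  define q where "q z = prob (Z -` {z} \<inter> space M)" for z
  have m: "Y -` {y} \<inter> space M \<in> events" "Z -` {z} \<inter> space M \<in> events" for y z
    using Y Z simple_functionD(2) by auto
  have rp: "r y z \<le> p y" and rq: "r y z \<le> q z" for y z
    unfolding r_def p_def q_def using m by (auto intro!: finite_measure_mono)
  have sz: "(\<Sum>z\<in>Z ` space M. r y z) = p y" for y
    unfolding r_def p_def by (rule prob_fibre_sum[OF Y Z])
  have sy: "(\<Sum>y\<in>Y ` space M. r y z) = q z" for z
    using prob_fibre_sum[OF Z Y, of z] unfolding r_def q_def by (simp add: Int_ac)
  have p1: "(\<Sum>y\<in>Y ` space M. p y) = 1" "(\<Sum>z\<in>Z ` space M. q z) = 1"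
    unfolding p_def q_def using prob_sum_1 Y Z by auto
  have et: "eta (r y z) \<le> - r y z * ln (p y) - r y z * ln (q z) + (p y * q z - r y z)" for y z
  proof (cases "r y z = 0")
    case True
    thus ?thesis by (simp add: p_def q_def)
  next
    case False
    hence "r y z > 0" unfolding r_def by (simp add: zero_less_measure_iff)
    hence "p y > 0" "q z > 0" using rp[of y z] rq[of y z] by auto
    thus ?thesis using eta_tangent[of "r y z" "p y * q z"] \<open>r y z > 0\<close> by (simp add: ln_mult algebra_simps)
  qed
  have "ent M (\<lambda>x. (Y x, Z x)) \<le>
    (\<Sum>y\<in>Y ` space M. \<Sum>z\<in>Z ` space M. - r y z * ln (p y) - r y z * ln (q z) + (p y * q z - r y z))"
    unfolding ent_pair_eq[OF Y Z] r_def[symmetric] by (intro sum_mono et)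
  also have "\<dots> = (\<Sum>y\<in>Y ` space M. - (ln (p y) * (\<Sum>z\<in>Z ` space M. r y z)))
     - (\<Sum>y\<in>Y ` space M. \<Sum>z\<in>Z ` space M. r y z * ln (q z))
     + ((\<Sum>y\<in>Y ` space M. \<Sum>z\<in>Z ` space M. p y * q z) - (\<Sum>y\<in>Y ` space M. \<Sum>z\<in>Z ` space M. r y z))"
    by (simp add: sum.distrib sum_subtractf sum_negf sum_distrib_left algebra_simps)
  also have "(\<Sum>y\<in>Y ` space M. \<Sum>z\<in>Z ` space M. r y z * ln (q z)) = (\<Sum>z\<in>Z ` space M. ln (q z) * (\<Sum>y\<in>Y ` space M. r y z))"
    by (subst sum.swap) (simp add: sum_distrib_left mult.commute)
  also have "(\<Sum>y\<in>Y ` space M. \<Sum>z\<in>Z ` space M. p y * q z) = 1"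
    using p1 by (simp add: sum_product[symmetric])
  also have "(\<Sum>y\<in>Y ` space M. \<Sum>z\<in>Z ` space M. r y z) = 1" using p1 sz by simp
  also have "(\<Sum>y\<in>Y ` space M. - (ln (p y) * (\<Sum>z\<in>Z ` space M. r y z))) = ent M Y"
    unfolding sz ent_def p_def by (intro sum.cong) (auto simp: eta_def)
  also have "(\<Sum>z\<in>Z ` space M. ln (q z) * (\<Sum>y\<in>Y ` space M. r y z)) = - ent M Z"
    unfolding sy ent_def q_def sum_negf[symmetric] by (intro sum.cong) (auto simp: eta_def)
  finally show ?thesis by simp
qed

text \<open>In effect the conditional entropy of \<open>Y\<close> given \<open>Z\<close> is at most
  ln C: on a fibre of \<open>Z\<close> of mass q z at most \<open>C\<close> values of
  \<open>Y\<close> occur, and the tangent at the even split q z / C yields eta (q z) + q z ln C.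
  Later this turns a bound on the fibres of the coding into a lower bound for the entropy of the
  coded points.\<close>

lemma ent_le_fibres:
  assumes Y: "simple_function M Y" and Z: "simple_function M Z" and C: "0 < C"
    and fib: "\<And>x. x \<in> space M \<Longrightarrow> real (card (Y ` (Z -` {Z x} \<inter> space M))) \<le> C"
  shows "ent M Y \<le> ent M Z + ln C"
proof -
  define r where "r y z = prob (Y -` {y} \<inter> Z -` {z} \<inter> space M)" for y z
  define q where "q z = prob (Z -` {z} \<inter> space M)" for z
  have fin: "finite (Y ` space M)" "finite (Z ` space M)" using Y Z simple_functionD(1) by auto
  have m: "Y -` {y} \<inter> space M \<in> events" "Z -` {z} \<inter> space M \<in> events" for y z
    using Y Z simple_functionD(2) by auto
  have r0: "r y z \<ge> 0" for y z unfolding r_def by simp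
  have rq: "r y z \<le> q z" for y z
    unfolding r_def q_def using m by (auto intro!: finite_measure_mono)
  have sy: "(\<Sum>y\<in>Y ` space M. r y z) = q z" for z
    using prob_fibre_sum[OF Z Y, of z] unfolding r_def q_def by (simp add: Int_ac)
  have "ent M Y = (\<Sum>y\<in>Y ` space M. eta (\<Sum>z\<in>Z ` space M. r y z))"
    unfolding ent_def r_def by (simp add: prob_fibre_sum[OF Y Z])
  also have "\<dots> \<le> (\<Sum>y\<in>Y ` space M. \<Sum>z\<in>Z ` space M. eta (r y z))"
    using fin r0 by (intro sum_mono eta_sum_subadd) auto
  also have "\<dots> = (\<Sum>z\<in>Z ` space M. \<Sum>y\<in>Y ` space M. eta (r y z))" by (rule sum.swap)
  also have "\<dots> \<le> (\<Sum>z\<in>Z ` space M. eta (q z) + q z * ln C)"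
  proof (rule sum_mono)
    fix z assume z: "z \<in> Z ` space M"
    define S where "S = Y ` (Z -` {z} \<inter> space M)"
    have S: "S \<subseteq> Y ` space M" "finite S" unfolding S_def using fin(1)
      by (auto intro: finite_subset[rotated, of "Y ` space M"])
    have cS: "real (card S) \<le> C" unfolding S_def using fib z by auto
    have r_out: "r y z = 0" if "y \<in> Y ` space M - S" for y
    proof -
      have "y \<in> S" if "x \<in> space M" "Y x = y" "Z x = z" for x
        unfolding S_def using that by blast
      hence "Y -` {y} \<inter> Z -` {z} \<inter> space M = {}" using that by blast
      thus ?thesis by (simp add: r_def)
    qed
    show "(\<Sum>y\<in>Y ` space M. eta (r y z)) \<le> eta (q z) + q z * ln C"
    proof (cases "q z = 0")
      case True
      hence "r y z = 0" for y using rq[of y z] r0[of y z] by auto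
      thus ?thesis using True by simp
    next
      case False
      hence qz: "q z > 0" unfolding q_def by (simp add: zero_less_measure_iff)
      have "(\<Sum>y\<in>Y ` space M. eta (r y z)) = (\<Sum>y\<in>S. eta (r y z))"
        using r_out by (intro sum.mono_neutral_right fin S) auto
      also have "\<dots> \<le> (\<Sum>y\<in>S. - r y z * ln (q z / C) + (q z / C - r y z))"
        using qz C r0 by (intro sum_mono eta_tangent) auto
      also have "\<dots> = - ln (q z / C) * (\<Sum>y\<in>S. r y z) + real (card S) * (q z / C) - (\<Sum>y\<in>S. r y z)"
        by (simp add: sum.distrib sum_subtractf sum_distrib_left sum_negf algebra_simps)
      also have "(\<Sum>y\<in>S. r y z) = q z"
        unfolding sy[symmetric] using r_out by (intro sum.mono_neutral_left fin S) auto
      also have "real (card S) * (q z / C) \<le> C * (q z / C)" using cS qz C by (intro mult_right_mono) auto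
      finally show ?thesis using qz C by (simp add: eta_def ln_div algebra_simps)
    qed
  qed
  also have "\<dots> = ent M Z + (\<Sum>z\<in>Z ` space M. q z) * ln C"
    by (simp add: sum.distrib sum_distrib_right ent_def q_def)
  also have "(\<Sum>z\<in>Z ` space M. q z) = 1" unfolding q_def by (rule prob_sum_1[OF Z])
  finally show ?thesis by simp
qed

lemma ent_function_le:
  assumes Y: "simple_function M Y" and Z: "simple_function M Z"
    and det: "\<And>x y. x \<in> space M \<Longrightarrow> y \<in> space M \<Longrightarrow> Z x = Z y \<Longrightarrow> Y x = Y y"
  shows "ent M Y \<le> ent M Z"
proof -
  have "real (card (Y ` (Z -` {Z x} \<inter> space M))) \<le> 1" if "x \<in> space M" for x
  proof -
    have "Y y = Y x" if "y \<in> Z -` {Z x} \<inter> space M" for y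
      using that \<open>x \<in> space M\<close> by (intro det) simp_all
    hence "Y ` (Z -` {Z x} \<inter> space M) \<subseteq> {Y x}" by blast
    from card_mono[OF _ this] show ?thesis by simp
  qed
  from ent_le_fibres[OF Y Z _ this] show ?thesis by simp
qed

lemma ent_le_ln_card:
  assumes Y: "simple_function M Y" and S: "finite S" "Y ` space M \<subseteq> S"
  shows "ent M Y \<le> ln (real (card S))"
proof -
  have ne: "S \<noteq> {}" using S not_empty by auto
  have "ent M (\<lambda>_. ()) = 0" unfolding ent_def using prob_space not_empty by (simp add: eta_def vimage_def)
  moreover have "ent M Y \<le> ent M (\<lambda>_. ()) + ln (real (card S))"
  proof (rule ent_le_fibres[OF Y])
    show "0 < real (card S)" using ne S by (simp add: card_gt_0_iff)
    show "real (card (Y ` ((\<lambda>_. ()) -` {()} \<inter> space M))) \<le> real (card S)"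
      using S by (auto intro!: card_mono)
  qed simp
  ultimately show ?thesis by simp
qed

end

section \<open>Subshifts and cylinders\<close>

definition word :: "seq \<Rightarrow> nat \<Rightarrow> nat \<Rightarrow> nat list" where
  "word x i n = map x [i..<i + n]"

definition words :: "nat \<Rightarrow> nat \<Rightarrow> nat list set" where
  "words m n = {w. set w \<subseteq> {1..m} \<and> length w = n}"

definition itin :: "(seq \<Rightarrow> 'b) \<Rightarrow> nat \<Rightarrow> seq \<Rightarrow> 'b list" where
  "itin Y n x = map (\<lambda>i. Y ((shift ^^ i) x)) [0..<n]"

lemma length_word [simp]: "length (word x i n) = n" by (simp add: word_def)

lemma nth_word [simp]: "k < n \<Longrightarrow> word x i n ! k = x (i + k)" by (simp add: word_def)

lemma word_0 [simp]: "word x i 0 = []" by (simp add: word_def)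

lemma shift_pow: "(shift ^^ j) x = (\<lambda>k. x (j + k))"
  by (induction j arbitrary: x) (simp_all add: shift_def funpow_swap1)

lemma word_shift_pow [simp]: "word ((shift ^^ j) x) i n = word x (j + i) n"
  by (rule nth_equalityI) (simp_all add: shift_pow add.assoc)

lemma word_append: "word x i (n + k) = word x i n @ word x (i + n) k"
  by (rule nth_equalityI) (simp_all add: nth_append add.assoc)

lemma take_word: "take k (word x i n) = word x i (min k n)"
  by (rule nth_equalityI) simp_all

lemma drop_word: "drop k (word x i n) = word x (i + k) (n - k)"
  by (rule nth_equalityI) (simp_all add: add.assoc)

lemma word_eqD: "word x i n = word y j n \<Longrightarrow> k < n \<Longrightarrow> x (i + k) = y (j + k)"
  by (metis nth_word)

lemma word_mono_eq: "word x i n = word y j n \<Longrightarrow> k \<le> n \<Longrightarrow> word x i k = word y j k"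
  by (metis take_word min.absorb1)

lemma word_eq_sub: "word x i n = word y j n \<Longrightarrow> k + l \<le> n \<Longrightarrow> word x (i + k) l = word y (j + k) l"
  by (rule nth_equalityI) (auto simp: add.assoc intro: word_eqD)

lemma finite_words [simp]: "finite (words m n)"
  unfolding words_def by (rule finite_lists_length_eq) simp

lemma card_words: "card (words m n) = m ^ n"
  unfolding words_def by (subst card_lists_length_eq) simp_all

lemma length_itin [simp]: "length (itin Y n x) = n" by (simp add: itin_def)

lemma nth_itin [simp]: "k < n \<Longrightarrow> itin Y n x ! k = Y ((shift ^^ k) x)" by (simp add: itin_def)

lemma itin_append: "itin Y (n + k) x = itin Y n x @ itin Y k ((shift ^^ n) x)"
  by (rule nth_equalityI) (auto simp: nth_append shift_pow add.assoc)

lemma itin_word: "itin (\<lambda>x. x 0) n x = word x 0 n"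
  by (rule nth_equalityI) (simp_all add: shift_pow)

text \<open>Finitely many coordinates in a discrete alphabet are involved. As \<open>B\<close> is
  arbitrary, the complement is a set of the same form, so these sets are also closed.\<close>

lemma open_word: "open {x :: seq. word x i n \<in> B}"
proof -
  have "open {x :: seq. x k = a}" for k a
  proof -
    have "continuous_on UNIV (\<lambda>x :: seq. x k)" by simp
    hence "open ((\<lambda>x :: seq. x k) -` {a})" by (rule open_vimage[rotated]) (rule Topological_Spaces.open_discrete)
    thus ?thesis by (simp add: vimage_def)
  qed
  hence "open (\<Inter>k<n. {x :: seq. x (i + k) = w ! k})" for w by (intro open_INT) auto
  moreover have "{x :: seq. word x i n = w} = (\<Inter>k<n. {x :: seq. x (i + k) = w ! k})" if "length w = n" for w
    using that nth_word[of _ n _ i] by (auto intro!: nth_equalityI simp del: nth_word) metis+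
  ultimately have "open {x :: seq. word x i n = w}" if "length w = n" for w using that by simp
  moreover have "{x :: seq. word x i n \<in> B} = (\<Union>w\<in>{w\<in>B. length w = n}. {x. word x i n = w})" by auto
  ultimately show ?thesis by auto
qed

section \<open>Cylinders and Borel sets of a subshift\<close>

locale subshift =
  fixes m :: nat and X :: "seq set"
  assumes shift_space: "shift_space m X"
begin

lemma X_ne: "X \<noteq> {}" and X_full: "x \<in> X \<Longrightarrow> x j \<in> {1..m}" and compact_X: "compact X"
  and shift_X: "x \<in> X \<Longrightarrow> shift x \<in> X"
  using shift_space by (auto simp: shift_space_def full_shift_def)

lemma m_pos: "m \<ge> 1"
proof -
  obtain x where "x \<in> X" using X_ne by auto
  from X_full[OF this, of 0] show ?thesis by auto
qed

lemma shift_pow_X: "x \<in> X \<Longrightarrow> (shift ^^ j) x \<in> X"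
  by (induction j) (simp_all add: shift_X)

lemma word_words: "x \<in> X \<Longrightarrow> word x i n \<in> words m n"
  using X_full by (fastforce simp: words_def word_def)

lemma closed_X: "closed X"
proof -
  have "\<exists>U V. open U \<and> open V \<and> x \<in> U \<and> y \<in> V \<and> disjnt U V" if "x \<noteq> y" for x y :: nat
    using that by (intro exI[of _ "{x}"] exI[of _ "{y}"]) (auto simp: Topological_Spaces.open_discrete)
  hence "Hausdorff_space (euclidean :: nat topology)"
    unfolding Hausdorff_space_def by simp
  hence "Hausdorff_space (euclidean :: seq topology)"
    unfolding euclidean_product_topology[symmetric] Hausdorff_space_product_topology by simp
  hence "closedin (euclidean :: seq topology) X"
    using compact_X by (intro compactin_imp_closedin) simp_all
  thus ?thesis by simp
qed

lemma X_borel [measurable]: "X \<in> sets borel"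
  using closed_X by (rule borel_closed)

text \<open>A whole set \<open>B\<close> of words is allowed, not just one word. Together with
  padding to a common length this makes the cylinders an algebra, as needed for approximation in
  measure and for Caratheodory's extension.\<close>

definition cyl :: "nat \<Rightarrow> nat list set \<Rightarrow> seq set" where
  "cyl k B = {x \<in> X. word x 0 k \<in> B}"

lemma cyl_mono: "k \<le> l \<Longrightarrow> cyl k B = cyl l {w. take k w \<in> B}"
  by (auto simp: cyl_def take_word)

lemma cyl_Int: "cyl k B \<inter> cyl l C = cyl (max k l) {w. take k w \<in> B \<and> take l w \<in> C}"
  by (auto simp: cyl_def take_word)

lemma cyl_Un: "cyl k B \<union> cyl l C = cyl (max k l) {w. take k w \<in> B \<or> take l w \<in> C}"
  by (auto simp: cyl_def take_word)

lemma cyl_Diff: "cyl k B - cyl l C = cyl (max k l) {w. take k w \<in> B \<and> take l w \<notin> C}"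
  by (auto simp: cyl_def take_word)

lemma word_set_borel: "{x \<in> X. word x i k \<in> B} \<in> sets (restrict_space borel X)"
proof -
  have "{x \<in> X. word x i k \<in> B} = {x. word x i k \<in> B} \<inter> X" by auto
  thus ?thesis using open_word[of i k B] by (auto simp: sets_restrict_space_iff)
qed

lemma sets_cyl: "sets (restrict_space borel X) = sigma_sets X {C. \<exists>k B. C = cyl k B}"
proof
  let ?G = "{C. \<exists>k B. C = cyl k B}"
  interpret G: sigma_algebra X "sigma_sets X ?G"
    by (rule sigma_algebra_sigma_sets) (auto simp: cyl_def)
  have "A \<inter> X \<in> sigma_sets X ?G" if "A \<in> sets (borel :: seq measure)" for A
  proof -
    have "A \<in> sigma_sets (\<Pi>\<^sub>E i\<in>UNIV. space borel) {{f\<in>\<Pi>\<^sub>E i\<in>UNIV. space (borel :: nat measure). f i \<in> A} | i A. i \<in> UNIV \<and> A \<in> sets borel}"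
      using that unfolding sets_PiM_equal_borel[symmetric] sets_PiM_single by simp
    thus ?thesis
    proof (induction A)
      case (Basic a)
      then obtain i A where a: "a = {f. f i \<in> A}" by auto
      \<comment> \<open>Coordinate \<open>i\<close> is the last symbol of the prefix of length
        \<open>Suc i\<close>.\<close>
      have "a \<inter> X = cyl (Suc i) {w. w ! i \<in> A}" unfolding a cyl_def by auto
      thus ?case by auto
    next
      case Empty
      show ?case by (simp add: sigma_sets.Empty)
    next
      case (Compl a)
      have "((\<Pi>\<^sub>E i\<in>UNIV. space borel) - a) \<inter> X = X - (a \<inter> X)" by auto
      thus ?case using sigma_sets.Compl[OF Compl.IH] by simp
    next
      case (Union a)
      have "(\<Union> (range a)) \<inter> X = (\<Union>i. a i \<inter> X)" by auto
      thus ?case using sigma_sets.Union[OF Union.IH] by simp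
    qed
  qed
  thus "sets (restrict_space borel X) \<subseteq> sigma_sets X ?G"
    by (auto simp: sets_restrict_space Int_commute)
  have "?G \<subseteq> sets (restrict_space borel X)"
    using word_set_borel[of 0] by (auto simp: cyl_def)
  hence "sigma_sets X ?G \<subseteq> sigma_sets (space (restrict_space borel X)) (sets (restrict_space borel X))"
    by (simp add: space_restrict_space sigma_sets_mono')
  thus "sigma_sets X ?G \<subseteq> sets (restrict_space borel X)"
    unfolding sets.sigma_sets_eq .
qed

lemma borel_probD:
  assumes "\<mu> \<in> borel_prob_on X"
  shows "prob_space \<mu>" "space \<mu> = X" "sets \<mu> = sets (restrict_space borel X)"
  using assms by (auto simp: borel_prob_on_def)

lemma invD:
  assumes "\<mu> \<in> invariant_measures X" shows "\<mu> \<in> borel_prob_on X"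
  using assms by (auto simp: invariant_measures_def)

lemma cyl_sets: "\<mu> \<in> borel_prob_on X \<Longrightarrow> cyl k B \<in> sets \<mu>"
  using word_set_borel[of 0] by (auto simp: cyl_def borel_probD)

lemma word_set_sets: "\<mu> \<in> borel_prob_on X \<Longrightarrow> {x \<in> X. word x i k \<in> B} \<in> sets \<mu>"
  using word_set_borel by (auto simp: borel_probD)

lemma simple_word:
  assumes "\<mu> \<in> borel_prob_on X" shows "simple_function \<mu> (\<lambda>x. f (word x i n))"
proof -
  have "(\<lambda>x. f (word x i n)) ` X \<subseteq> f ` words m n" using word_words by auto
  hence "finite ((\<lambda>x. f (word x i n)) ` X)" by (rule finite_subset) simp
  moreover have "(\<lambda>x. f (word x i n)) -` {y} \<inter> X \<in> sets \<mu>" for y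
  proof -
    have eq: "(\<lambda>x. f (word x i n)) -` {y} \<inter> X = {x \<in> X. word x i n \<in> {w. f w = y}}" by auto
    show ?thesis unfolding eq by (rule word_set_sets[OF assms])
  qed
  ultimately show ?thesis unfolding simple_function_def by (simp add: borel_probD(2)[OF assms])
qed

lemma shift_measurable:
  assumes "\<mu> \<in> borel_prob_on X" "A \<in> sets \<mu>" shows "(shift ^^ j) -` A \<inter> X \<in> sets \<mu>"
proof -
  have "A \<in> sigma_sets X {C. \<exists>k B. C = cyl k B}" using assms sets_cyl by (simp add: borel_probD)
  hence "(shift ^^ j) -` A \<inter> X \<in> sets (restrict_space borel X)"
  proof (induction A)
    case (Basic a)
    then obtain k B where "a = cyl k B" by auto
    hence "(shift ^^ j) -` a \<inter> X = {x \<in> X. word x j k \<in> B}" using shift_pow_X by (auto simp: cyl_def)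
    thus ?case using word_set_borel by simp
  next
    case (Compl a)
    have "(shift ^^ j) -` (X - a) \<inter> X = X - ((shift ^^ j) -` a \<inter> X)" using shift_pow_X by auto
    moreover have "X \<in> sets (restrict_space borel X)" using sets.top[of "restrict_space borel X"]
      by (simp add: space_restrict_space)
    ultimately show ?case using Compl by auto
  next
    case (Union a)
    have "(shift ^^ j) -` (\<Union> (range a)) \<inter> X = (\<Union>i. (shift ^^ j) -` a i \<inter> X)" by auto
    moreover have "(\<Union>i. (shift ^^ j) -` a i \<inter> X) \<in> sets (restrict_space borel X)"
      using Union.IH by blast
    ultimately show ?case by metis
  qed auto
  thus ?thesis using assms by (simp add: borel_probD)
qed

lemma inv_measure:
  assumes "\<mu> \<in> invariant_measures X" "A \<in> sets \<mu>"
  shows "measure \<mu> ((shift ^^ j) -` A \<inter> X) = measure \<mu> A"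
proof (induction j)
  case 0
  have "A \<subseteq> X" using sets.sets_into_space[OF assms(2)] borel_probD(2)[OF invD[OF assms(1)]] by simp
  thus ?case by (simp add: Int_absorb2)
next
  case (Suc j)
  let ?B = "(shift ^^ j) -` A \<inter> X"
  have "(shift ^^ Suc j) -` A \<inter> X = shift -` ?B \<inter> X"
    using shift_X by (auto simp: funpow_swap1)
  moreover have "emeasure \<mu> (shift -` ?B \<inter> X) = emeasure \<mu> ?B"
    using shift_measurable[OF invD[OF assms(1)] assms(2)] assms(1)
    unfolding invariant_measures_def by blast
  ultimately have "measure \<mu> ((shift ^^ Suc j) -` A \<inter> X) = measure \<mu> ?B" by (simp only: measure_def)
  thus ?case using Suc by (simp only:)
qed

section \<open>Entropy of itineraries\<close>

lemma simple_shift: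
  assumes "\<mu> \<in> borel_prob_on X" "simple_function \<mu> Y"
  shows "simple_function \<mu> (\<lambda>x. Y ((shift ^^ j) x))"
proof -
  note [simp] = borel_probD(2)[OF assms(1)]
  have "(\<lambda>x. Y ((shift ^^ j) x)) ` X \<subseteq> Y ` X" using shift_pow_X by auto
  moreover have "finite (Y ` X)" using simple_functionD(1)[OF assms(2)] by simp
  ultimately have "finite ((\<lambda>x. Y ((shift ^^ j) x)) ` X)" by (rule finite_subset)
  moreover have "(\<lambda>x. Y ((shift ^^ j) x)) -` {y} \<inter> X \<in> sets \<mu>" for y
  proof -
    have "(\<lambda>x. Y ((shift ^^ j) x)) -` {y} \<inter> X = (shift ^^ j) -` (Y -` {y} \<inter> X) \<inter> X"
      using shift_pow_X by auto
    moreover have "Y -` {y} \<inter> X \<in> sets \<mu>" using simple_functionD(2)[OF assms(2)] by simp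
    ultimately show ?thesis using shift_measurable[OF assms(1)] by metis
  qed
  ultimately show ?thesis unfolding simple_function_def by simp
qed

lemma ent_shift:
  assumes "\<mu> \<in> invariant_measures X" "simple_function \<mu> Y"
  shows "ent \<mu> (\<lambda>x. Y ((shift ^^ j) x)) = ent \<mu> Y"
proof -
  note bp = invD[OF assms(1)]
  interpret prob_space \<mu> using borel_probD[OF bp] by simp
  note [simp] = borel_probD(2)[OF bp]
  have fin: "finite (Y ` X)" using simple_functionD(1)[OF assms(2)] by simp
  have "Y -` {y} \<inter> X \<in> sets \<mu>" for y using simple_functionD(2)[OF assms(2)] by simp
  from inv_measure[OF assms(1) this]
  have e: "measure \<mu> ((shift ^^ j) -` (Y -` {y} \<inter> X) \<inter> X) = measure \<mu> (Y -` {y} \<inter> X)" for y .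
  have "(\<lambda>x. Y ((shift ^^ j) x)) -` {y} \<inter> X = (shift ^^ j) -` (Y -` {y} \<inter> X) \<inter> X" for y
    using shift_pow_X by auto
  hence e': "measure \<mu> ((\<lambda>x. Y ((shift ^^ j) x)) -` {y} \<inter> X) = measure \<mu> (Y -` {y} \<inter> X)" for y
    using e by simp
  have "ent \<mu> (\<lambda>x. Y ((shift ^^ j) x)) = (\<Sum>v\<in>Y ` X. eta (measure \<mu> ((\<lambda>x. Y ((shift ^^ j) x)) -` {v} \<inter> space \<mu>)))"
    by (rule ent_superset[OF fin]) (use shift_pow_X in auto)
  also have "\<dots> = ent \<mu> Y" unfolding ent_def using e' by simp
  finally show ?thesis .
qed

lemma simple_itin:
  assumes "\<mu> \<in> borel_prob_on X" "simple_function \<mu> Y"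
  shows "simple_function \<mu> (itin Y n)"
proof (induction n)
  case 0
  have "itin Y 0 = (\<lambda>_. [])" by (auto simp: itin_def)
  thus ?case by simp
next
  case (Suc n)
  have "itin Y (Suc n) = (\<lambda>x. itin Y n x @ [Y ((shift ^^ n) x)])" by (auto simp: itin_def)
  thus ?case using simple_function_compose2[OF Suc simple_shift[OF assms], of "\<lambda>a b. a @ [b]"] by simp
qed

text \<open>The last \<open>k\<close> labels form the itinerary of the shifted point, which has the
  same entropy by invariance. With Fekete's lemma this gives the existence of all entropy
  rates.\<close>

lemma ent_itin_subadd:
  assumes "\<mu> \<in> invariant_measures X" "simple_function \<mu> Y"
  shows "ent \<mu> (itin Y (n + k)) \<le> ent \<mu> (itin Y n) + ent \<mu> (itin Y k)"
proof -
  note bp = invD[OF assms(1)]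
  interpret prob_space \<mu> using borel_probD[OF bp] by simp
  note s = simple_itin[OF bp assms(2)]
  note s' = simple_shift[OF bp s[of k], of n]
  have "ent \<mu> (itin Y (n + k)) \<le> ent \<mu> (\<lambda>x. (itin Y n x, itin Y k ((shift ^^ n) x)))"
    by (rule ent_function_le[OF s simple_function_Pair[OF s s']]) (simp add: itin_append)
  also have "\<dots> \<le> ent \<mu> (itin Y n) + ent \<mu> (\<lambda>x. itin Y k ((shift ^^ n) x))"
    by (rule ent_pair_le[OF s s'])
  also have "ent \<mu> (\<lambda>x. itin Y k ((shift ^^ n) x)) = ent \<mu> (itin Y k)"
    by (rule ent_shift[OF assms(1) s])
  finally show ?thesis .
qed

definition block_ent :: "seq measure \<Rightarrow> nat \<Rightarrow> real" where
  "block_ent \<mu> n = ent \<mu> (\<lambda>x. word x 0 n)"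

lemma block_ent_itin: "block_ent \<mu> n = ent \<mu> (itin (\<lambda>x. x 0) n)"
proof -
  have "(\<lambda>x. word x 0 n) = itin (\<lambda>x. x 0) n" by (simp add: itin_word fun_eq_iff)
  thus ?thesis by (simp add: block_ent_def)
qed

lemma simple_coord: "\<mu> \<in> borel_prob_on X \<Longrightarrow> simple_function \<mu> (\<lambda>x. x 0)"
  using simple_word[of \<mu> hd 0 1] by (simp add: word_def)

lemma ent_itin_rate:
  assumes "\<mu> \<in> invariant_measures X" "simple_function \<mu> Y"
  shows "\<exists>l. (\<lambda>n. ent \<mu> (itin Y n) / real n) \<longlonglongrightarrow> l \<and> (\<forall>n. l * real n \<le> ent \<mu> (itin Y n))"
proof (rule fekete)
  show "ent \<mu> (itin Y (n + k)) \<le> ent \<mu> (itin Y n) + ent \<mu> (itin Y k)" for n k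
    by (rule ent_itin_subadd[OF assms])
  interpret prob_space \<mu> using borel_probD[OF invD[OF assms(1)]] by simp
  show "0 \<le> ent \<mu> (itin Y n)" for n by (rule ent_nonneg)
qed

lemma ent_itin_le:
  assumes "\<mu> \<in> invariant_measures X" "simple_function \<mu> Y"
  shows "ent \<mu> (itin Y n) \<le> real n * ent \<mu> Y"
proof (induction n)
  case 0
  interpret prob_space \<mu> using borel_probD[OF invD[OF assms(1)]] by simp
  have "ent \<mu> (itin Y 0) \<le> ln (real (card {[] :: 'a list}))"
    by (rule ent_le_ln_card[OF simple_itin[OF invD[OF assms(1)] assms(2)]]) (auto simp: itin_def)
  thus ?case by simp
next
  case (Suc n)
  interpret prob_space \<mu> using borel_probD[OF invD[OF assms(1)]] by simp
  have "ent \<mu> (itin Y 1) \<le> ent \<mu> Y"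
    by (rule ent_function_le[OF simple_itin[OF invD[OF assms(1)] assms(2)] assms(2)]) (simp add: itin_def)
  thus ?case using ent_itin_subadd[OF assms, of n 1] Suc by (simp add: algebra_simps)
qed

text \<open>The measurable sets that can be approximated contain the cylinders and are closed under
  complements and countable unions. This carries statements about finite words over to arbitrary
  partitions and to invariant sets.\<close>

lemma approx_by_cyl:
  assumes mu: "\<mu> \<in> borel_prob_on X" and A: "A \<in> sets \<mu>" and d: "\<delta> > 0"
  shows "\<exists>k B. measure \<mu> ((A - cyl k B) \<union> (cyl k B - A)) < \<delta>"
proof -
  interpret prob_space \<mu> using borel_probD[OF mu] by simp
  have c: "cyl k B \<in> events" for k B by (rule cyl_sets[OF mu])
  define S where "S A = (\<forall>\<delta>>0. \<exists>k B. prob ((A - cyl k B) \<union> (cyl k B - A)) < \<delta>)" for A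
  have S_Un: "S (A \<union> B)" if "S A" "S B" "A \<in> events" "B \<in> events" for A B
    unfolding S_def
  proof (intro allI impI)
    fix \<delta> :: real assume "\<delta> > 0"
    hence d2: "\<delta> / 2 > 0" by simp
    obtain k E where E: "prob ((A - cyl k E) \<union> (cyl k E - A)) < \<delta> / 2"
      using \<open>S A\<close> d2 unfolding S_def by blast
    obtain l F where F: "prob ((B - cyl l F) \<union> (cyl l F - B)) < \<delta> / 2"
      using \<open>S B\<close> d2 unfolding S_def by blast
    let ?C = "cyl (max k l) {w. take k w \<in> E \<or> take l w \<in> F}"
    have C: "?C = cyl k E \<union> cyl l F" by (rule cyl_Un[symmetric])
    have "prob (((A \<union> B) - ?C) \<union> (?C - (A \<union> B))) \<le>
      prob (((A - cyl k E) \<union> (cyl k E - A)) \<union> ((B - cyl l F) \<union> (cyl l F - B)))"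
      using that c unfolding C by (intro finite_measure_mono sets.Un sets.Diff) auto
    also have "\<dots> \<le> prob ((A - cyl k E) \<union> (cyl k E - A)) + prob ((B - cyl l F) \<union> (cyl l F - B))"
      using that c by (intro measure_Un_le sets.Un sets.Diff) auto
    also have "\<dots> < \<delta>" using E F by simp
    finally show "\<exists>k C. prob (((A \<union> B) - cyl k C) \<union> (cyl k C - (A \<union> B))) < \<delta>" by blast
  qed
  have "A \<in> sigma_sets X {C. \<exists>k B. C = cyl k B}" using A sets_cyl by (simp add: borel_probD[OF mu])
  hence "A \<in> events \<and> S A"
  proof (induction A)
    case (Basic a)
    then obtain k B where a: "a = cyl k B" by auto
    show ?case unfolding S_def a using c by (auto intro!: exI[of _ k] exI[of _ B])
  next
    case Empty
    have "({} - cyl 0 {}) \<union> (cyl 0 {} - {}) = {}" by (simp add: cyl_def)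
    thus ?case unfolding S_def by (metis measure_empty sets.empty_sets)
  next
    case (Compl a)
    have aX: "a \<subseteq> X" using Compl.IH sets.sets_into_space borel_probD(2)[OF mu] by blast
    \<comment> \<open>The complement of a cylinder is a cylinder of the same length, and passing to
      complements leaves the symmetric difference unchanged.\<close>
    have "((X - a) - cyl k (- B)) \<union> (cyl k (- B) - (X - a)) = (a - cyl k B) \<union> (cyl k B - a)" for k B
      using aX by (auto simp: cyl_def)
    hence "S (X - a)" using Compl.IH unfolding S_def by metis
    moreover have "X - a \<in> events" using Compl.IH sets.compl_sets borel_probD(2)[OF mu] by metis
    ultimately show ?case by simp
  next
    case (Union a)
    have ev: "a i \<in> events" for i using Union.IH by blast
    \<comment> \<open>Continuity from below replaces the countable union by a finite one at a cost
      below \<delta> / 2; finite unions are handled by \<open>S_Un\<close>.\<close>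
    define U where "U n = (\<Union>i<n. a i)" for n
    have U: "U n \<in> events \<and> S (U n)" for n
    proof (induction n)
      case 0
      have "({} - cyl 0 {}) \<union> (cyl 0 {} - {}) = {}" by (simp add: cyl_def)
      hence "S {}" unfolding S_def by (metis measure_empty)
      thus ?case by (simp add: U_def)
    next
      case (Suc n)
      have "U (Suc n) = U n \<union> a n" unfolding U_def by (auto simp: lessThan_Suc)
      thus ?case using Suc S_Un Union.IH by auto
    qed
    have un: "(\<Union>(range a)) \<in> events" using ev by auto
    have "(\<lambda>n. prob (U n)) \<longlonglongrightarrow> prob (\<Union>n. U n)"
    proof (rule finite_Lim_measure_incseq)
      show "incseq U" unfolding incseq_def U_def by (auto dest: less_le_trans)
    qed (use U in auto)
    moreover have UU: "(\<Union>n. U n) = \<Union>(range a)" unfolding U_def by auto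
    ultimately have lim: "(\<lambda>n. prob (U n)) \<longlonglongrightarrow> prob (\<Union>(range a))" by simp
    have "S (\<Union>(range a))" unfolding S_def
    proof (intro allI impI)
      fix \<delta> :: real assume "\<delta> > 0"
      hence d2: "\<delta> / 2 > 0" by simp
      obtain n where n: "\<bar>prob (U n) - prob (\<Union>(range a))\<bar> < \<delta> / 2"
        using LIMSEQ_D[OF lim d2] by auto
      obtain k E where E: "prob ((U n - cyl k E) \<union> (cyl k E - U n)) < \<delta> / 2"
        using U[of n] d2 unfolding S_def by blast
      have Un: "U n \<subseteq> \<Union>(range a)" by (auto simp: U_def)
      have "prob ((\<Union>(range a) - cyl k E) \<union> (cyl k E - \<Union>(range a)))
        \<le> prob ((\<Union>(range a) - U n) \<union> ((U n - cyl k E) \<union> (cyl k E - U n)))"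
        using Un U c un by (intro finite_measure_mono sets.Un sets.Diff) auto
      also have "\<dots> \<le> prob (\<Union>(range a) - U n) + prob ((U n - cyl k E) \<union> (cyl k E - U n))"
        using U c un by (intro measure_Un_le sets.Un sets.Diff) auto
      also have "prob (\<Union>(range a) - U n) = prob (\<Union>(range a)) - prob (U n)"
        using Un U un by (intro finite_measure_Diff) auto
      finally show "\<exists>k B. prob ((\<Union>(range a) - cyl k B) \<union> (cyl k B - \<Union>(range a))) < \<delta>"
        using n E by (intro exI[of _ k] exI[of _ E]) linarith
    qed
    thus ?case using un by simp
  qed
  thus ?thesis using d unfolding S_def by blast
qed

end

section \<open>Kolmogorov--Sinai entropy of a subshift\<close>

context subshift
begin

definition entropy_rate :: "seq measure \<Rightarrow> real" where
  "entropy_rate \<mu> = lim (\<lambda>n. block_ent \<mu> n / real n)"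

lemma
  assumes "\<mu> \<in> invariant_measures X"
  shows entropy_rate_lim: "(\<lambda>n. block_ent \<mu> n / real n) \<longlonglongrightarrow> entropy_rate \<mu>"
    and entropy_rate_le: "entropy_rate \<mu> * real n \<le> block_ent \<mu> n"
proof -
  obtain l where l: "(\<lambda>n. block_ent \<mu> n / real n) \<longlonglongrightarrow> l" "\<And>n. l * real n \<le> block_ent \<mu> n"
    using ent_itin_rate[OF assms simple_coord[OF invD[OF assms]]] unfolding block_ent_itin by blast
  have "entropy_rate \<mu> = l" unfolding entropy_rate_def using l(1) by (rule limI)
  thus "(\<lambda>n. block_ent \<mu> n / real n) \<longlonglongrightarrow> entropy_rate \<mu>" "entropy_rate \<mu> * real n \<le> block_ent \<mu> n"
    using l by auto
qed

text \<open>\<open>eta\<close> is continuous and vanishes at 0 and at 1. Hence a function that takes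
  one value except on a set of small measure, and finitely many values there, has small
  entropy.\<close>

lemma small_eta:
  assumes "(e::real) > 0"
  shows "\<exists>d>0. d < 1 \<and> (\<forall>t. 0 \<le> t \<and> t \<le> d \<longrightarrow> eta t < e \<and> eta (1 - t) < e)"
proof -
  have "(eta \<longlongrightarrow> eta 0) (at 0 within {0..})" "(eta \<longlongrightarrow> eta 1) (at 1 within {0..})"
    using bspec[OF continuous_eta[unfolded continuous_on], of 0]
      bspec[OF continuous_eta[unfolded continuous_on], of 1] by simp_all
  hence 1: "\<forall>\<^sub>F t in at 0 within {0..}. dist (eta t) 0 < e" "\<forall>\<^sub>F t in at 1 within {0..}. dist (eta t) 0 < e"
    using assms by (auto dest!: tendstoD[of _ _ _ e] simp: eta_def[of 1])
  obtain d1 where d1: "d1 > 0" "\<And>t. t \<in> {0..} \<Longrightarrow> t \<noteq> 0 \<and> dist t 0 < d1 \<Longrightarrow> dist (eta t) 0 < e"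
    using 1(1) unfolding eventually_at by blast
  obtain d2 where d2: "d2 > 0" "\<And>t. t \<in> {0..} \<Longrightarrow> t \<noteq> 1 \<and> dist t 1 < d2 \<Longrightarrow> dist (eta t) 0 < e"
    using 1(2) unfolding eventually_at by blast
  define d where "d = min (1/2) (min d1 d2 / 2)"
  have d: "d > 0" "d < 1" "d < d1" "d < d2" using d1(1) d2(1) by (auto simp: d_def min_def)
  have "eta t < e \<and> eta (1 - t) < e" if "0 \<le> t" "t \<le> d" for t
  proof (cases "t = 0")
    case True thus ?thesis using assms by (simp add: eta_def)
  next
    case False
    have "dist (eta t) 0 < e" using that d False by (intro d1(2)) auto
    moreover have "dist (eta (1 - t)) 0 < e" using that d False by (intro d2(2)) (auto simp: dist_real_def)
    ultimately show ?thesis by (auto simp: dist_real_def)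
  qed
  thus ?thesis using d by blast
qed

lemma approx_simple:
  assumes mu: "\<mu> \<in> borel_prob_on X" and Y: "simple_function \<mu> Y" and d: "\<delta> > 0"
  shows "\<exists>k Z. (\<forall>x. Z x \<in> Y ` X) \<and> measure \<mu> {x \<in> X. Y x \<noteq> Z (word x 0 k)} < \<delta>"
proof -
  interpret prob_space \<mu> using borel_probD[OF mu] by simp
  note [simp] = borel_probD(2)[OF mu]
  have fin: "finite (Y ` X)" using simple_functionD(1)[OF Y] by simp
  have ne: "Y ` X \<noteq> {}" using X_ne by simp
  define N where "N = card (Y ` X)"
  have N: "N > 0" using fin ne by (simp add: N_def card_gt_0_iff)
  define A where "A v = Y -` {v} \<inter> X" for v
  have A: "A v \<in> events" for v unfolding A_def using simple_functionD(2)[OF Y, of "{v}"] by simp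
  have "\<forall>v. \<exists>k B. prob ((A v - cyl k B) \<union> (cyl k B - A v)) < \<delta> / N"
    using d N A by (intro allI approx_by_cyl[OF mu]) auto
  then obtain k B where kB: "\<And>v. prob ((A v - cyl (k v) (B v)) \<union> (cyl (k v) (B v) - A v)) < \<delta> / N"
    by metis
  \<comment> \<open>Pads all approximating cylinders to one common word length.\<close>
  define K where "K = Max (k ` Y ` X)"
  define B' where "B' v = {w. take (k v) w \<in> B v}" for v
  have kK: "k v \<le> K" if "v \<in> Y ` X" for v unfolding K_def using fin that by (intro Max_ge) auto
  have cB: "cyl (k v) (B v) = cyl K (B' v)" if "v \<in> Y ` X" for v
    unfolding B'_def by (rule cyl_mono[OF kK[OF that]])
  obtain v0 where v0: "v0 \<in> Y ` X" using ne by blast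
  define Z where "Z w = (if \<exists>v\<in>Y ` X. w \<in> B' v then SOME v. v \<in> Y ` X \<and> w \<in> B' v else v0)" for w
  have ZX: "Z w \<in> Y ` X" for w
  proof (cases "\<exists>v\<in>Y ` X. w \<in> B' v")
    case True
    hence "\<exists>v. v \<in> Y ` X \<and> w \<in> B' v" by blast
    from someI_ex[OF this] True show ?thesis by (simp add: Z_def)
  qed (use v0 in \<open>auto simp: Z_def\<close>)
  \<comment> \<open>A word may lie in several of the sets \<open>B' v\<close> or in none, and there
    \<open>Z\<close> is an arbitrary choice. This is harmless: if a point lies in none of the
    symmetric differences, its word lies in \<open>B' v\<close> exactly for v = Y x.\<close>
  have "{x \<in> X. Y x \<noteq> Z (word x 0 K)} \<subseteq> (\<Union>v\<in>Y ` X. (A v - cyl K (B' v)) \<union> (cyl K (B' v) - A v))"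
  proof
    fix x assume "x \<in> {x \<in> X. Y x \<noteq> Z (word x 0 K)}"
    hence x: "x \<in> X" "Y x \<noteq> Z (word x 0 K)" by auto
    show "x \<in> (\<Union>v\<in>Y ` X. (A v - cyl K (B' v)) \<union> (cyl K (B' v) - A v))"
    proof (rule ccontr)
      assume n: "\<not> ?thesis"
      have iff: "x \<in> A v \<longleftrightarrow> x \<in> cyl K (B' v)" if "v \<in> Y ` X" for v using n that by blast
      have iff': "Y x = v \<longleftrightarrow> word x 0 K \<in> B' v" if "v \<in> Y ` X" for v
        using iff[OF that] x(1) by (simp add: A_def cyl_def)
      have "Y x \<in> Y ` X \<and> word x 0 K \<in> B' (Y x)" using iff'[of "Y x"] x(1) by auto
      hence "(SOME v. v \<in> Y ` X \<and> word x 0 K \<in> B' v) = Y x"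
      proof (rule some_equality)
        fix v assume "v \<in> Y ` X \<and> word x 0 K \<in> B' v"
        thus "v = Y x" using iff'[of v] by simp
      qed
      hence "Z (word x 0 K) = Y x" unfolding Z_def using iff'[of "Y x"] x(1) by auto
      thus False using x(2) by simp
    qed
  qed
  hence "prob {x \<in> X. Y x \<noteq> Z (word x 0 K)} \<le> prob (\<Union>v\<in>Y ` X. (A v - cyl K (B' v)) \<union> (cyl K (B' v) - A v))"
    using fin A cyl_sets[OF mu] by (intro finite_measure_mono sets.finite_UN) auto
  also have "\<dots> \<le> (\<Sum>v\<in>Y ` X. prob ((A v - cyl K (B' v)) \<union> (cyl K (B' v) - A v)))"
    using fin A cyl_sets[OF mu] by (intro measure_UNION_le) auto
  also have "\<dots> < (\<Sum>v\<in>Y ` X. \<delta> / N)"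
    using kB cB by (intro sum_strict_mono fin ne) metis
  also have "\<dots> = \<delta>" using N by (simp add: N_def)
  finally show ?thesis using ZX by blast
qed

text \<open>The partition \<open>Y\<close> is approximated by a function \<open>Z\<close> of a finite word, and \<open>D\<close> records the errors.
  Since \<open>Y\<close> is a function of \<open>(Z, D)\<close> and \<open>D\<close> has small entropy, no conditional entropy is needed.\<close>

lemma ent_itin_le_block:
  assumes mu: "\<mu> \<in> invariant_measures X" and Y: "simple_function \<mu> Y" and e: "e > 0"
  shows "\<exists>c. \<forall>n. ent \<mu> (itin Y n) \<le> block_ent \<mu> n + c + real n * e"
proof -
  note bp = invD[OF mu]
  interpret prob_space \<mu> using borel_probD[OF bp] by simp
  note [simp] = borel_probD(2)[OF bp]
  have fin: "finite (Y ` X)" using simple_functionD(1)[OF Y] by simp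
  \<comment> \<open>Number of values of the error function \<open>D\<close>: one for each value of
    \<open>Y\<close>, and \<open>None\<close> for agreement. Each is to contribute at most e /
    N.\<close>
  define N where "N = real (card (Y ` X)) + 1"
  have "e / N > 0" using e by (simp add: N_def add_nonneg_pos)
  from small_eta[OF this] obtain \<delta> where \<delta>: "\<delta> > 0" "\<delta> < 1"
    "\<And>t. 0 \<le> t \<Longrightarrow> t \<le> \<delta> \<Longrightarrow> eta t < e / N \<and> eta (1 - t) < e / N" by blast
  obtain k Z where Z: "\<And>x. Z x \<in> Y ` X" and d: "prob {x \<in> X. Y x \<noteq> Z (word x 0 k)} < \<delta>"
    using approx_simple[OF bp Y \<delta>(1)] by blast
  define Z' where "Z' x = Z (word x 0 k)" for x
  have sZ: "simple_function \<mu> Z'" unfolding Z'_def by (rule simple_word[OF bp])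
  define D where "D x = (if Y x = Z' x then None else Some (Y x))" for x
  have "D = (\<lambda>x. (\<lambda>a b. if a = b then None else Some a) (Y x) (Z' x))" by (auto simp: D_def)
  with simple_function_compose2[OF Y sZ, of "\<lambda>a b. if a = b then None else Some a"]
  have sD: "simple_function \<mu> D" by simp
  have ev: "D -` V \<inter> X \<in> events" for V using simple_functionD(2)[OF sD] by simp
  have nN: "D -` (- {None}) \<inter> X = {x \<in> X. Y x \<noteq> Z (word x 0 k)}" by (auto simp: D_def Z'_def)
  have small: "prob (D -` (- {None}) \<inter> X) < \<delta>" using d nN by simp
  have S: "prob (D -` {Some v} \<inter> X) \<le> \<delta>" for v
  proof -
    have "prob (D -` {Some v} \<inter> X) \<le> prob (D -` (- {None}) \<inter> X)"
      by (intro finite_measure_mono ev) auto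
    thus ?thesis using small by simp
  qed
  have "prob (D -` {None} \<inter> X) = 1 - prob (D -` (- {None}) \<inter> X)"
  proof -
    have "D -` {None} \<inter> X = space \<mu> - (D -` (- {None}) \<inter> X)" by auto
    thus ?thesis using prob_compl[OF ev] by metis
  qed
  hence None: "eta (prob (D -` {None} \<inter> X)) < e / N"
    using \<delta>(3)[of "prob (D -` (- {None}) \<inter> X)"] small by simp
  have "ent \<mu> D = (\<Sum>v\<in>insert None (Some ` Y ` X). eta (prob (D -` {v} \<inter> space \<mu>)))"
    using fin by (intro ent_superset) (auto simp: D_def)
  also have "\<dots> \<le> (\<Sum>v\<in>insert None (Some ` Y ` X). e / N)"
    using None \<delta>(3)[OF _ S] by (intro sum_mono) (auto intro: less_imp_le)
  also have "\<dots> = e"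
  proof -
    have "card (insert None (Some ` Y ` X)) = card (Y ` X) + 1"
      using fin by (subst card_insert_disjoint) (auto simp: card_image)
    hence "real (card (insert None (Some ` Y ` X))) = N" by (simp add: N_def)
    moreover have "N > 0" by (simp add: N_def add_nonneg_pos)
    ultimately show ?thesis by simp
  qed
  finally have entD: "ent \<mu> D \<le> e" .
  have "ent \<mu> (itin Y n) \<le> block_ent \<mu> n + block_ent \<mu> k + real n * e" for n
  proof -
    note sI = simple_itin[OF bp]
    have "ent \<mu> (itin Y n) \<le> ent \<mu> (\<lambda>x. (itin Z' n x, itin D n x))"
    proof (rule ent_function_le[OF sI[OF Y] simple_function_Pair[OF sI[OF sZ] sI[OF sD]]])
      fix x y assume "(itin Z' n x, itin D n x) = (itin Z' n y, itin D n y)"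
      hence z: "itin Z' n x = itin Z' n y" and dd: "itin D n x = itin D n y" by auto
      show "itin Y n x = itin Y n y"
      proof (rule nth_equalityI)
        fix i assume "i < length (itin Y n x)"
        hence i: "i < n" by simp
        have "Z' ((shift ^^ i) x) = Z' ((shift ^^ i) y)" using z i by (metis nth_itin)
        moreover have "D ((shift ^^ i) x) = D ((shift ^^ i) y)" using dd i by (metis nth_itin)
        ultimately show "itin Y n x ! i = itin Y n y ! i" using i
          by (auto simp: D_def split: if_splits)
      qed simp
    qed
    also have "\<dots> \<le> ent \<mu> (itin Z' n) + ent \<mu> (itin D n)" by (rule ent_pair_le[OF sI[OF sZ] sI[OF sD]])
    also have "ent \<mu> (itin D n) \<le> real n * ent \<mu> D" by (rule ent_itin_le[OF mu sD])
    also have "\<dots> \<le> real n * e" using entD by (intro mult_left_mono) auto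
    \<comment> \<open>The labels at times below \<open>n\<close> read only symbols at positions
      below n + k.\<close>
    also have "ent \<mu> (itin Z' n) \<le> ent \<mu> (\<lambda>x. word x 0 (n + k))"
    proof (rule ent_function_le[OF sI[OF sZ] simple_word[OF bp, of "\<lambda>w. w"]])
      fix x y assume w: "word x 0 (n + k) = word y 0 (n + k)"
      show "itin Z' n x = itin Z' n y"
      proof (rule nth_equalityI)
        fix i assume "i < length (itin Z' n x)"
        thus "itin Z' n x ! i = itin Z' n y ! i" using word_eq_sub[OF w, of i k] by (simp add: Z'_def)
      qed simp
    qed
    also have "\<dots> \<le> block_ent \<mu> n + block_ent \<mu> k"
      using ent_itin_subadd[OF mu simple_coord[OF bp], of n k] unfolding block_ent_itin[symmetric]
      by (simp add: block_ent_def)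
    finally show ?thesis by simp
  qed
  hence "\<forall>n. ent \<mu> (itin Y n) \<le> block_ent \<mu> n + block_ent \<mu> k + real n * e" by blast
  thus ?thesis by blast
qed

lemma rate_le_entropy_rate:
  assumes mu: "\<mu> \<in> invariant_measures X" and Y: "simple_function \<mu> Y"
  shows "lim (\<lambda>n. ent \<mu> (itin Y n) / real n) \<le> entropy_rate \<mu>"
proof (rule field_le_epsilon)
  fix e :: real assume e: "e > 0"
  obtain l where l: "(\<lambda>n. ent \<mu> (itin Y n) / real n) \<longlonglongrightarrow> l"
    using ent_itin_rate[OF mu Y] by blast
  obtain c where c: "\<And>n. ent \<mu> (itin Y n) \<le> block_ent \<mu> n + c + real n * e"
    using ent_itin_le_block[OF mu Y e] by blast
  have "(\<lambda>n. block_ent \<mu> n / real n + c / real n + e) \<longlonglongrightarrow> entropy_rate \<mu> + 0 + e"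
    by (intro tendsto_intros entropy_rate_lim[OF mu] lim_const_over_n)
  hence "l \<le> entropy_rate \<mu> + 0 + e"
  proof (rule LIMSEQ_le[OF l])
    show "\<exists>N. \<forall>n\<ge>N. ent \<mu> (itin Y n) / real n \<le> block_ent \<mu> n / real n + c / real n + e"
    proof (intro exI[of _ 1] allI impI)
      fix n :: nat assume "n \<ge> 1"
      thus "ent \<mu> (itin Y n) / real n \<le> block_ent \<mu> n / real n + c / real n + e"
        using c[of n] by (simp add: field_simps)
    qed
  qed
  thus "lim (\<lambda>n. ent \<mu> (itin Y n) / real n) \<le> entropy_rate \<mu> + e" using limI[OF l] by simp
qed

text \<open>A point is labelled by its own cell. The nonempty elements of \<open>join_iter\<close>
  then correspond one to one to itineraries; the empty set may be an element too and contributes eta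
  0 = 0.\<close>

lemma partition_label:
  assumes bp: "\<mu> \<in> borel_prob_on X" and P: "finite_partition \<mu> P"
  shows "\<exists>Y. (\<forall>x\<in>X. Y x \<in> P \<and> x \<in> Y x) \<and> simple_function \<mu> Y
    \<and> (\<forall>n. part_entropy \<mu> (join_iter X n P) = ent \<mu> (itin Y n))"
proof -
  interpret prob_space \<mu> using borel_probD[OF bp] by simp
  note [simp] = borel_probD(2)[OF bp]
  have fP: "finite P" and PX: "\<Union>P = X" and dP: "disjoint P" and PS: "P \<subseteq> events"
    using P by (auto simp: finite_partition_def)
  have "\<forall>x\<in>X. \<exists>A\<in>P. x \<in> A" using PX by blast
  then obtain Y where Y: "\<And>x. x \<in> X \<Longrightarrow> Y x \<in> P \<and> x \<in> Y x" by metis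
  have uniq: "Y x = A" if "x \<in> X" "A \<in> P" "x \<in> A" for x A
    using Y[OF that(1)] that dP unfolding disjoint_def by blast
  have fib: "Y -` {A} \<inter> X = A" if "A \<in> P" for A
    using Y uniq that PX by blast
  have sY: "simple_function \<mu> Y" unfolding simple_function_def
  proof (intro conjI ballI)
    have "Y ` X \<subseteq> P" using Y by auto
    thus "finite (Y ` space \<mu>)" using fP by (auto intro: finite_subset)
    fix v assume "v \<in> Y ` space \<mu>"
    hence "v \<in> P" using Y by auto
    thus "Y -` {v} \<inter> space \<mu> \<in> events" using fib PS by auto
  qed
  have "part_entropy \<mu> (join_iter X n P) = ent \<mu> (itin Y n)" for n
  proof -
    define F where "F v = itin Y n -` {v} \<inter> X" for v
    define cell where "cell f = X \<inter> (\<Inter>i<n. (shift ^^ i) -` f i)" for f :: "nat \<Rightarrow> seq set"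
    have J: "join_iter X n P = {cell f | f. \<forall>i<n. f i \<in> P}" by (simp add: join_iter_def cell_def)
    have cell: "x \<in> cell f \<longleftrightarrow> x \<in> X \<and> itin Y n x = map f [0..<n]" if "\<forall>i<n. f i \<in> P" for x f
    proof -
      have "x \<in> cell f \<longleftrightarrow> x \<in> X \<and> (\<forall>i<n. (shift ^^ i) x \<in> f i)" by (auto simp: cell_def)
      also have "\<dots> \<longleftrightarrow> x \<in> X \<and> (\<forall>i<n. Y ((shift ^^ i) x) = f i)"
        using Y uniq that shift_pow_X by metis
      finally show ?thesis by (auto simp: itin_def)
    qed
    have cellF: "cell f = F (map f [0..<n])" if "\<forall>i<n. f i \<in> P" for f
      using cell[OF that] by (auto simp: F_def)
    have r: "F ` (itin Y n ` X) \<subseteq> join_iter X n P"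
    proof safe
      fix x assume x: "x \<in> X"
      let ?f = "\<lambda>i. Y ((shift ^^ i) x)"
      have "\<forall>i<n. ?f i \<in> P" using Y shift_pow_X x by blast
      hence "cell ?f \<in> join_iter X n P" "cell ?f = F (map ?f [0..<n])" using cellF[of ?f] unfolding J by blast+
      thus "F (itin Y n x) \<in> join_iter X n P" by (simp add: itin_def)
    qed
    have r2: "A = {}" if A: "A \<in> join_iter X n P" "A \<notin> F ` (itin Y n ` X)" for A
    proof (rule ccontr)
      assume "A \<noteq> {}"
      then obtain x where x: "x \<in> A" by blast
      obtain f where f: "A = cell f" "\<forall>i<n. f i \<in> P" using A(1) J by auto
      have "x \<in> X" "itin Y n x = map f [0..<n]" using x f cell by auto
      moreover have "A = F (map f [0..<n])" using f cellF by simp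
      ultimately show False using A(2) by (metis imageI)
    qed
    have finI: "finite (itin Y n ` X)" using simple_functionD(1)[OF simple_itin[OF bp sY, of n]] by simp
    have finJ: "finite (join_iter X n P)"
    proof (rule finite_subset)
      show "join_iter X n P \<subseteq> insert {} (F ` (itin Y n ` X))" using r2 by blast
    qed (use finI in simp)
    have inj: "inj_on F (itin Y n ` X)"
    proof (rule inj_onI)
      fix u v assume "u \<in> itin Y n ` X" "v \<in> itin Y n ` X" "F u = F v"
      thus "u = v" unfolding F_def by blast
    qed
    have "part_entropy \<mu> (join_iter X n P) = (\<Sum>A\<in>F ` (itin Y n ` X). eta (prob A))"
      unfolding part_entropy_def
    proof (rule sum.mono_neutral_right[OF finJ r], safe)
      fix A assume "A \<in> join_iter X n P" "A \<notin> F ` itin Y n ` X"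
      hence "A = {}" by (rule r2)
      thus "eta (prob A) = 0" by simp
    qed
    also have "\<dots> = (\<Sum>v\<in>itin Y n ` X. eta (prob (F v)))" using inj by (simp add: sum.reindex)
    also have "\<dots> = ent \<mu> (itin Y n)" by (simp add: ent_def F_def)
    finally show ?thesis .
  qed
  thus ?thesis using Y sY by blast
qed

text \<open>The partition by the first symbol generates, so its rate attains the supremum;
  \<open>rate_le_entropy_rate\<close> bounds all other partitions. From here on entropy is computed
  from blocks alone.\<close>

theorem ks_entropy_eq:
  assumes mu: "\<mu> \<in> invariant_measures X"
  shows "ks_entropy X \<mu> = entropy_rate \<mu>"
proof -
  note bp = invD[OF mu]
  interpret prob_space \<mu> using borel_probD[OF bp] by simp
  note [simp] = borel_probD(2)[OF bp]
  have le: "partition_entropy_rate X \<mu> P \<le> entropy_rate \<mu>" if P: "finite_partition \<mu> P" for P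
  proof -
    obtain Y :: "seq \<Rightarrow> seq set" where Y: "simple_function \<mu> Y" "\<forall>n. part_entropy \<mu> (join_iter X n P) = ent \<mu> (itin Y n)"
      using partition_label[OF bp P] by (elim exE conjE)
    show ?thesis unfolding partition_entropy_rate_def Y(2)[rule_format] by (rule rate_le_entropy_rate[OF mu Y(1)])
  qed
  \<comment> \<open>A symbol with which no point of \<open>X\<close> begins gives the empty cell.
    Several such symbols give the same set, so disjointness is not affected.\<close>
  define P0 where "P0 = (\<lambda>a. cyl 1 {[a]}) ` {1..m}"
  have x_cyl: "x \<in> cyl 1 {[a]} \<longleftrightarrow> x \<in> X \<and> x 0 = a" for x a by (auto simp: cyl_def word_def)
  have P0: "finite_partition \<mu> P0" unfolding finite_partition_def
  proof (intro conjI)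
    show "finite P0" "P0 \<subseteq> events" using cyl_sets[OF bp] by (auto simp: P0_def)
    show "\<Union>P0 = space \<mu>" using X_full x_cyl by (auto simp: P0_def)
    show "disjoint P0" unfolding disjoint_def
    proof (intro ballI impI)
      fix A B assume "A \<in> P0" "B \<in> P0" "A \<noteq> B"
      then obtain a b where ab: "A = cyl 1 {[a]}" "B = cyl 1 {[b]}" unfolding P0_def by blast
      with \<open>A \<noteq> B\<close> have "a \<noteq> b" by blast
      thus "A \<inter> B = {}" unfolding ab by (auto simp: x_cyl simp del: One_nat_def)
    qed
  qed
  obtain Y where Y: "\<And>x. x \<in> X \<Longrightarrow> Y x \<in> P0 \<and> x \<in> Y x" "simple_function \<mu> Y"
    "\<And>n. part_entropy \<mu> (join_iter X n P0) = ent \<mu> (itin Y n)"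
    using partition_label[OF bp P0] by blast
  have Yx: "Y x = cyl 1 {[x 0]}" if "x \<in> X" for x
  proof -
    have "Y x \<in> P0" "x \<in> Y x" using Y(1) \<open>x \<in> X\<close> by auto
    then obtain a where a: "Y x = cyl 1 {[a]}" unfolding P0_def by blast
    with \<open>x \<in> Y x\<close> x_cyl have "x 0 = a" by auto
    with a show ?thesis by simp
  qed
  have Y_eq: "Y x = Y y \<longleftrightarrow> x 0 = y 0" if "x \<in> X" "y \<in> X" for x y
    using Yx[OF that(1)] Yx[OF that(2)] x_cyl that by metis
  have "ent \<mu> (itin Y n) = ent \<mu> (itin (\<lambda>x. x 0) n)" for n
  proof (rule antisym)
    have *: "itin Y n x = itin Y n y \<longleftrightarrow> itin (\<lambda>x. x 0) n x = itin (\<lambda>x. x 0) n y" if "x \<in> X" "y \<in> X" for x y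
      using Y_eq[OF shift_pow_X[OF that(1)] shift_pow_X[OF that(2)]] by (simp add: itin_def)
    note s = simple_itin[OF bp Y(2)] simple_itin[OF bp simple_coord[OF bp]]
    show "ent \<mu> (itin Y n) \<le> ent \<mu> (itin (\<lambda>x. x 0) n)"
      by (rule ent_function_le[OF s]) (use * in simp)
    show "ent \<mu> (itin (\<lambda>x. x 0) n) \<le> ent \<mu> (itin Y n)"
      by (rule ent_function_le[OF s(2,1)]) (use * in simp)
  qed
  hence "partition_entropy_rate X \<mu> P0 = entropy_rate \<mu>"
    unfolding partition_entropy_rate_def Y(3) entropy_rate_def block_ent_itin by simp
  moreover have "partition_entropy_rate X \<mu> P0 \<le> ks_entropy X \<mu>"
    unfolding ks_entropy_def using P0 le by (intro cSUP_upper bdd_aboveI2) auto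
  moreover have "ks_entropy X \<mu> \<le> entropy_rate \<mu>"
    unfolding ks_entropy_def using P0 le by (intro cSUP_least) auto
  ultimately show ?thesis by simp
qed

end

section \<open>Weak limits of empirical measures\<close>

text \<open>On the support of a finitely supported law every function is simple, so \<open>ent\<close> makes sense
  for words, which have infinite range on the whole of \<open>seq\<close>.\<close>

definition fin_space :: "'a pmf \<Rightarrow> 'a measure" where
  "fin_space q = restrict_space (measure_pmf q) (set_pmf q)"

lemma space_fin_space [simp]: "space (fin_space q) = set_pmf q"
  by (simp add: fin_space_def space_restrict_space)

lemma sets_fin_space [simp]: "sets (fin_space q) = Pow (set_pmf q)"
  by (auto simp: fin_space_def sets_restrict_space)

lemma prob_space_fin_space: "prob_space (fin_space q)"
  unfolding fin_space_def
  by (intro prob_space_restrict_space) (simp_all add: measure_pmf.emeasure_eq_measure measure_pmf.prob_eq_1 AE_measure_pmf)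

lemma measure_fin_space: "A \<subseteq> set_pmf q \<Longrightarrow> measure (fin_space q) A = measure_pmf.prob q A"
  unfolding fin_space_def by (intro measure_restrict_space) auto

lemma simple_fin_space: "finite (set_pmf q) \<Longrightarrow> simple_function (fin_space q) Y"
  by (auto simp: simple_function_def)

lemma ent_fin_space:
  assumes "finite S" "Y ` set_pmf q \<subseteq> S"
  shows "ent (fin_space q) Y = (\<Sum>v\<in>S. eta (measure_pmf.prob q (Y -` {v})))"
proof -
  interpret prob_space "fin_space q" by (rule prob_space_fin_space)
  have "measure (fin_space q) (Y -` {v} \<inter> set_pmf q) = measure_pmf.prob q (Y -` {v})" for v
    by (subst measure_fin_space) (auto simp: measure_Int_set_pmf)
  thus ?thesis using ent_superset[of S Y] assms by simp
qed

lemma prob_fibres_sum: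
  assumes "finite S" "Y ` set_pmf q \<subseteq> S"
  shows "measure_pmf.prob q {x. Y x \<in> B} = (\<Sum>v\<in>S \<inter> B. measure_pmf.prob q (Y -` {v}))"
proof -
  have "measure_pmf.prob q {x. Y x \<in> B} = measure_pmf.prob q ({x. Y x \<in> B} \<inter> set_pmf q)"
    by (rule measure_Int_set_pmf[symmetric])
  also have "{x. Y x \<in> B} \<inter> set_pmf q = (\<Union>v\<in>S \<inter> B. Y -` {v}) \<inter> set_pmf q" using assms(2) by auto
  also have "measure_pmf.prob q \<dots> = measure_pmf.prob q (\<Union>v\<in>S \<inter> B. Y -` {v})"
    by (rule measure_Int_set_pmf)
  also have "\<dots> = (\<Sum>v\<in>S \<inter> B. measure_pmf.prob q (Y -` {v}))"
    using assms(1) by (intro measure_pmf.finite_measure_finite_Union) (auto simp: disjoint_family_on_def)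
  finally show ?thesis .
qed

text \<open>The empirical measure of the first \<open>N\<close> shifts of a point, averaged over a
  random point of law \<open>q\<close>.\<close>

definition time_avg :: "nat \<Rightarrow> seq pmf \<Rightarrow> seq pmf" where
  "time_avg N q = bind_pmf (pmf_of_set {..<N}) (\<lambda>i. map_pmf (shift ^^ i) q)"

lemma prob_time_avg:
  assumes "N > 0"
  shows "measure_pmf.prob (time_avg N q) A = (\<Sum>i<N. measure_pmf.prob q ((shift ^^ i) -` A)) / N"
proof -
  have "emeasure (time_avg N q) A = (\<integral>\<^sup>+i. emeasure (map_pmf (shift ^^ i) q) A \<partial>pmf_of_set {..<N})"
    unfolding time_avg_def by (rule emeasure_bind_pmf)
  also have "\<dots> = (\<Sum>i<N. emeasure (map_pmf (shift ^^ i) q) A) / N"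
    using assms by (subst nn_integral_pmf_of_set) auto
  also have "\<dots> = (\<Sum>i<N. ennreal (measure_pmf.prob q ((shift ^^ i) -` A))) / N"
    by (simp add: measure_pmf.emeasure_eq_measure)
  also have "\<dots> = ennreal ((\<Sum>i<N. measure_pmf.prob q ((shift ^^ i) -` A)) / N)"
    using assms by (subst sum_ennreal) (auto simp: divide_ennreal ennreal_of_nat_eq_real_of_nat sum_nonneg)
  finally show ?thesis by (simp add: measure_pmf.emeasure_eq_measure sum_nonneg)
qed

lemma set_time_avg: "N > 0 \<Longrightarrow> set_pmf (time_avg N q) = (\<Union>i<N. (shift ^^ i) ` set_pmf q)"
  unfolding time_avg_def by (subst set_bind_pmf, subst set_pmf_of_set) auto

context subshift
begin

lemma ent_fin_word:
  assumes "set_pmf q \<subseteq> X"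
  shows "ent (fin_space q) (\<lambda>x. word x i n) = (\<Sum>v\<in>words m n. eta (measure_pmf.prob q {x. word x i n = v}))"
proof -
  have "ent (fin_space q) (\<lambda>x. word x i n) = (\<Sum>v\<in>words m n. eta (measure_pmf.prob q ((\<lambda>x. word x i n) -` {v})))"
    using word_words assms by (intro ent_fin_space) auto
  thus ?thesis by (simp add: vimage_def)
qed

section \<open>Limit measures built from their values on cylinders\<close>

lemma prob_cyl_eq:
  assumes "set_pmf q \<subseteq> X"
  shows "measure_pmf.prob q {x. word x 0 n \<in> B} = measure_pmf.prob q (cyl n B)"
proof -
  have "{x. word x 0 n \<in> B} \<inter> set_pmf q = cyl n B \<inter> set_pmf q" using assms by (auto simp: cyl_def)
  thus ?thesis by (metis measure_Int_set_pmf)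
qed

lemma prob_cyl_sum:
  assumes "set_pmf q \<subseteq> X"
  shows "measure_pmf.prob q (cyl n B) = (\<Sum>w\<in>words m n \<inter> B. measure_pmf.prob q (cyl n {w}))"
proof -
  have "measure_pmf.prob q {x. word x 0 n \<in> B} = (\<Sum>w\<in>words m n \<inter> B. measure_pmf.prob q ((\<lambda>x. word x 0 n) -` {w}))"
    using assms word_words by (intro prob_fibres_sum) auto
  moreover have "measure_pmf.prob q ((\<lambda>x. word x 0 n) -` {w}) = measure_pmf.prob q (cyl n {w})" for w
    using prob_cyl_eq[OF assms, of n "{w}"] by (simp add: vimage_def)
  ultimately show ?thesis using prob_cyl_eq[OF assms] by simp
qed

text \<open>The probabilities of all single-word cylinders form a point of a product of unit
  intervals. There are countably many words, so this compact product is metrizable and a convergent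
  subsequence exists. A general cylinder is a finite disjoint union of single-word ones up to null
  sets of the laws.\<close>

lemma cylinder_subsequence:
  fixes \<rho> :: "nat \<Rightarrow> seq pmf"
  assumes "\<And>J. set_pmf (\<rho> J) \<subseteq> X"
  shows "\<exists>r L. strict_mono (r :: nat \<Rightarrow> nat) \<and> (\<forall>k B. (\<lambda>J. measure_pmf.prob (\<rho> (r J)) (cyl k B)) \<longlonglongrightarrow> L k B)"
proof -
  define h where "h J w = measure_pmf.prob (\<rho> J) (cyl (length w) {w})" for J and w :: "nat list"
  have "compactin (product_topology (\<lambda>_ :: nat list. euclideanreal) UNIV) (PiE UNIV (\<lambda>_. {0..1::real}))"
    unfolding compactin_PiE by simp
  hence "compact (PiE UNIV (\<lambda>_ :: nat list. {0..1::real}))"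
    unfolding euclidean_product_topology by simp
  hence sc: "seq_compact (PiE UNIV (\<lambda>_ :: nat list. {0..1::real}))"
    by (simp add: compact_eq_seq_compact_metric)
  have "h J \<in> PiE UNIV (\<lambda>_. {0..1})" for J by (auto simp: h_def)
  then obtain l r where l: "strict_mono (r :: nat \<Rightarrow> nat)" "(h \<circ> r) \<longlonglongrightarrow> l"
    using seq_compactE[OF sc, of h] by metis
  have hl: "(\<lambda>J. h (r J) w) \<longlonglongrightarrow> l w" for w
  proof -
    have "isCont (\<lambda>f :: nat list \<Rightarrow> real. f w) l"
    proof -
      have "continuous_on UNIV (\<lambda>f :: nat list \<Rightarrow> real. f w)" by (rule continuous_on_product_coordinates)
      from this[THEN continuous_on_eq_continuous_at[OF open_UNIV, THEN iffD1]] show ?thesis by blast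
    qed
    from isCont_tendsto_compose[OF this l(2)] show ?thesis by simp
  qed
  have "(\<lambda>J. measure_pmf.prob (\<rho> (r J)) (cyl k B)) \<longlonglongrightarrow> (\<Sum>w\<in>words m k \<inter> B. l w)" for k B
  proof -
    have "(\<lambda>J. \<Sum>w\<in>words m k \<inter> B. h (r J) w) \<longlonglongrightarrow> (\<Sum>w\<in>words m k \<inter> B. l w)"
      by (intro tendsto_sum hl)
    moreover have "measure_pmf.prob (\<rho> (r J)) (cyl k B) = (\<Sum>w\<in>words m k \<inter> B. h (r J) w)" for J
      by (rule trans[OF prob_cyl_sum[OF assms]], intro sum.cong) (auto simp: words_def h_def)
    ultimately show ?thesis by simp
  qed
  thus ?thesis using l(1) by (intro exI[of _ r] exI[of _ "\<lambda>k B. \<Sum>w\<in>words m k \<inter> B. l w"]) simp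
qed

lemma closed_cyl: "closed (cyl k B)"
proof -
  have "cyl k B = X \<inter> - {x. word x 0 k \<in> - B}" by (auto simp: cyl_def)
  moreover have "closed (- {x. word x 0 k \<in> - B})" using open_word by (rule closed_Compl)
  ultimately show ?thesis using closed_X by (metis closed_Int)
qed

lemma cyl_empty: "{} = cyl 0 {}" by (simp add: cyl_def)

lemma X_cyl: "X = cyl 0 UNIV" by (simp add: cyl_def)

text \<open>Cylinders are closed in the compact \<open>X\<close>, so the finite intersection
  property applies. This provides the continuity at the empty set that Caratheodory's theorem asks
  for.\<close>

lemma decseq_cyl_empty:
  assumes "range A \<subseteq> {C. \<exists>k B. C = cyl k B}" "decseq A" "(\<Inter>i. A i) = {}"
  shows "\<exists>i. A i = {}"
proof (rule ccontr)
  assume ne: "\<not> ?thesis"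
  have sub: "A i \<subseteq> X" for i using assms(1) by (auto simp: cyl_def image_subset_iff)
  have "X \<inter> \<Inter>(range A) \<noteq> {}"
  proof (rule compact_imp_fip[OF compact_X])
    fix T assume "T \<in> range A" thus "closed T" using assms(1) closed_cyl by auto
  next
    fix F' assume "finite F'" "F' \<subseteq> range A"
    then obtain I where I: "finite I" "F' = A ` I" by (auto dest: finite_subset_image)
    define n where "n = Max (insert 0 I)"
    have "A n \<subseteq> A i" if "i \<in> I" for i
      using assms(2) I(1) that unfolding n_def decseq_def by (auto intro!: Max_ge)
    moreover obtain x where "x \<in> A n" using ne by blast
    ultimately have "x \<in> X \<inter> \<Inter>F'" using sub I by auto
    thus "X \<inter> \<Inter>F' \<noteq> {}" by blast
  qed
  thus False using assms(3) by simp
qed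

text \<open>The limits on cylinders are finitely additive, and on cylinders continuity at the empty
  set is automatic by compactness. The limit measure is their Caratheodory extension.\<close>

lemma weak_limit:
  fixes \<rho> :: "nat \<Rightarrow> seq pmf"
  assumes \<rho>: "\<And>J. set_pmf (\<rho> J) \<subseteq> X"
  shows "\<exists>r \<nu>. strict_mono (r :: nat \<Rightarrow> nat) \<and> \<nu> \<in> borel_prob_on X \<and>
    (\<forall>k B. (\<lambda>J. measure_pmf.prob (\<rho> (r J)) (cyl k B)) \<longlonglongrightarrow> measure \<nu> (cyl k B))"
proof -
  obtain r L where r: "strict_mono (r :: nat \<Rightarrow> nat)"
    and L: "\<And>k B. (\<lambda>J. measure_pmf.prob (\<rho> (r J)) (cyl k B)) \<longlonglongrightarrow> L k B"
    using cylinder_subsequence[of \<rho>, OF \<rho>] by blast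
  define E where "E = {C. \<exists>k B. C = cyl k B}"
  \<comment> \<open>\<open>lim\<close> is total, but \<open>f\<close> is meaningful only on the
    algebra \<open>E\<close>, where the limits are known to exist.\<close>
  define f where "f A = lim (\<lambda>J. measure_pmf.prob (\<rho> (r J)) A)" for A
  have f: "(\<lambda>J. measure_pmf.prob (\<rho> (r J)) A) \<longlonglongrightarrow> f A" if AE: "A \<in> E" for A
  proof -
    obtain k B where "A = cyl k B" using AE by (auto simp: E_def)
    hence "(\<lambda>J. measure_pmf.prob (\<rho> (r J)) A) \<longlonglongrightarrow> L k B" using L by simp
    thus ?thesis unfolding f_def by (simp add: limI)
  qed
  have f0: "f A \<ge> 0" if "A \<in> E" for A using f[OF that] by (rule LIMSEQ_le_const) simp
  have fe: "f {} = 0" unfolding f_def by simp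
  have fX: "f X = 1"
  proof -
    have "measure_pmf.prob (\<rho> (r J)) X = 1" for J
      using \<rho> by (auto simp: measure_pmf.prob_eq_1 AE_measure_pmf_iff)
    thus ?thesis unfolding f_def by simp
  qed
  interpret R: ring_of_sets X E
  proof (rule ring_of_setsI)
    show "E \<subseteq> Pow X" by (auto simp: E_def cyl_def)
    show "{} \<in> E" using cyl_empty by (auto simp: E_def)
    fix a b assume "a \<in> E" "b \<in> E"
    then obtain k B l C where "a = cyl k B" "b = cyl l C" unfolding E_def by blast
    thus "a \<union> b \<in> E" "a - b \<in> E" unfolding E_def using cyl_Un cyl_Diff by blast+
  qed
  have "\<exists>\<mu> :: seq set \<Rightarrow> ennreal. (\<forall>s \<in> E. \<mu> s = ennreal (f s)) \<and> measure_space X (sigma_sets X E) \<mu>"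
  proof (rule R.caratheodory_empty_continuous)
    show "positive E (\<lambda>s. ennreal (f s))" by (simp add: positive_def fe)
    show "additive E (\<lambda>s. ennreal (f s))" unfolding additive_def
    proof (intro ballI impI)
      fix A B assume AB: "A \<in> E" "B \<in> E" "A \<inter> B = {}"
      have "(\<lambda>J. measure_pmf.prob (\<rho> (r J)) A + measure_pmf.prob (\<rho> (r J)) B) \<longlonglongrightarrow> f A + f B"
        by (intro tendsto_add f AB)
      moreover have "measure_pmf.prob (\<rho> (r J)) A + measure_pmf.prob (\<rho> (r J)) B = measure_pmf.prob (\<rho> (r J)) (A \<union> B)" for J
        using AB by (intro measure_pmf.finite_measure_Union[symmetric]) auto
      ultimately have "f (A \<union> B) = f A + f B" using f[OF R.Un[OF AB(1,2)]] by (simp add: LIMSEQ_unique)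
      thus "ennreal (f (A \<union> B)) = ennreal (f A) + ennreal (f B)" using f0 AB by simp
    qed
    show "(\<lambda>i. ennreal (f (A i))) \<longlonglongrightarrow> 0" if A: "range A \<subseteq> E" "decseq A" "(\<Inter>i. A i) = {}" for A
    proof -
      obtain n where n: "A n = {}" using decseq_cyl_empty A unfolding E_def by blast
      have "A i = {}" if "i \<ge> n" for i using n A(2) that by (auto simp: decseq_def)
      hence "\<forall>\<^sub>F i in sequentially. ennreal (f (A i)) = 0"
        unfolding eventually_sequentially using fe by (intro exI[of _ n]) simp
      thus ?thesis by (rule tendsto_eventually)
    qed
  qed auto
  then obtain \<mu> :: "seq set \<Rightarrow> ennreal" where \<mu>: "\<And>s. s \<in> E \<Longrightarrow> \<mu> s = ennreal (f s)"
    and ms: "measure_space X (sigma_sets X E) \<mu>" by blast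
  define \<nu> where "\<nu> = measure_of X E \<mu>"
  have EX: "E \<subseteq> Pow X" by (rule R.space_closed)
  have sp: "space \<nu> = X" unfolding \<nu>_def using EX by (rule space_measure_of)
  have st: "sets \<nu> = sigma_sets X E" unfolding \<nu>_def using EX by (rule sets_measure_of)
  have em: "emeasure \<nu> A = \<mu> A" if "A \<in> sigma_sets X E" for A
    unfolding \<nu>_def using ms that EX unfolding measure_space_def
    by (intro emeasure_measure_of_sigma[of X "sigma_sets X E", simplified, THEN trans, OF _ _ _ _ refl]
        emeasure_measure_of[OF refl EX]) (auto simp: sets_measure_of)
  have emE: "emeasure \<nu> A = ennreal (f A)" if "A \<in> E" for A using em[of A] \<mu>[OF that] that by auto
  have "X \<in> E" using X_cyl by (auto simp: E_def)
  hence "emeasure \<nu> X = 1" using emE fX by simp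
  hence "prob_space \<nu>" using sp by (intro prob_spaceI) simp
  moreover have "sets \<nu> = sets (restrict_space borel X)" unfolding st E_def by (rule sets_cyl[symmetric])
  ultimately have "\<nu> \<in> borel_prob_on X" using sp by (simp add: borel_prob_on_def)
  moreover have "(\<lambda>J. measure_pmf.prob (\<rho> (r J)) (cyl k B)) \<longlonglongrightarrow> measure \<nu> (cyl k B)" for k B
  proof -
    have "cyl k B \<in> E" by (auto simp: E_def)
    thus ?thesis using f[of "cyl k B"] emE f0 by (simp add: measure_def)
  qed
  ultimately show ?thesis using r by blast
qed

text \<open>Cylinders are stable under intersection and generate the Borel sets, so agreement on
  them identifies \<nu> with its image under the shift.\<close>

lemma invariant_if_cyl:
  assumes bp: "\<nu> \<in> borel_prob_on X"
    and inv: "\<And>k B. measure \<nu> ((shift ^^ 1) -` cyl k B \<inter> X) = measure \<nu> (cyl k B)"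
  shows "\<nu> \<in> invariant_measures X"
proof -
  interpret prob_space \<nu> using borel_probD[OF bp] by simp
  note [simp] = borel_probD(2)[OF bp]
  define E where "E = {C. \<exists>k B. C = cyl k B}"
  have st: "sets \<nu> = sigma_sets X E" using borel_probD(3)[OF bp] sets_cyl by (simp add: E_def)
  have sm: "shift \<in> measurable \<nu> \<nu>"
    using shift_X shift_measurable[OF bp, of _ 1] by (intro measurableI) auto
  have "\<nu> = distr \<nu> \<nu> shift"
  proof (rule measure_eqI_generator_eq[of E X])
    show "Int_stable E"
    proof (rule Int_stableI)
      fix a b assume "a \<in> E" "b \<in> E"
      then obtain k B l C where "a = cyl k B" "b = cyl l C" unfolding E_def by blast
      thus "a \<inter> b \<in> E" unfolding E_def using cyl_Int by blast
    qed
    show "E \<subseteq> Pow X" by (auto simp: E_def cyl_def)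
    show "range (\<lambda>_. X) \<subseteq> E" using X_cyl by (auto simp: E_def)
    fix C assume "C \<in> E"
    then obtain k B where C: "C = cyl k B" by (auto simp: E_def)
    have "emeasure (distr \<nu> \<nu> shift) C = emeasure \<nu> (shift -` C \<inter> X)"
      using cyl_sets[OF bp] by (simp add: emeasure_distr[OF sm] C)
    thus "emeasure \<nu> C = emeasure (distr \<nu> \<nu> shift) C"
      using inv[of k B] C by (simp add: emeasure_eq_measure)
  qed (use st in auto)
  hence "emeasure \<nu> (shift -` A \<inter> X) = emeasure \<nu> A" if "A \<in> sets \<nu>" for A
    using emeasure_distr[OF sm that] by simp
  thus ?thesis using bp by (simp add: invariant_measures_def)
qed

lemma block_ent_sum:
  assumes bp: "\<nu> \<in> borel_prob_on X"
  shows "block_ent \<nu> n = (\<Sum>w\<in>words m n. eta (measure \<nu> (cyl n {w})))"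
proof -
  interpret prob_space \<nu> using borel_probD[OF bp] by simp
  have "(\<lambda>x. word x 0 n) -` {w} \<inter> space \<nu> = cyl n {w}" for w
    by (auto simp: cyl_def borel_probD(2)[OF bp])
  thus ?thesis unfolding block_ent_def
    using ent_superset[of "words m n" "\<lambda>x. word x 0 n"] word_words by (simp add: borel_probD(2)[OF bp] image_subset_iff)
qed

lemma block_ent_tendsto:
  assumes \<rho>: "\<And>J :: nat. set_pmf (\<rho> J) \<subseteq> X" and bp: "\<nu> \<in> borel_prob_on X"
    and lim: "\<And>k B. (\<lambda>J. measure_pmf.prob (\<rho> J) (cyl k B)) \<longlonglongrightarrow> measure \<nu> (cyl k B)"
  shows "(\<lambda>J. ent (fin_space (\<rho> J)) (\<lambda>x. word x 0 n)) \<longlonglongrightarrow> block_ent \<nu> n"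
proof -
  have "ent (fin_space (\<rho> J)) (\<lambda>x. word x 0 n) = (\<Sum>w\<in>words m n. eta (measure_pmf.prob (\<rho> J) (cyl n {w})))" for J
  proof -
    have "measure_pmf.prob (\<rho> J) {x. word x 0 n = w} = measure_pmf.prob (\<rho> J) (cyl n {w})" for w
      using prob_cyl_eq[OF \<rho>[of J], of n "{w}"] by simp
    thus ?thesis unfolding ent_fin_word[OF \<rho>] by simp
  qed
  moreover have "(\<lambda>J. \<Sum>w\<in>words m n. eta (measure_pmf.prob (\<rho> J) (cyl n {w}))) \<longlonglongrightarrow> block_ent \<nu> n"
    unfolding block_ent_sum[OF bp]
    by (intro tendsto_sum continuous_on_tendsto_compose[OF continuous_eta lim]) auto
  ultimately show ?thesis by simp
qed

section \<open>Entropy of limit measures\<close>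

lemma ent_word_le:
  assumes "finite (set_pmf q)" "set_pmf q \<subseteq> X"
  shows "ent (fin_space q) (\<lambda>x. word x i n) \<le> real n * ln (real m)"
proof -
  interpret prob_space "fin_space q" by (rule prob_space_fin_space)
  have "ent (fin_space q) (\<lambda>x. word x i n) \<le> ln (real (card (words m n)))"
    using word_words assms by (intro ent_le_ln_card simple_fin_space) auto
  thus ?thesis using m_pos by (simp add: card_words ln_realpow)
qed

lemma ent_word_subadd:
  assumes "finite (set_pmf q)"
  shows "ent (fin_space q) (\<lambda>x. word x i (n + k)) \<le> ent (fin_space q) (\<lambda>x. word x i n) + ent (fin_space q) (\<lambda>x. word x (i + n) k)"
proof -
  interpret prob_space "fin_space q" by (rule prob_space_fin_space)
  note s = simple_fin_space[OF assms]
  have "ent (fin_space q) (\<lambda>x. word x i (n + k)) \<le> ent (fin_space q) (\<lambda>x. (word x i n, word x (i + n) k))"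
    by (rule ent_function_le[OF s s]) (simp add: word_append)
  also have "\<dots> \<le> ent (fin_space q) (\<lambda>x. word x i n) + ent (fin_space q) (\<lambda>x. word x (i + n) k)"
    by (rule ent_pair_le[OF s s])
  finally show ?thesis .
qed

lemma ent_word_mono:
  assumes "finite (set_pmf q)" "n \<le> k"
  shows "ent (fin_space q) (\<lambda>x. word x i n) \<le> ent (fin_space q) (\<lambda>x. word x i k)"
proof -
  interpret prob_space "fin_space q" by (rule prob_space_fin_space)
  note s = simple_fin_space[OF assms(1)]
  show ?thesis by (rule ent_function_le[OF s s]) (rule word_mono_eq[OF _ assms(2)])
qed

text \<open>Cut the word of length \<open>N\<close> into blocks of length \<open>n\<close>, starting at each of the \<open>n\<close> possible offsets,
  and average over the offsets.\<close>

lemma misiurewicz: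
  assumes q: "finite (set_pmf q)" "set_pmf q \<subseteq> X" and n: "n > 0"
  shows "real n * ent (fin_space q) (\<lambda>x. word x 0 N)
    \<le> (\<Sum>i<N. ent (fin_space q) (\<lambda>x. word x i n)) + 2 * real n ^ 2 * ln (real m)"
proof -
  interpret prob_space "fin_space q" by (rule prob_space_fin_space)
  define g where "g i = ent (fin_space q) (\<lambda>x. word x i n)" for i
  have g_le: "g i \<le> real n * ln (real m)" for i unfolding g_def by (rule ent_word_le[OF q])
  have ln0: "ln (real m) \<ge> 0" using m_pos by simp
  \<comment> \<open>With one block more than fits, every offset covers the whole word of length
    \<open>N\<close>, and the excess is at most \<open>n\<close>.\<close>
  define K where "K = N div n + 1"
  have nK: "N \<le> n * K" "K * n \<le> N + n"
  proof -
    have a: "n * K = n * (N div n) + n" by (simp add: K_def)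
    have b: "n * (N div n) + N mod n = N" "N mod n < n" using n by simp_all
    show "N \<le> n * K" using a b by linarith
    show "K * n \<le> N + n" using a b by (simp add: mult.commute)
  qed
  \<comment> \<open>The first \<open>s\<close> symbols, before the regular blocks begin, are charged
    their maximal entropy.\<close>
  have chain: "ent (fin_space q) (\<lambda>x. word x 0 (s + k * n)) \<le> real s * ln (real m) + (\<Sum>j<k. g (s + j * n))" for s k
  proof (induction k)
    case 0 thus ?case using ent_word_le[OF q] by simp
  next
    case (Suc k)
    have "ent (fin_space q) (\<lambda>x. word x 0 (s + k * n + n)) \<le> ent (fin_space q) (\<lambda>x. word x 0 (s + k * n)) + g (s + k * n)"
      using ent_word_subadd[OF q(1), of 0 "s + k * n" n] by (simp add: g_def)
    thus ?case using Suc by (simp add: algebra_simps)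
  qed
  have "real n * ent (fin_space q) (\<lambda>x. word x 0 N) = (\<Sum>s<n. ent (fin_space q) (\<lambda>x. word x 0 N))" by simp
  also have "\<dots> \<le> (\<Sum>s<n. real n * ln (real m) + (\<Sum>j<K. g (s + j * n)))"
  proof (rule sum_mono)
    fix s assume s: "s \<in> {..<n}"
    have "N \<le> s + K * n" using nK by (simp add: algebra_simps)
    hence "ent (fin_space q) (\<lambda>x. word x 0 N) \<le> ent (fin_space q) (\<lambda>x. word x 0 (s + K * n))"
      by (rule ent_word_mono[OF q(1)])
    also have "\<dots> \<le> real s * ln (real m) + (\<Sum>j<K. g (s + j * n))" by (rule chain)
    also have "\<dots> \<le> real n * ln (real m) + (\<Sum>j<K. g (s + j * n))"
      using s ln0 by (intro add_right_mono mult_right_mono) auto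
    finally show "ent (fin_space q) (\<lambda>x. word x 0 N) \<le> real n * ln (real m) + (\<Sum>j<K. g (s + j * n))" .
  qed
  also have "\<dots> = real n ^ 2 * ln (real m) + (\<Sum>j<K. \<Sum>s<n. g (s + j * n))"
    by (subst sum.swap) (simp add: sum.distrib power2_eq_square)
  \<comment> \<open>Offset and block number together run through every start below K * n exactly
    once. The at most \<open>n\<close> starts beyond \<open>N\<close> give the second n^2 ln m of
    the error term.\<close>
  also have "(\<Sum>j<K. \<Sum>s<n. g (s + j * n)) = (\<Sum>i<K * n. g i)"
  proof -
    have "(\<Sum>s<n. g (s + j * n)) = sum g {j * n..<j * n + n}" for j
      using sum.shift_bounds_nat_ivl[of g 0 "j * n" n] by (simp add: lessThan_atLeast0 add.commute)
    thus ?thesis using sum.nat_group[of g n K] by simp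
  qed
  also have "\<dots> \<le> (\<Sum>i<N + n. g i)"
    using nK by (intro sum_mono2) (auto simp: g_def ent_nonneg)
  also have "\<dots> = (\<Sum>i<N. g i) + (\<Sum>i=N..<N + n. g i)"
    by (simp add: lessThan_atLeast0 sum.atLeastLessThan_concat)
  also have "(\<Sum>i=N..<N + n. g i) \<le> real n ^ 2 * ln (real m)"
    using sum_bounded_above[of "{N..<N + n}" g "real n * ln (real m)"] g_le by (simp add: power2_eq_square)
  finally show ?thesis unfolding g_def by (simp add: algebra_simps)
qed

text \<open>Krylov-Bogolyubov combined with the entropy estimate from Misiurewicz' proof of the
  variational principle. The last clause is quantified over \<open>c\<close> and \<open>e\<close>
  because these are chosen after \<nu> has been obtained; \<open>e\<close> absorbs costs that do not
  grow with \<open>N J\<close>.\<close>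

theorem averaging:
  fixes q :: "nat \<Rightarrow> seq pmf" and N :: "nat \<Rightarrow> nat"
  assumes fin: "\<And>J. finite (set_pmf (q J))" and qX: "\<And>J. set_pmf (q J) \<subseteq> X"
    and N0: "\<And>J. N J > 0" and N: "filterlim N at_top sequentially"
  shows "\<exists>r \<nu>. strict_mono (r :: nat \<Rightarrow> nat) \<and> \<nu> \<in> invariant_measures X \<and>
    (\<forall>k B. (\<lambda>J. measure_pmf.prob (time_avg (N (r J)) (q (r J))) (cyl k B)) \<longlonglongrightarrow> measure \<nu> (cyl k B)) \<and>
    (\<forall>c e. (\<forall>J. c * real (N J) - e \<le> ent (fin_space (q J)) (\<lambda>x. word x 0 (N J))) \<longrightarrow> c \<le> entropy_rate \<nu>)"
proof -
  define \<rho> where "\<rho> J = time_avg (N J) (q J)" for J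
  have \<rho>X: "set_pmf (\<rho> J) \<subseteq> X" for J
    unfolding \<rho>_def set_time_avg[OF N0] using qX shift_pow_X by fastforce
  obtain r \<nu> where r: "strict_mono (r :: nat \<Rightarrow> nat)" and bp: "\<nu> \<in> borel_prob_on X"
    and lim: "\<And>k B. (\<lambda>J. measure_pmf.prob (\<rho> (r J)) (cyl k B)) \<longlonglongrightarrow> measure \<nu> (cyl k B)"
    using weak_limit[of \<rho>, OF \<rho>X] by blast
  have Nr: "filterlim (\<lambda>J. real (N (r J))) at_top sequentially"
    using filterlim_compose[OF N filterlim_subseq[OF r]] by (rule filterlim_compose[OF filterlim_real_sequentially])
  have small: "(\<lambda>J. c / real (N (r J))) \<longlonglongrightarrow> 0" for c :: real
    by (rule real_tendsto_divide_at_top[OF tendsto_const Nr])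
  have inv: "\<nu> \<in> invariant_measures X"
  proof (rule invariant_if_cyl[OF bp])
    fix k B
    have eq: "(shift ^^ 1) -` cyl k B \<inter> X = cyl (Suc k) {w. drop 1 w \<in> B}"
    proof -
      have "word (shift x) 0 k = drop 1 (word x 0 (Suc k))" for x
        using word_shift_pow[of 1 x 0 k] by (simp add: drop_word)
      thus ?thesis using shift_X by (auto simp: cyl_def)
    qed
    define b where "b J i = measure_pmf.prob (q J) ((shift ^^ i) -` cyl k B)" for J i
    have p1: "measure_pmf.prob (\<rho> J) (cyl k B) = (\<Sum>i<N J. b J i) / N J" for J
      unfolding \<rho>_def b_def by (rule prob_time_avg[OF N0])
    have p2: "measure_pmf.prob (\<rho> J) (cyl (Suc k) {w. drop 1 w \<in> B}) = (\<Sum>i<N J. b J (Suc i)) / N J" for J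
    proof -
      have "measure_pmf.prob (q J) ((shift ^^ i) -` cyl (Suc k) {w. drop 1 w \<in> B}) = b J (Suc i)" for i
      proof -
        have "(shift ^^ i) -` cyl (Suc k) {w. drop 1 w \<in> B} \<inter> set_pmf (q J) = (shift ^^ Suc i) -` cyl k B \<inter> set_pmf (q J)"
          using qX[of J] shift_pow_X[of _ i] unfolding eq[symmetric] by auto
        thus ?thesis unfolding b_def by (metis measure_Int_set_pmf)
      qed
      thus ?thesis unfolding \<rho>_def prob_time_avg[OF N0] by simp
    qed
    have "(\<lambda>J. measure_pmf.prob (\<rho> (r J)) (cyl (Suc k) {w. drop 1 w \<in> B}) - measure_pmf.prob (\<rho> (r J)) (cyl k B)) \<longlonglongrightarrow> 0"
    proof (rule Lim_null_comparison[OF _ small[of 1]], intro always_eventually allI)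
      fix J
      let ?J = "r J"
      \<comment> \<open>Shifting a time average changes only its two end terms, so the defect of
        invariance is at most 1 / N.\<close>
      have "(\<Sum>i<N ?J. b ?J (Suc i)) - (\<Sum>i<N ?J. b ?J i) = b ?J (N ?J) - b ?J 0"
        by (simp add: sum_subtractf[symmetric] sum_lessThan_telescope)
      moreover have "\<bar>b ?J (N ?J) - b ?J 0\<bar> \<le> 1"
        unfolding b_def using measure_pmf.prob_le_1 measure_nonneg by (smt (verit))
      ultimately show "norm (measure_pmf.prob (\<rho> ?J) (cyl (Suc k) {w. drop 1 w \<in> B}) - measure_pmf.prob (\<rho> ?J) (cyl k B)) \<le> 1 / real (N ?J)"
        unfolding p1 p2 diff_divide_distrib[symmetric] using N0[of ?J] by (simp add: divide_right_mono)
    qed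
    moreover have "(\<lambda>J. measure_pmf.prob (\<rho> (r J)) (cyl (Suc k) {w. drop 1 w \<in> B}) - measure_pmf.prob (\<rho> (r J)) (cyl k B))
      \<longlonglongrightarrow> measure \<nu> (cyl (Suc k) {w. drop 1 w \<in> B}) - measure \<nu> (cyl k B)"
      by (intro tendsto_diff lim)
    ultimately have "measure \<nu> (cyl (Suc k) {w. drop 1 w \<in> B}) - measure \<nu> (cyl k B) = 0"
      using LIMSEQ_unique by blast
    thus "measure \<nu> ((shift ^^ 1) -` cyl k B \<inter> X) = measure \<nu> (cyl k B)" unfolding eq by simp
  qed
  have "c \<le> entropy_rate \<nu>" if c: "\<And>J. c * real (N J) - e \<le> ent (fin_space (q J)) (\<lambda>x. word x 0 (N J))" for c e
  proof -
    have le: "real n * c \<le> block_ent \<nu> n" if n: "n > 0" for n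
    proof -
      have bound: "real n * c - (real n * e + 2 * real n ^ 2 * ln (real m)) / real (N J) \<le> ent (fin_space (\<rho> J)) (\<lambda>x. word x 0 n)" for J
      proof -
        have "real n * (c * real (N J) - e) \<le> real n * ent (fin_space (q J)) (\<lambda>x. word x 0 (N J))"
          by (intro mult_left_mono c) simp
        also have "\<dots> \<le> (\<Sum>i<N J. ent (fin_space (q J)) (\<lambda>x. word x i n)) + 2 * real n ^ 2 * ln (real m)"
          by (rule misiurewicz[OF fin qX n])
        also have "(\<Sum>i<N J. ent (fin_space (q J)) (\<lambda>x. word x i n)) \<le> real (N J) * ent (fin_space (\<rho> J)) (\<lambda>x. word x 0 n)"
        proof -
          let ?p = "\<lambda>w i. measure_pmf.prob (q J) {x. word x i n = w}"
          have "(\<Sum>i<N J. ent (fin_space (q J)) (\<lambda>x. word x i n)) / real (N J) = (\<Sum>w\<in>words m n. \<Sum>i<N J. (1 / real (N J)) * eta (?p w i))"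
            unfolding ent_fin_word[OF qX] by (subst sum.swap) (simp add: sum_divide_distrib)
          \<comment> \<open>Concavity: the block entropy of the averaged law is at least the average
            of the block entropies.\<close>
          also have "\<dots> \<le> (\<Sum>w\<in>words m n. eta (\<Sum>i<N J. (1 / real (N J)) * ?p w i))"
            using N0[of J] by (intro sum_mono eta_concave) auto
          also have "\<dots> = ent (fin_space (\<rho> J)) (\<lambda>x. word x 0 n)"
          proof -
            have "measure_pmf.prob (\<rho> J) {x. word x 0 n = w} = (\<Sum>i<N J. (1 / real (N J)) * ?p w i)" for w
              unfolding \<rho>_def prob_time_avg[OF N0] by (simp add: sum_divide_distrib vimage_def)
            thus ?thesis unfolding ent_fin_word[OF \<rho>X] by simp
          qed
          finally show ?thesis using N0[of J] by (simp add: field_simps)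
        qed
        finally show ?thesis using N0[of J] by (simp add: field_simps)
      qed
      have "(\<lambda>J. real n * c - (real n * e + 2 * real n ^ 2 * ln (real m)) / real (N (r J))) \<longlonglongrightarrow> real n * c - 0"
        by (intro tendsto_diff tendsto_const small)
      moreover have "(\<lambda>J. ent (fin_space (\<rho> (r J))) (\<lambda>x. word x 0 n)) \<longlonglongrightarrow> block_ent \<nu> n"
        using block_ent_tendsto[of "\<lambda>J. \<rho> (r J)", OF \<rho>X bp lim] .
      ultimately show ?thesis using bound by (intro LIMSEQ_le[of _ "real n * c"]) auto
    qed
    show ?thesis
    proof (rule LIMSEQ_le[OF tendsto_const entropy_rate_lim[OF inv]], intro exI[of _ 1] allI impI)
      fix n :: nat assume "n \<ge> 1"
      thus "c \<le> block_ent \<nu> n / real n" using le[of n] by (simp add: field_simps)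
    qed
  qed
  thus ?thesis using r inv lim unfolding \<rho>_def by blast
qed

end

section \<open>The weak* topology and a criterion for ergodicity\<close>

text \<open>\<open>M\<close> counts starting positions, so the value depends on a finite word of
  length M + length w and is a continuous function of the point. This is why conditions on it define
  weak* open sets.\<close>

definition freq :: "nat \<Rightarrow> nat list \<Rightarrow> seq \<Rightarrow> real" where
  "freq M w x = (\<Sum>i<M. of_bool (word x i (length w) = w)) / real M"

lemma freq_word:
  "\<exists>\<Phi>. \<forall>x. freq M w x = \<Phi> (word x 0 (M + length w))"
proof (intro exI allI)
  fix x
  have "word x i (length w) = take (length w) (drop i (word x 0 (M + length w)))" if "i < M" for i
    using that by (simp add: drop_word take_word)
  thus "freq M w x = (\<lambda>u. (\<Sum>i<M. of_bool (take (length w) (drop i u) = w)) / real M) (word x 0 (M + length w))"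
    by (simp add: freq_def)
qed

lemma open_contains_word:
  assumes "open A" "x \<in> A"
  shows "\<exists>k. {y. word y 0 k = word x 0 k} \<subseteq> A"
proof -
  have "openin (product_topology (\<lambda>_ :: nat. euclidean :: nat topology) UNIV) A"
    using assms by (simp add: euclidean_product_topology)
  from product_topology_open_contains_basis[OF this assms(2)]
  obtain V where V: "x \<in> (\<Pi>\<^sub>E i\<in>UNIV. V i)" "finite {i. V i \<noteq> UNIV}" "(\<Pi>\<^sub>E i\<in>UNIV. V i) \<subseteq> A"
    by auto
  define k where "k = Suc (Max (insert 0 {i. V i \<noteq> UNIV}))"
  have lt: "i < k" if "V i \<noteq> UNIV" for i
    unfolding k_def using V(2) that by (simp add: le_imp_less_Suc)
  have "y \<in> A" if y: "word y 0 k = word x 0 k" for y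
  proof -
    have "y i \<in> V i" for i
    proof (cases "V i = UNIV")
      case False
      have "y i = x i" using word_eqD[OF y lt[OF False]] by simp
      thus ?thesis using V(1) by auto
    qed simp
    thus ?thesis using V(3) by auto
  qed
  thus ?thesis by blast
qed

context subshift
begin

section \<open>Continuous functions and neighbourhoods in terms of words\<close>

lemma continuous_on_word:
  fixes \<Phi> :: "nat list \<Rightarrow> real"
  shows "continuous_on X (\<lambda>x. \<Phi> (word x i k))"
  unfolding continuous_on_open_invariant
proof (intro allI impI)
  fix B :: "real set" assume "open B"
  show "\<exists>A. open A \<and> A \<inter> X = (\<lambda>x. \<Phi> (word x i k)) -` B \<inter> X"
    by (rule exI[of _ "{x. word x i k \<in> \<Phi> -` B}"]) (use open_word[of i k "\<Phi> -` B"] in auto)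
qed

text \<open>Uniform continuity on the compact \<open>X\<close>: finitely many cylinders on which
  \<open>f\<close> varies little cover \<open>X\<close>, and the longest of their lengths serves for
  all points.\<close>

lemma continuous_approx_word:
  fixes f :: "seq \<Rightarrow> real"
  assumes f: "continuous_on X f" and d: "\<delta> > 0"
  shows "\<exists>k \<Phi>. \<forall>x\<in>X. \<bar>f x - \<Phi> (word x 0 k)\<bar> \<le> \<delta>"
proof -
  have "\<forall>x\<in>X. \<exists>k. \<forall>y\<in>X. word y 0 k = word x 0 k \<longrightarrow> \<bar>f y - f x\<bar> < \<delta> / 2"
  proof
    fix x assume x: "x \<in> X"
    have "open (ball (f x) (\<delta> / 2))" by simp
    then obtain A where A: "open A" "A \<inter> X = f -` ball (f x) (\<delta> / 2) \<inter> X"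
      using f unfolding continuous_on_open_invariant by blast
    hence "x \<in> A" using x d by auto
    then obtain k where k: "{y. word y 0 k = word x 0 k} \<subseteq> A" using open_contains_word[OF A(1)] by blast
    have "\<bar>f y - f x\<bar> < \<delta> / 2" if "y \<in> X" "word y 0 k = word x 0 k" for y
    proof -
      have "y \<in> A \<inter> X" using k that by auto
      thus ?thesis unfolding A(2) by (auto simp: dist_real_def abs_minus_commute)
    qed
    thus "\<exists>k. \<forall>y\<in>X. word y 0 k = word x 0 k \<longrightarrow> \<bar>f y - f x\<bar> < \<delta> / 2" by blast
  qed
  then obtain k where k: "\<And>x y. x \<in> X \<Longrightarrow> y \<in> X \<Longrightarrow> word y 0 (k x) = word x 0 (k x) \<Longrightarrow> \<bar>f y - f x\<bar> < \<delta> / 2"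
    by metis
  define U where "U x = {y. word y 0 (k x) = word x 0 (k x)}" for x
  have "open (U x)" for x unfolding U_def using open_word[of 0 "k x" "{word x 0 (k x)}"] by simp
  moreover have "X \<subseteq> (\<Union>x\<in>X. U x)" by (auto simp: U_def)
  ultimately obtain D where D: "D \<subseteq> X" "finite D" "X \<subseteq> (\<Union>x\<in>D. U x)"
    using compactE_image[OF compact_X, of X U] by metis
  define K where "K = Max (k ` D)"
  \<comment> \<open>A representative point for each word. On words that do not begin a point of
    \<open>X\<close> its value is arbitrary and does not affect the estimate.\<close>
  define z where "z w = (SOME y. y \<in> X \<and> word y 0 K = w)" for w
  have "\<bar>f y - f (z (word y 0 K))\<bar> \<le> \<delta>" if y: "y \<in> X" for y
  proof -
    have "\<exists>y'. y' \<in> X \<and> word y' 0 K = word y 0 K" using y by blast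
    from someI_ex[OF this] have z: "z (word y 0 K) \<in> X" "word (z (word y 0 K)) 0 K = word y 0 K"
      unfolding z_def by auto
    obtain x where x: "x \<in> D" "word y 0 (k x) = word x 0 (k x)" using D(3) y by (auto simp: U_def)
    have "k x \<le> K" unfolding K_def using D(2) x(1) by simp
    from word_mono_eq[OF z(2) this] x(2) have "word (z (word y 0 K)) 0 (k x) = word x 0 (k x)" by simp
    hence "\<bar>f (z (word y 0 K)) - f x\<bar> < \<delta> / 2" "\<bar>f y - f x\<bar> < \<delta> / 2"
      using k x D(1) y z(1) by blast+
    thus ?thesis by linarith
  qed
  thus ?thesis by (intro exI[of _ K] exI[of _ "\<lambda>w. f (z w)"]) simp
qed

lemma integrable_continuous:
  fixes f :: "seq \<Rightarrow> real"
  assumes f: "continuous_on X f" and bp: "\<nu> \<in> borel_prob_on X"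
  shows "integrable \<nu> f"
proof -
  interpret prob_space \<nu> using borel_probD[OF bp] by simp
  have "f \<in> borel_measurable (restrict_space borel X)"
    by (rule borel_measurable_continuous_on_restrict[OF f])
  moreover have "measurable (restrict_space borel X) borel = measurable \<nu> (borel :: real measure)"
    using borel_probD(3)[OF bp] by (intro measurable_cong_sets) auto
  ultimately have m: "f \<in> borel_measurable \<nu>" by simp
  have "bounded (f ` X)" using compact_continuous_image[OF f compact_X] by (rule compact_imp_bounded)
  then obtain B where "\<And>x. x \<in> X \<Longrightarrow> norm (f x) \<le> B" unfolding bounded_iff by auto
  hence "AE x in \<nu>. norm (f x) \<le> B" using borel_probD(2)[OF bp] by (intro AE_I2) auto
  thus ?thesis using m by (rule integrable_const_bound)
qed

lemma integral_word:
  fixes \<Phi> :: "nat list \<Rightarrow> real"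
  assumes bp: "\<nu> \<in> borel_prob_on X"
  shows "(\<integral>x. \<Phi> (word x 0 k) \<partial>\<nu>) = (\<Sum>w\<in>words m k. \<Phi> w * measure \<nu> (cyl k {w}))"
proof -
  interpret prob_space \<nu> using borel_probD[OF bp] by simp
  have "(\<integral>x. \<Phi> (word x 0 k) \<partial>\<nu>) = (\<integral>x. (\<Sum>w\<in>words m k. \<Phi> w * indicator (cyl k {w}) x) \<partial>\<nu>)"
  proof (rule Bochner_Integration.integral_cong[OF refl])
    fix x assume "x \<in> space \<nu>"
    hence x: "x \<in> X" using borel_probD(2)[OF bp] by simp
    have "(\<Sum>w\<in>words m k. \<Phi> w * indicator (cyl k {w}) x) = (\<Sum>w\<in>words m k. if w = word x 0 k then \<Phi> w else 0)"
      using x by (intro sum.cong) (auto simp: cyl_def)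
    also have "\<dots> = \<Phi> (word x 0 k)" using word_words[OF x] by simp
    finally show "\<Phi> (word x 0 k) = (\<Sum>w\<in>words m k. \<Phi> w * indicator (cyl k {w}) x)" by simp
  qed
  also have "\<dots> = (\<Sum>w\<in>words m k. \<Phi> w * measure \<nu> (cyl k {w}))"
  proof -
    have "cyl k {w} \<inter> space \<nu> = cyl k {w}" for w by (auto simp: cyl_def borel_probD(2)[OF bp])
    thus ?thesis using cyl_sets[OF bp]
      by (subst Bochner_Integration.integral_sum) (auto simp: emeasure_eq_measure)
  qed
  finally show ?thesis .
qed

text \<open>For a subbasic set the test function is approximated by a function of a word, whose
  integral is a finite linear combination of cylinder measures. So density can be proved by matching
  finitely many cylinders.\<close>

lemma weak_star_nbhd:
  assumes "openin (weak_star_topology X) U" "\<mu> \<in> U" "\<mu> \<in> borel_prob_on X"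
  shows "\<exists>F \<epsilon>. finite F \<and> \<epsilon> > 0 \<and>
    (\<forall>\<nu>\<in>borel_prob_on X. (\<forall>w\<in>F. \<bar>measure \<nu> (cyl (length w) {w}) - measure \<mu> (cyl (length w) {w})\<bar> < \<epsilon>) \<longrightarrow> \<nu> \<in> U)"
proof -
  have "generate_topology_on {{\<mu>. (\<integral>x. f x \<partial>\<mu>) \<in> U} | (f :: seq \<Rightarrow> real) U. continuous_on X f \<and> open U} U"
    using assms(1) unfolding weak_star_topology_def by (rule openin_topology_generated_by)
  thus ?thesis using assms(2)
  proof (induction U)
    case Empty thus ?case by simp
  next
    case (Int a b)
    obtain F e where 1: "finite F" "e > 0" "\<forall>\<nu>\<in>borel_prob_on X. (\<forall>w\<in>F. \<bar>measure \<nu> (cyl (length w) {w}) - measure \<mu> (cyl (length w) {w})\<bar> < e) \<longrightarrow> \<nu> \<in> a"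
      using Int by blast
    obtain F' e' where 2: "finite F'" "e' > 0" "\<forall>\<nu>\<in>borel_prob_on X. (\<forall>w\<in>F'. \<bar>measure \<nu> (cyl (length w) {w}) - measure \<mu> (cyl (length w) {w})\<bar> < e') \<longrightarrow> \<nu> \<in> b"
      using Int by blast
    show ?case using 1 2 by (intro exI[of _ "F \<union> F'"] exI[of _ "min e e'"]) auto
  next
    case (UN K)
    then obtain k where k: "k \<in> K" "\<mu> \<in> k" by blast
    from UN.IH[OF this] show ?case using k(1) by blast
  next
    case (Basis s)
    then obtain f :: "seq \<Rightarrow> real" and V where f: "continuous_on X f" and V: "open V" and s: "s = {\<mu>. (\<integral>x. f x \<partial>\<mu>) \<in> V}"
      by blast
    have "(\<integral>x. f x \<partial>\<mu>) \<in> V" using Basis s by simp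
    then obtain d where d: "d > 0" "\<And>y. \<bar>y - (\<integral>x. f x \<partial>\<mu>)\<bar> < d \<Longrightarrow> y \<in> V"
      using V unfolding open_dist dist_real_def by blast
    have d3: "d / 3 > 0" using d by simp
    from continuous_approx_word[OF f this] obtain k \<Phi> where \<Phi>: "\<And>x. x \<in> X \<Longrightarrow> \<bar>f x - \<Phi> (word x 0 k)\<bar> \<le> d / 3" by blast
    have app: "\<bar>(\<integral>x. f x \<partial>\<nu>) - (\<Sum>w\<in>words m k. \<Phi> w * measure \<nu> (cyl k {w}))\<bar> \<le> d / 3" if bp: "\<nu> \<in> borel_prob_on X" for \<nu>
    proof -
      interpret prob_space \<nu> using borel_probD[OF bp] by simp
      have i: "integrable \<nu> f" "integrable \<nu> (\<lambda>x. \<Phi> (word x 0 k))"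
        using integrable_continuous[OF _ bp] f continuous_on_word by auto
      have "\<bar>(\<integral>x. f x \<partial>\<nu>) - (\<integral>x. \<Phi> (word x 0 k) \<partial>\<nu>)\<bar> = \<bar>\<integral>x. f x - \<Phi> (word x 0 k) \<partial>\<nu>\<bar>"
        using i by simp
      also have "\<dots> \<le> (\<integral>x. \<bar>f x - \<Phi> (word x 0 k)\<bar> \<partial>\<nu>)" by (rule integral_abs_bound)
      also have "\<dots> \<le> (\<integral>x. d / 3 \<partial>\<nu>)"
        using i \<Phi> borel_probD(2)[OF bp] by (intro integral_mono integrable_abs Bochner_Integration.integrable_diff) auto
      also have "\<dots> = d / 3" by (simp add: prob_space)
      finally show ?thesis unfolding integral_word[OF bp] .
    qed
    \<comment> \<open>The distance d is split into three parts, two for approximating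
      \<open>f\<close> and one for the cylinder measures. The summand 1 keeps \<open>C\<close>
      positive when \<Phi> vanishes.\<close>
    define C where "C = (\<Sum>w\<in>words m k. \<bar>\<Phi> w\<bar>) + 1"
    have C: "C > 0" unfolding C_def by (intro add_nonneg_pos sum_nonneg) auto
    have "\<nu> \<in> s" if bp: "\<nu> \<in> borel_prob_on X"
      and cl: "\<forall>w\<in>words m k. \<bar>measure \<nu> (cyl (length w) {w}) - measure \<mu> (cyl (length w) {w})\<bar> < d / (3 * C)" for \<nu>
    proof -
      have "\<bar>(\<Sum>w\<in>words m k. \<Phi> w * measure \<nu> (cyl k {w})) - (\<Sum>w\<in>words m k. \<Phi> w * measure \<mu> (cyl k {w}))\<bar>
        = \<bar>\<Sum>w\<in>words m k. \<Phi> w * (measure \<nu> (cyl k {w}) - measure \<mu> (cyl k {w}))\<bar>"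
        by (simp add: sum_subtractf right_diff_distrib)
      also have "\<dots> \<le> (\<Sum>w\<in>words m k. \<bar>\<Phi> w\<bar> * (d / (3 * C)))"
      proof (rule order.trans[OF sum_abs sum_mono])
        fix w assume w: "w \<in> words m k"
        hence "length w = k" by (simp add: words_def)
        thus "\<bar>\<Phi> w * (measure \<nu> (cyl k {w}) - measure \<mu> (cyl k {w}))\<bar> \<le> \<bar>\<Phi> w\<bar> * (d / (3 * C))"
          using cl w unfolding abs_mult by (intro mult_left_mono) auto
      qed
      also have "\<dots> = (C - 1) * (d / (3 * C))" unfolding C_def by (simp only: sum_distrib_right[symmetric] add_diff_cancel_right')
      also have "\<dots> < C * (d / (3 * C))" using C d by (intro mult_strict_right_mono) auto
      also have "\<dots> = d / 3" using C by simp
      finally have "\<bar>(\<integral>x. f x \<partial>\<nu>) - (\<integral>x. f x \<partial>\<mu>)\<bar> < d" using app[OF bp] app[OF assms(3)] by linarith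
      thus ?thesis using d(2) s by simp
    qed
    thus ?case using C d by (intro exI[of _ "words m k"] exI[of _ "d / (3 * C)"]) auto
  qed
qed

text \<open>The generating sets are not confined to measures on \<open>X\<close>: a constant test
  function already gives every measure. Restriction to actual measures is made by
  \<open>subtopology\<close>.\<close>

lemma topspace_weak_star: "topspace (weak_star_topology X) = UNIV"
proof -
  have "UNIV \<in> {{\<mu> :: seq measure. (\<integral>x. f x \<partial>\<mu>) \<in> U} | (f :: seq \<Rightarrow> real) U. continuous_on X f \<and> open U}"
    by (auto intro!: exI[of _ "\<lambda>_. 0"] exI[of _ UNIV])
  thus ?thesis unfolding weak_star_topology_def topology_generated_by_topspace by blast
qed

lemma continuous_integral:
  fixes f :: "seq \<Rightarrow> real"
  assumes "continuous_on X f"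
  shows "continuous_map (weak_star_topology X) euclideanreal (\<lambda>\<mu>. \<integral>x. f x \<partial>\<mu>)"
  unfolding continuous_map_def
proof (intro conjI allI impI)
  fix U :: "real set" assume "openin euclideanreal U"
  hence "{\<mu>. (\<integral>x. f x \<partial>\<mu>) \<in> U} \<in> {{\<mu>. (\<integral>x. f x \<partial>\<mu>) \<in> U} | (f :: seq \<Rightarrow> real) U. continuous_on X f \<and> open U}"
    using assms by auto
  thus "openin (weak_star_topology X) {\<mu> \<in> topspace (weak_star_topology X). (\<integral>x. f x \<partial>\<mu>) \<in> U}"
    unfolding topspace_weak_star unfolding weak_star_topology_def by (simp add: topology_generated_by_Basis)
qed auto

lemma continuous_measure_cyl:
  assumes "S \<subseteq> borel_prob_on X"
  shows "continuous_map (subtopology (weak_star_topology X) S) euclideanreal (\<lambda>\<mu>. measure \<mu> (cyl k B))"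
proof -
  have "continuous_map (subtopology (weak_star_topology X) S) euclideanreal (\<lambda>\<mu>. \<integral>x. of_bool (word x 0 k \<in> B) \<partial>\<mu>)"
    using continuous_on_word[of "\<lambda>w. of_bool (w \<in> B)"] by (intro continuous_map_from_subtopology continuous_integral) simp
  thus ?thesis
  proof (rule continuous_map_eq)
    fix \<mu> assume "\<mu> \<in> topspace (subtopology (weak_star_topology X) S)"
    hence bp: "\<mu> \<in> borel_prob_on X" using assms by auto
    have "(\<integral>x. of_bool (word x 0 k \<in> B) \<partial>\<mu>) = (\<integral>x. indicator (cyl k B) x \<partial>\<mu>)"
      using borel_probD(2)[OF bp] by (intro Bochner_Integration.integral_cong) (auto simp: cyl_def)
    also have "\<dots> = measure \<mu> (cyl k B \<inter> space \<mu>)" by simp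
    also have "cyl k B \<inter> space \<mu> = cyl k B" using borel_probD(2)[OF bp] by (auto simp: cyl_def)
    finally show "(\<integral>x. of_bool (word x 0 k \<in> B) \<partial>\<mu>) = measure \<mu> (cyl k B)" .
  qed
qed

lemma continuous_block_ent:
  assumes "S \<subseteq> borel_prob_on X"
  shows "continuous_map (subtopology (weak_star_topology X) S) euclideanreal (\<lambda>\<mu>. block_ent \<mu> n)"
proof -
  \<comment> \<open>The absolute value extends \<open>eta\<close> continuously to the whole line;
    measures are nonnegative, so nothing changes for them.\<close>
  have "continuous_on UNIV (\<lambda>t :: real. eta \<bar>t\<bar>)"
    by (rule continuous_on_compose2[OF continuous_eta]) (auto intro: continuous_intros)
  hence ca: "continuous_map euclideanreal euclideanreal (\<lambda>t. eta \<bar>t\<bar>)" by simp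
  have "continuous_map (subtopology (weak_star_topology X) S) euclideanreal (\<lambda>\<mu>. \<Sum>w\<in>words m n. eta \<bar>measure \<mu> (cyl n {w})\<bar>)"
    using continuous_map_compose[OF continuous_measure_cyl[OF assms] ca]
    by (intro continuous_map_sum) (auto simp: comp_def)
  thus ?thesis
    by (rule continuous_map_eq) (use assms block_ent_sum in auto)
qed

text \<open>For an invariant measure and M >= 1 the cylinder measure is the mean of
  \<open>freq M w\<close>, so this is a variance.\<close>

definition deviation :: "seq measure \<Rightarrow> nat \<Rightarrow> nat list \<Rightarrow> real" where
  "deviation \<mu> M w = (\<integral>x. (freq M w x - measure \<mu> (cyl (length w) {w}))\<^sup>2 \<partial>\<mu>)"

lemma continuous_freq: "continuous_on X (freq M w)"
proof -
  obtain \<Phi> where "\<And>x. freq M w x = \<Phi> (word x 0 (M + length w))" using freq_word by blast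
  hence "freq M w = (\<lambda>x. \<Phi> (word x 0 (M + length w)))" by auto
  thus ?thesis using continuous_on_word by metis
qed

text \<open>The integrand itself depends on \<mu>. Expanding the square leaves integrals of fixed
  continuous functions and a cylinder measure, each continuous in \<mu>.\<close>

lemma continuous_deviation:
  assumes "S \<subseteq> borel_prob_on X"
  shows "continuous_map (subtopology (weak_star_topology X) S) euclideanreal (\<lambda>\<mu>. deviation \<mu> M w)"
proof -
  let ?c = "\<lambda>\<mu>. measure \<mu> (cyl (length w) {w})"
  have "continuous_map (subtopology (weak_star_topology X) S) euclideanreal
    (\<lambda>\<mu>. (\<integral>x. (freq M w x)\<^sup>2 \<partial>\<mu>) - 2 * ?c \<mu> * (\<integral>x. freq M w x \<partial>\<mu>) + (?c \<mu>)\<^sup>2)"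
    using assms by (intro continuous_intros continuous_map_real_mult continuous_map_real_pow continuous_measure_cyl
        continuous_map_from_subtopology continuous_integral continuous_freq continuous_map_diff continuous_map_add) auto
  thus ?thesis
  proof (rule continuous_map_eq)
    fix \<mu> assume "\<mu> \<in> topspace (subtopology (weak_star_topology X) S)"
    hence bp: "\<mu> \<in> borel_prob_on X" using assms by auto
    interpret prob_space \<mu> using borel_probD[OF bp] by simp
    have i: "integrable \<mu> (\<lambda>x. (freq M w x)\<^sup>2)" "integrable \<mu> (freq M w)"
      by (intro integrable_continuous[OF _ bp] continuous_intros continuous_freq)+
    have "deviation \<mu> M w = (\<integral>x. (freq M w x)\<^sup>2 - 2 * ?c \<mu> * freq M w x + (?c \<mu>)\<^sup>2 \<partial>\<mu>)"
      unfolding deviation_def by (simp add: power2_diff algebra_simps)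
    also have "\<dots> = (\<integral>x. (freq M w x)\<^sup>2 \<partial>\<mu>) - 2 * ?c \<mu> * (\<integral>x. freq M w x \<partial>\<mu>) + (?c \<mu>)\<^sup>2"
      using i by (simp add: prob_space)
    finally show "(\<integral>x. (freq M w x)\<^sup>2 \<partial>\<mu>) - 2 * ?c \<mu> * (\<integral>x. freq M w x \<partial>\<mu>) + (?c \<mu>)\<^sup>2 = deviation \<mu> M w" by simp
  qed
qed

text \<open>For an invariant set \<open>A\<close> and a word \<open>w\<close> the integral of \<open>freq M w\<close> over \<open>A\<close> is \<open>\<mu>(A \<inter> [w])\<close> for every \<open>M\<close>. Small
  deviation therefore makes \<open>A\<close> independent of all cylinders, hence of itself.\<close>

lemma ergodic_if_small_deviation:
  assumes inv: "\<mu> \<in> invariant_measures X"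
    and dev: "\<And>k j. \<exists>M\<ge>1. (\<Sum>w\<in>words m k. deviation \<mu> M w) < 1 / real (Suc j)"
  shows "\<mu> \<in> ergodic_measures X"
proof -
  note bp = invD[OF inv]
  interpret prob_space \<mu> using borel_probD[OF bp] by simp
  note [simp] = borel_probD(2)[OF bp]
  have "prob A = 0 \<or> prob A = 1" if A: "A \<in> events" and AA: "shift -` A \<inter> X = A" for A
  proof -
    have AX: "A \<subseteq> X" using sets.sets_into_space[OF A] by simp
    have AAj: "(shift ^^ j) -` A \<inter> X = A" for j
    proof (induction j)
      case (Suc j)
      have "(shift ^^ Suc j) -` A \<inter> X = shift -` ((shift ^^ j) -` A \<inter> X) \<inter> X"
        using shift_X by (auto simp: funpow_swap1)
      thus ?case using Suc AA by (simp only:)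
    qed (use AX in auto)
    \<comment> \<open>The bound |d| <= t / 2 + d^2 / (2 t) takes the place of the Cauchy-Schwarz
      inequality; \<open>t\<close> stays free so that it can be adapted to the number of
      words.\<close>
    have key: "\<bar>prob (A \<inter> cyl (length w) {w}) - prob A * prob (cyl (length w) {w})\<bar> \<le> t / 2 + deviation \<mu> M w / (2 * t)"
      if t: "t > 0" and M: "M \<ge> 1" for w t M
    proof -
      let ?c = "prob (cyl (length w) {w})"
      define Wi where "Wi i = {x \<in> X. word x i (length w) = w}" for i
      have Wi: "Wi i \<in> events" for i unfolding Wi_def using word_set_sets[OF bp, of i "length w" "{w}"] by simp
      have pA: "prob (A \<inter> Wi i) = prob (A \<inter> cyl (length w) {w})" for i
      proof -
        have "(shift ^^ i) -` (A \<inter> cyl (length w) {w}) \<inter> X = A \<inter> Wi i"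
          using AAj[of i] shift_pow_X by (auto simp: cyl_def Wi_def)
        thus ?thesis using inv_measure[OF inv, of "A \<inter> cyl (length w) {w}" i] A cyl_sets[OF bp] by auto
      qed
      have cf: "integrable \<mu> (freq M w)" by (rule integrable_continuous[OF continuous_freq bp])
      have iA: "integrable \<mu> (\<lambda>x. indicator A x * freq M w x)"
        using integrable_real_mult_indicator[OF A cf] by (simp add: mult.commute)
      have "(\<integral>x. indicator A x * freq M w x \<partial>\<mu>) = (\<integral>x. (\<Sum>i<M. indicator (A \<inter> Wi i) x / real M) \<partial>\<mu>)"
        by (rule Bochner_Integration.integral_cong)
          (auto simp: freq_def Wi_def sum_divide_distrib sum_distrib_left indicator_def simp del: sum_of_bool_eq intro!: sum.cong)
      also have "\<dots> = (\<Sum>i<M. prob (A \<inter> Wi i) / real M)"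
      proof -
        have "A \<inter> Wi i \<inter> X = A \<inter> Wi i" for i using AX by auto
        thus ?thesis using A Wi by (subst Bochner_Integration.integral_sum) (auto simp: emeasure_eq_measure Int_assoc)
      qed
      also have "\<dots> = prob (A \<inter> cyl (length w) {w})" unfolding pA using M by simp
      finally have e: "(\<integral>x. indicator A x * freq M w x \<partial>\<mu>) = prob (A \<inter> cyl (length w) {w})" .
      have "(\<integral>x. indicator A x * ?c \<partial>\<mu>) = prob A * ?c" using AX by (simp add: Int_absorb2)
      hence "prob (A \<inter> cyl (length w) {w}) - prob A * ?c = (\<integral>x. indicator A x * freq M w x - indicator A x * ?c \<partial>\<mu>)"
        using e iA A by (subst Bochner_Integration.integral_diff) (auto simp: emeasure_eq_measure)
      also have "\<bar>\<dots>\<bar> \<le> (\<integral>x. \<bar>indicator A x * freq M w x - indicator A x * ?c\<bar> \<partial>\<mu>)" by (rule integral_abs_bound)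
      also have "\<dots> \<le> (\<integral>x. t / 2 + (freq M w x - ?c)\<^sup>2 / (2 * t) \<partial>\<mu>)"
      proof (rule integral_mono)
        show "integrable \<mu> (\<lambda>x. \<bar>indicator A x * freq M w x - indicator A x * ?c\<bar>)"
          using iA A by (intro integrable_abs Bochner_Integration.integrable_diff) (auto simp: emeasure_eq_measure)
        show "integrable \<mu> (\<lambda>x. t / 2 + (freq M w x - ?c)\<^sup>2 / (2 * t))"
          by (intro integrable_continuous[OF _ bp] continuous_intros continuous_freq) (use t in auto)
        fix x
        have "\<bar>indicator A x * freq M w x - indicator A x * ?c\<bar> \<le> \<bar>freq M w x - ?c\<bar>" by (auto simp: indicator_def)
        also have "\<dots> \<le> t / 2 + (freq M w x - ?c)\<^sup>2 / (2 * t)"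
        proof -
          have "0 \<le> (t - \<bar>freq M w x - ?c\<bar>)\<^sup>2" by simp
          hence "2 * t * \<bar>freq M w x - ?c\<bar> \<le> t\<^sup>2 + (freq M w x - ?c)\<^sup>2" by (simp add: power2_diff)
          thus ?thesis using t by (simp add: field_simps power2_eq_square)
        qed
        finally show "\<bar>indicator A x * freq M w x - indicator A x * ?c\<bar> \<le> t / 2 + (freq M w x - ?c)\<^sup>2 / (2 * t)" .
      qed
      also have "\<dots> = t / 2 + deviation \<mu> M w / (2 * t)"
      proof -
        have "integrable \<mu> (\<lambda>x. (freq M w x - ?c)\<^sup>2)"
          by (intro integrable_continuous[OF _ bp] continuous_intros continuous_freq)
        moreover have "prob X = 1" using prob_space by simp
        ultimately show ?thesis unfolding deviation_def by (subst Bochner_Integration.integral_add) auto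
      qed
      finally show ?thesis .
    qed
    have "\<bar>prob A - (prob A)\<^sup>2\<bar> \<le> \<epsilon>" if e: "\<epsilon> > 0" for \<epsilon>
    proof -
      have e4: "\<epsilon> / 4 > 0" using e by simp
      obtain k B where kB: "prob ((A - cyl k B) \<union> (cyl k B - A)) < \<epsilon> / 4"
        using approx_by_cyl[OF bp A e4] by blast
      let ?C = "cyl k B"
      have C: "?C \<in> events" by (rule cyl_sets[OF bp])
      define c where "c = real (card (words m k)) + 1"
      have c: "c > 0" by (simp add: c_def add_nonneg_pos)
      \<comment> \<open>The fewer than \<open>c\<close> summands t / 2 add up to at most \<epsilon>
        / 4. Only then is the total deviation chosen small in comparison with \<epsilon> t.\<close>
      define t where "t = \<epsilon> / (4 * c)"
      have t: "t > 0" unfolding t_def using e c by simp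
      obtain j where j: "1 / real (Suc j) < \<epsilon> * t / 4" using reals_Archimedean[of "\<epsilon> * t / 4"] t e
        by (auto simp: inverse_eq_divide)
      obtain M where M: "M \<ge> 1" "(\<Sum>w\<in>words m k. deviation \<mu> M w) < 1 / real (Suc j)" using dev by blast
      have sC: "prob (A' \<inter> ?C) = (\<Sum>w\<in>words m k \<inter> B. prob (A' \<inter> cyl k {w}))" if A': "A' \<in> events" for A'
      proof -
        have "?C = (\<Union>w\<in>words m k \<inter> B. cyl k {w})" using word_words by (auto simp: cyl_def)
        hence "A' \<inter> ?C = (\<Union>w\<in>words m k \<inter> B. A' \<inter> cyl k {w})" by auto
        also have "prob \<dots> = (\<Sum>w\<in>words m k \<inter> B. prob (A' \<inter> cyl k {w}))"
        proof (rule finite_measure_finite_Union)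
          show "(\<lambda>w. A' \<inter> cyl k {w}) ` (words m k \<inter> B) \<subseteq> events" using A' cyl_sets[OF bp] by blast
          show "disjoint_family_on (\<lambda>w. A' \<inter> cyl k {w}) (words m k \<inter> B)"
            by (auto simp: disjoint_family_on_def cyl_def)
        qed simp
        finally show ?thesis .
      qed
      have XC: "X \<inter> cyl k Z = cyl k Z" for Z by (auto simp: cyl_def)
      have sC': "prob ?C = (\<Sum>w\<in>words m k \<inter> B. prob (cyl k {w}))"
        using sC[of X] sets.top[of \<mu>] by (simp add: XC)
      have "\<bar>prob (A \<inter> ?C) - prob A * prob ?C\<bar> = \<bar>\<Sum>w\<in>words m k \<inter> B. prob (A \<inter> cyl k {w}) - prob A * prob (cyl k {w})\<bar>"
        unfolding sC[OF A] sC' by (simp add: sum_subtractf sum_distrib_left)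
      also have "\<dots> \<le> (\<Sum>w\<in>words m k \<inter> B. t / 2 + deviation \<mu> M w / (2 * t))"
      proof (rule order.trans[OF sum_abs sum_mono])
        fix w assume "w \<in> words m k \<inter> B"
        hence "length w = k" by (simp add: words_def)
        thus "\<bar>prob (A \<inter> cyl k {w}) - prob A * prob (cyl k {w})\<bar> \<le> t / 2 + deviation \<mu> M w / (2 * t)"
          using key[OF t M(1), of w] by simp
      qed
      also have "\<dots> \<le> (\<Sum>w\<in>words m k. t / 2 + deviation \<mu> M w / (2 * t))"
        using t by (intro sum_mono2) (auto simp: deviation_def)
      also have "\<dots> = real (card (words m k)) * (t / 2) + (\<Sum>w\<in>words m k. deviation \<mu> M w) / (2 * t)"
        by (simp add: sum.distrib sum_divide_distrib)
      also have "\<dots> \<le> \<epsilon> / 4 + \<epsilon> / 4"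
      proof (rule add_mono)
        have "real (card (words m k)) * (t / 2) \<le> c * t" unfolding c_def using t by (intro mult_mono) auto
        also have "\<dots> = \<epsilon> / 4" unfolding t_def using c by simp
        finally show "real (card (words m k)) * (t / 2) \<le> \<epsilon> / 4" .
        have "(\<Sum>w\<in>words m k. deviation \<mu> M w) \<le> \<epsilon> * t / 4" using M(2) j by linarith
        hence "(\<Sum>w\<in>words m k. deviation \<mu> M w) / (2 * t) \<le> (\<epsilon> * t / 4) / (2 * t)" using t by (intro divide_right_mono) auto
        also have "\<dots> \<le> \<epsilon> / 4" using t e by (simp add: field_simps)
        finally show "(\<Sum>w\<in>words m k. deviation \<mu> M w) / (2 * t) \<le> \<epsilon> / 4" .
      qed
      finally have 1: "\<bar>prob (A \<inter> ?C) - prob A * prob ?C\<bar> \<le> \<epsilon> / 2" by simp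
      have dA: "prob (A - ?C) + prob (?C - A) < \<epsilon> / 4"
      proof -
        have "prob ((A - ?C) \<union> (?C - A)) = prob (A - ?C) + prob (?C - A)"
          using A C by (intro finite_measure_Union) auto
        thus ?thesis using kB by simp
      qed
      have 2: "prob A = prob (A \<inter> ?C) + prob (A - ?C)" "prob ?C = prob (A \<inter> ?C) + prob (?C - A)"
        using finite_measure_Diff'[OF A C] finite_measure_Diff'[OF C A] by (simp_all add: Int_commute)
      \<comment> \<open>The cylinder is exchanged for \<open>A\<close> in the product as well, so
        that near independence of \<open>A\<close> from the cylinder becomes near independence of
        \<open>A\<close> from itself.\<close>
      have "\<bar>prob A * prob ?C - prob A * prob A\<bar> \<le> \<bar>prob ?C - prob A\<bar>"
        unfolding right_diff_distrib[symmetric] abs_mult using prob_le_1[of A] by (simp add: mult_left_le_one_le)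
      hence "\<bar>prob A - prob A * prob A\<bar> \<le> \<epsilon>"
        using 1 2 dA measure_nonneg[of \<mu> "A - ?C"] measure_nonneg[of \<mu> "?C - A"] by linarith
      thus ?thesis by (simp add: power2_eq_square)
    qed
    hence "\<bar>prob A - (prob A)\<^sup>2\<bar> \<le> 0" by (rule field_le_epsilon[where y = 0, simplified])
    hence "prob A * (1 - prob A) = 0" by (simp add: power2_eq_square algebra_simps)
    thus ?thesis by auto
  qed
  thus ?thesis using inv by (simp add: ergodic_measures_def)
qed

end

section \<open>Mixtures and measures of large entropy\<close>

context subshift
begin

lemma mixture_exists:
  assumes \<mu>: "\<mu> \<in> invariant_measures X" and \<nu>: "\<nu> \<in> invariant_measures X" and t: "0 \<le> t" "t \<le> 1"
  shows "\<exists>\<kappa>\<in>invariant_measures X. \<forall>A\<in>sets (restrict_space borel X). measure \<kappa> A = t * measure \<mu> A + (1 - t) * measure \<nu> A"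
proof -
  note b\<mu> = borel_probD[OF invD[OF \<mu>]] and b\<nu> = borel_probD[OF invD[OF \<nu>]]
  interpret M: prob_space \<mu> using b\<mu> by simp
  interpret N: prob_space \<nu> using b\<nu> by simp
  let ?S = "sets (restrict_space borel X)"
  let ?f = "\<lambda>A. ennreal t * emeasure \<mu> A + ennreal (1 - t) * emeasure \<nu> A"
  define \<kappa> where "\<kappa> = measure_of X ?S ?f"
  have SX: "?S \<subseteq> Pow X" using sets.space_closed[of "restrict_space borel X"] by (simp add: space_restrict_space)
  have sg: "sigma_sets X ?S = ?S"
    using sets.sigma_sets_eq[of "restrict_space borel X"] by (simp add: space_restrict_space)
  have sp: "space \<kappa> = X" and st: "sets \<kappa> = ?S"
    unfolding \<kappa>_def using SX sg by (simp_all add: space_measure_of sets_measure_of)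
  have em: "emeasure \<kappa> A = ?f A" if A: "A \<in> ?S" for A
  proof (rule emeasure_measure_of[OF \<kappa>_def SX])
    show "positive (sets \<kappa>) ?f" by (simp add: positive_def)
    show "A \<in> sets \<kappa>" using A st by simp
    show "countably_additive (sets \<kappa>) ?f" unfolding countably_additive_def st
    proof (intro allI impI)
      fix A :: "nat \<Rightarrow> seq set" assume A: "range A \<subseteq> ?S" "disjoint_family A"
      have "(\<Sum>i. emeasure \<mu> (A i)) = emeasure \<mu> (\<Union>i. A i)" "(\<Sum>i. emeasure \<nu> (A i)) = emeasure \<nu> (\<Union>i. A i)"
        using A b\<mu>(3) b\<nu>(3) by (auto intro!: suminf_emeasure)
      thus "(\<Sum>i. ?f (A i)) = ?f (\<Union>i. A i)" by (subst suminf_add[symmetric]) auto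
    qed
  qed
  have m: "measure \<kappa> A = t * measure \<mu> A + (1 - t) * measure \<nu> A" if A: "A \<in> ?S" for A
    using em[OF A] t unfolding measure_def[of \<kappa>]
    by (simp add: M.emeasure_eq_measure N.emeasure_eq_measure ennreal_mult[symmetric] ennreal_plus[symmetric] del: ennreal_plus)
  have XS: "X \<in> ?S" using sets.top[of "restrict_space borel X"] by (simp add: space_restrict_space)
  have "emeasure \<kappa> X = 1"
    using em[OF XS] M.emeasure_space_1 N.emeasure_space_1 t b\<mu>(2) b\<nu>(2) by (simp flip: ennreal_plus)
  hence "\<kappa> \<in> borel_prob_on X" using sp st by (auto simp: borel_prob_on_def intro: prob_spaceI)
  moreover have "emeasure \<kappa> (shift -` A \<inter> X) = emeasure \<kappa> A" if A: "A \<in> ?S" for A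
  proof -
    have "shift -` A \<inter> X \<in> ?S" using shift_measurable[OF invD[OF \<mu>], of A 1] A b\<mu>(3) by simp
    thus ?thesis using em A \<mu> \<nu> b\<mu>(3) b\<nu>(3) by (simp add: invariant_measures_def)
  qed
  ultimately have "\<kappa> \<in> invariant_measures X" using st by (simp add: invariant_measures_def)
  thus ?thesis using m by blast
qed

text \<open>Concavity of \<open>eta\<close> gives one inequality for block entropies. In the other
  direction mixing adds at most the entropy of the coin, eta t + eta (1 - t), which does not depend
  on the block length and vanishes in the rate.\<close>

lemma entropy_rate_affine:
  assumes \<mu>: "\<mu> \<in> invariant_measures X" and \<nu>: "\<nu> \<in> invariant_measures X" and t: "0 \<le> t" "t \<le> 1"
    and \<kappa>: "\<kappa> \<in> invariant_measures X"
    and mix: "\<And>A. A \<in> sets (restrict_space borel X) \<Longrightarrow> measure \<kappa> A = t * measure \<mu> A + (1 - t) * measure \<nu> A"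
  shows "entropy_rate \<kappa> = t * entropy_rate \<mu> + (1 - t) * entropy_rate \<nu>"
proof -
  have c: "measure \<kappa> (cyl n B) = t * measure \<mu> (cyl n B) + (1 - t) * measure \<nu> (cyl n B)" for n B
    using mix cyl_sets[OF invD[OF \<mu>]] borel_probD(3)[OF invD[OF \<mu>]] by simp
  have sum1: "(\<Sum>w\<in>words m n. measure \<rho> (cyl n {w})) = 1" if "\<rho> \<in> borel_prob_on X" for \<rho> n
    using integral_word[OF that, of "\<lambda>_. 1" n] prob_space.prob_space[OF borel_probD(1)[OF that]] by simp
  have lo: "t * block_ent \<mu> n + (1 - t) * block_ent \<nu> n \<le> block_ent \<kappa> n" for n
  proof -
    have "t * eta a + (1 - t) * eta b \<le> eta (t * a + (1 - t) * b)" if "a \<ge> 0" "b \<ge> 0" for a b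
      using eta_concave[of "{True, False}" "\<lambda>i. if i then t else 1 - t" "\<lambda>i. if i then a else b"] t that by simp
    thus ?thesis unfolding block_ent_sum[OF invD[OF \<mu>]] block_ent_sum[OF invD[OF \<nu>]] block_ent_sum[OF invD[OF \<kappa>]] c
        sum_distrib_left sum.distrib[symmetric]
      by (intro sum_mono) simp
  qed
  have hi: "block_ent \<kappa> n \<le> t * block_ent \<mu> n + (1 - t) * block_ent \<nu> n + (eta t + eta (1 - t))" for n
  proof -
    have "eta (t * a + (1 - t) * b) \<le> t * eta a + (1 - t) * eta b + (a * eta t + b * eta (1 - t))" if "a \<ge> 0" "b \<ge> 0" for a b
      using eta_subadd[of "t * a" "(1 - t) * b"] eta_mult[of t a] eta_mult[of "1 - t" b] t that by simp
    hence "block_ent \<kappa> n \<le> (\<Sum>w\<in>words m n. t * eta (measure \<mu> (cyl n {w})) + (1 - t) * eta (measure \<nu> (cyl n {w}))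
        + (measure \<mu> (cyl n {w}) * eta t + measure \<nu> (cyl n {w}) * eta (1 - t)))"
      unfolding block_ent_sum[OF invD[OF \<kappa>]] c by (intro sum_mono) simp
    also have "\<dots> = t * block_ent \<mu> n + (1 - t) * block_ent \<nu> n
        + ((\<Sum>w\<in>words m n. measure \<mu> (cyl n {w})) * eta t + (\<Sum>w\<in>words m n. measure \<nu> (cyl n {w})) * eta (1 - t))"
      unfolding block_ent_sum[OF invD[OF \<mu>]] block_ent_sum[OF invD[OF \<nu>]]
      by (simp add: sum.distrib sum_distrib_left sum_distrib_right)
    finally show ?thesis using sum1 invD \<mu> \<nu> by simp
  qed
  have l: "(\<lambda>n. t * (block_ent \<mu> n / n) + (1 - t) * (block_ent \<nu> n / n)) \<longlonglongrightarrow> t * entropy_rate \<mu> + (1 - t) * entropy_rate \<nu>"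
    by (intro tendsto_intros entropy_rate_lim \<mu> \<nu>)
  have u: "(\<lambda>n. t * (block_ent \<mu> n / n) + (1 - t) * (block_ent \<nu> n / n) + (eta t + eta (1 - t)) / n)
      \<longlonglongrightarrow> t * entropy_rate \<mu> + (1 - t) * entropy_rate \<nu> + 0"
    by (intro tendsto_add l lim_const_over_n)
  have lo': "t * (block_ent \<mu> n / n) + (1 - t) * (block_ent \<nu> n / n) \<le> block_ent \<kappa> n / n" for n
    using divide_right_mono[OF lo[of n], of "real n"] by (simp add: add_divide_distrib)
  have hi': "block_ent \<kappa> n / n \<le> t * (block_ent \<mu> n / n) + (1 - t) * (block_ent \<nu> n / n) + (eta t + eta (1 - t)) / n" for n
    using divide_right_mono[OF hi[of n], of "real n"] by (simp add: add_divide_distrib)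
  have "(\<lambda>n. block_ent \<kappa> n / n) \<longlonglongrightarrow> t * entropy_rate \<mu> + (1 - t) * entropy_rate \<nu>"
    by (rule tendsto_sandwich[OF always_eventually[OF allI[OF lo']] always_eventually[OF allI[OF hi']] l u[unfolded add_0_right]])
  thus ?thesis using entropy_rate_lim[OF \<kappa>] LIMSEQ_unique by blast
qed

section \<open>A measure of entropy at least the topological entropy\<close>

lemma language_n_eq: "language_n X n = {word x 0 n | x. x \<in> X}"
proof safe
  fix w assume "w \<in> language_n X n"
  then obtain x i where x: "x \<in> X" "w = map x [i..<i + length w]" "length w = n"
    by (auto simp: language_n_def language_def)
  hence "w = word x i n" by (simp add: word_def)
  hence "w = word ((shift ^^ i) x) 0 n" by simp
  thus "\<exists>x. w = word x 0 n \<and> x \<in> X" using shift_pow_X[OF x(1)] by blast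
next
  fix x assume "x \<in> X"
  thus "word x 0 n \<in> language_n X n" unfolding language_n_def language_def
    by (auto intro!: bexI[of _ x] exI[of _ 0] simp: word_def)
qed

lemma language_n_words: "language_n X n \<subseteq> words m n"
  unfolding language_n_eq using word_words by auto

lemma finite_language_n: "finite (language_n X n)"
  using finite_subset[OF language_n_words] by simp

lemma language_n_ne: "language_n X n \<noteq> {}"
  unfolding language_n_eq using X_ne by auto

text \<open>A word of length n + k is a word of length n followed by one of length k, so Fekete's
  lemma applies: the limit in \<open>htop\<close> exists and is also an infimum.\<close>

lemma htop_le: "htop X * real n \<le> ln (real (card (language_n X n)))"
proof -
  define a where "a n = ln (real (card (language_n X n)))" for n
  have pos: "card (language_n X n) > 0" for n
    using finite_language_n language_n_ne by (simp add: card_gt_0_iff)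
  have "a (n + k) \<le> a n + a k" for n k
  proof -
    have "language_n X (n + k) \<subseteq> (\<lambda>(u, v). u @ v) ` (language_n X n \<times> language_n X k)"
    proof
      fix w assume "w \<in> language_n X (n + k)"
      then obtain x where x: "x \<in> X" "w = word x 0 (n + k)" by (auto simp: language_n_eq)
      have "w = word x 0 n @ word ((shift ^^ n) x) 0 k" using x by (simp add: word_append)
      moreover have "word x 0 n \<in> language_n X n" "word ((shift ^^ n) x) 0 k \<in> language_n X k"
        unfolding language_n_eq using x shift_pow_X by blast+
      ultimately show "w \<in> (\<lambda>(u, v). u @ v) ` (language_n X n \<times> language_n X k)" by force
    qed
    hence "card (language_n X (n + k)) \<le> card (language_n X n \<times> language_n X k)"
      using finite_language_n by (meson card_image_le card_mono finite_SigmaI finite_imageI le_trans)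
    also have "\<dots> = card (language_n X n) * card (language_n X k)" by (rule card_cartesian_product)
    finally have "real (card (language_n X (n + k))) \<le> real (card (language_n X n)) * real (card (language_n X k))"
      by (simp flip: of_nat_mult)
    hence "a (n + k) \<le> ln (real (card (language_n X n)) * real (card (language_n X k)))"
      unfolding a_def using pos[of "n + k"] by (intro ln_mono) auto
    thus ?thesis unfolding a_def using pos by (simp add: ln_mult)
  qed
  moreover have "0 \<le> a n" for n unfolding a_def using pos[of n] by simp
  ultimately obtain l where l: "(\<lambda>n. a n / real n) \<longlonglongrightarrow> l" "\<And>n. l * real n \<le> a n" using fekete[of a] by blast
  have "htop X = l" unfolding htop_def using l(1) unfolding a_def by (rule limI)
  thus ?thesis using l(2)[of n] by (simp add: a_def)
qed

text \<open>One half of the variational principle. Choose one point of \<open>X\<close> for each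
  word of a given length; the uniform law on these points has the logarithm of the number of words
  as its entropy, and \<open>averaging\<close> keeps this growth rate in the limit.\<close>

lemma large_entropy_measure: "\<exists>\<nu>\<in>invariant_measures X. htop X \<le> entropy_rate \<nu>"
proof -
  define p where "p w = (SOME x. x \<in> X \<and> word x 0 (length w) = w)" for w
  have p: "p w \<in> X \<and> word (p w) 0 n = w" if "w \<in> language_n X n" for w n
  proof -
    have "\<exists>x. x \<in> X \<and> word x 0 (length w) = w" using that by (auto simp: language_n_eq)
    from someI_ex[OF this] show ?thesis using that by (auto simp: p_def language_n_eq)
  qed
  define q where "q J = map_pmf p (pmf_of_set (language_n X (Suc J)))" for J
  note ps = finite_language_n language_n_ne
  have sq: "set_pmf (q J) = p ` language_n X (Suc J)" for J unfolding q_def using ps by simp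
  have fin: "finite (set_pmf (q J))" for J unfolding sq using ps by simp
  have qX: "set_pmf (q J) \<subseteq> X" for J unfolding sq using p by auto
  have "filterlim Suc at_top sequentially" by (rule filterlim_Suc)
  from averaging[of q Suc, OF fin qX zero_less_Suc this] obtain \<nu> where \<nu>: "\<nu> \<in> invariant_measures X"
    "\<And>c e. (\<forall>J. c * real (Suc J) - e \<le> ent (fin_space (q J)) (\<lambda>x. word x 0 (Suc J))) \<Longrightarrow> c \<le> entropy_rate \<nu>"
    by blast
  have "htop X \<le> entropy_rate \<nu>"
  proof (rule \<nu>(2)[of _ 0], rule allI)
    fix J
    let ?L = "language_n X (Suc J)"
    have pr: "measure_pmf.prob (q J) ((\<lambda>x. word x 0 (Suc J)) -` {v}) = 1 / real (card ?L)" if v: "v \<in> ?L" for v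
    proof -
      have "?L \<inter> p -` (\<lambda>x. word x 0 (Suc J)) -` {v} = {v}" using p v by auto
      thus ?thesis unfolding q_def using ps by (simp add: measure_pmf_of_set)
    qed
    have "ent (fin_space (q J)) (\<lambda>x. word x 0 (Suc J)) = (\<Sum>v\<in>?L. eta (1 / real (card ?L)))"
      using pr by (subst ent_fin_space[OF finite_language_n]) (auto simp: sq p)
    also have "\<dots> = ln (real (card ?L))"
      using ps by (simp add: eta_def ln_div card_gt_0_iff)
    finally show "htop X * real (Suc J) - 0 \<le> ent (fin_space (q J)) (\<lambda>x. word x 0 (Suc J))"
      using htop_le[of "Suc J"] by simp
  qed
  thus ?thesis using \<nu>(1) by blast
qed

end

section \<open>Words at small edit distance\<close>

text \<open>Delete everything, then insert the target. Without some path the \<open>LEAST\<close> in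
  \<open>edit_dist\<close> would carry no information.\<close>

lemma edit_path_ex: "\<exists>n. (edit_step ^^ n) v w"
proof -
  have del: "(edit_step ^^ length v) v []" for v :: "'a list"
  proof (induction v)
    case (Cons a v)
    have "edit_step (a # v) v" unfolding edit_step_def
      by (rule exI[of _ "[]"], rule exI[of _ v], rule exI[of _ a], rule exI[of _ a]) simp
    thus ?case using Cons relpowp_Suc_I2[of edit_step "a # v" v "length v" "[]"] by simp
  qed simp
  have ins: "(edit_step ^^ length w) [] w" for w :: "'a list"
  proof (induction w)
    case (Cons a w)
    have "edit_step w (a # w)" unfolding edit_step_def
      by (rule exI[of _ "[]"], rule exI[of _ w], rule exI[of _ a], rule exI[of _ a]) simp
    thus ?case using Cons relpowp_Suc_I[of "length w" edit_step "[]" w "a # w"] by simp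
  qed simp
  have "(edit_step ^^ (length v + length w)) v w"
    unfolding relpowp_add using del[of v] ins[of w] by blast
  thus ?thesis by blast
qed

lemma edit_dist_path: "(edit_step ^^ edit_dist v w) v w"
  unfolding edit_dist_def using edit_path_ex[of v w] by (rule LeastI_ex)

lemma subseq_delete:
  "subseq u (xs @ a # ys) \<Longrightarrow> \<exists>u'. subseq u' (xs @ ys) \<and> subseq u' u \<and> length u \<le> length u' + 1"
proof (induction xs arbitrary: u)
  case Nil
  show ?case
  proof (cases "subseq u ys")
    case False
    then obtain u1 where "u = a # u1" "subseq u1 ys" using Nil by (cases u) (auto split: if_splits)
    thus ?thesis by (intro exI[of _ u1]) auto
  qed auto
next
  case (Cons x xs)
  show ?case
  proof (cases "subseq u (xs @ a # ys)")
    case True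
    from Cons.IH[OF this] show ?thesis by (auto intro: list_emb_Cons)
  next
    case False
    then obtain u1 where u1: "u = x # u1" "subseq u1 (xs @ a # ys)" using Cons.prems by (cases u) (auto split: if_splits)
    from Cons.IH[OF u1(2)] obtain u' where "subseq u' (xs @ ys)" "subseq u' u1" "length u1 \<le> length u' + 1" by blast
    thus ?thesis using u1(1) by (intro exI[of _ "x # u'"]) auto
  qed
qed

text \<open>Along the path a common subsequence of \<open>v\<close> and the current word is
  maintained. A substitution or deletion removes at most one of its symbols and an insertion removes
  none, so after \<open>k\<close> edits at most \<open>k\<close> symbols of either word lie outside
  it.\<close>

lemma edit_path_common_subseq:
  "(edit_step ^^ k) v w \<Longrightarrow> \<exists>u. subseq u v \<and> subseq u w \<and> length v \<le> length u + k \<and> length w \<le> length u + k"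
proof (induction k arbitrary: w)
  case 0 thus ?case by (intro exI[of _ v]) auto
next
  case (Suc k)
  then obtain y where y: "(edit_step ^^ k) v y" "edit_step y w" by auto
  from Suc.IH[OF y(1)] obtain u where u: "subseq u v" "subseq u y" "length v \<le> length u + k" "length y \<le> length u + k" by blast
  from y(2) obtain xs ys a b where
    "(y = xs @ a # ys \<and> w = xs @ b # ys) \<or> (y = xs @ ys \<and> w = xs @ a # ys) \<or> (y = xs @ a # ys \<and> w = xs @ ys)"
    unfolding edit_step_def by auto
  then consider (sub) "y = xs @ a # ys" "w = xs @ b # ys" | (ins) "y = xs @ ys" "w = xs @ a # ys" | (del) "y = xs @ a # ys" "w = xs @ ys"
    by blast
  thus ?case
  proof cases
    case sub
    obtain u' where u': "subseq u' (xs @ ys)" "subseq u' u" "length u \<le> length u' + 1"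
      using subseq_delete[OF u(2)[unfolded sub(1)]] by blast
    have "subseq (xs @ ys) w" unfolding sub(2) by (intro list_emb_append_mono) auto
    hence "subseq u' w" using u'(1) subseq_order.order_trans by blast
    thus ?thesis using u u' sub subseq_order.order_trans by (intro exI[of _ u']) auto
  next
    case ins
    have "subseq (xs @ ys) w" unfolding ins(2) by (intro list_emb_append_mono) auto
    hence "subseq u w" using u(2) ins(1) subseq_order.order_trans by blast
    thus ?thesis using u ins by (intro exI[of _ u]) auto
  next
    case del
    obtain u' where u': "subseq u' (xs @ ys)" "subseq u' u" "length u \<le> length u' + 1"
      using subseq_delete[OF u(2)[unfolded del(1)]] by blast
    thus ?thesis using u u' del subseq_order.order_trans by (intro exI[of _ u']) auto
  qed
qed

section \<open>Occurrences of a pattern under deletions\<close>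

fun occ :: "'a list \<Rightarrow> 'a list \<Rightarrow> nat" where
  "occ p [] = 0"
| "occ p (x # l) = of_bool (take (length p) (x # l) = p) + occ p l"

text \<open>Occurrences may overlap. Near the end \<open>take\<close> returns something too short to
  equal \<open>p\<close>, so only complete occurrences are counted.\<close>

lemma occ_sum: "occ p w = (\<Sum>i<length w. of_bool (take (length p) (drop i w) = p))"
proof (induction w)
  case (Cons x l)
  show ?case unfolding occ.simps Cons.IH length_Cons sum.lessThan_Suc_shift by simp
qed simp

lemma occ_le: "occ p w \<le> length w"
  by (induction w) auto

text \<open>Only occurrences that start at \<open>a\<close>, or at one of the
  \<open>length p\<close> positions before it, are affected. The minimum with
  \<open>length xs\<close> makes the induction close: a new front symbol matters only while it is
  near enough to \<open>a\<close>.\<close>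

lemma occ_delete:
  "\<bar>int (occ p (xs @ a # ys)) - int (occ p (xs @ ys))\<bar> \<le> 1 + int (min (length xs) (length p))"
proof (induction xs)
  case (Cons x xs)
  let ?A = "take (length p) (x # xs @ a # ys) = p" and ?B = "take (length p) (x # xs @ ys) = p"
  have *: "\<bar>int (occ p ((x # xs) @ a # ys)) - int (occ p ((x # xs) @ ys))\<bar>
    \<le> \<bar>of_bool ?A - of_bool ?B\<bar> + \<bar>int (occ p (xs @ a # ys)) - int (occ p (xs @ ys))\<bar>" by simp
  show ?case
  proof (cases "length p \<le> length xs")
    case True
    hence "take (length p) (x # xs @ a # ys) = take (length p) (x # xs @ ys)"
      by (cases "length p") auto
    hence "\<bar>of_bool ?A - of_bool ?B\<bar> = (0 :: int)" by simp
    thus ?thesis using * Cons True by (simp add: min_def del: occ.simps split: if_splits)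
  next
    case False
    have "\<bar>of_bool ?A - of_bool ?B\<bar> \<le> (1 :: int)" by simp
    thus ?thesis using * Cons False by (simp add: min_def del: occ.simps split: if_splits)
  qed
qed auto

lemma subseq_first_deletion:
  "subseq u w \<Longrightarrow> u = w \<or> (\<exists>xs a ys. w = xs @ a # ys \<and> subseq u (xs @ ys))"
proof (induction rule: list_emb.induct)
  case (list_emb_Nil ys)
  show ?case
  proof (cases ys)
    case (Cons a l)
    thus ?thesis by (intro disjI2 exI[of _ "[]"] exI[of _ a] exI[of _ l]) auto
  qed simp
next
  case (list_emb_Cons xs ys y)
  thus ?case by (intro disjI2 exI[of _ "[]"] exI[of _ y] exI[of _ ys]) auto
next
  case (list_emb_Cons2 x y xs ys)
  show ?case
  proof (cases "xs = ys")
    case False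
    then obtain zs a us where z: "ys = zs @ a # us" "subseq xs (zs @ us)" using list_emb_Cons2 by blast
    thus ?thesis using list_emb_Cons2(1) by (intro disjI2 exI[of _ "x # zs"] exI[of _ a] exI[of _ us]) auto
  qed (use list_emb_Cons2 in auto)
qed

text \<open>Delete the symbols of \<open>w\<close> missing from \<open>u\<close> one at a time; each
  deletion changes the count by at most 1 + length p.\<close>

lemma occ_subseq:
  "subseq u w \<Longrightarrow> \<bar>int (occ p u) - int (occ p w)\<bar> \<le> (1 + int (length p)) * (int (length w) - int (length u))"
proof (induction "length w" arbitrary: w rule: less_induct)
  case less
  show ?case
  proof (cases "u = w")
    case False
    then obtain xs a ys where w: "w = xs @ a # ys" "subseq u (xs @ ys)" using subseq_first_deletion[OF less.prems] by blast
    have "\<bar>int (occ p u) - int (occ p (xs @ ys))\<bar> \<le> (1 + int (length p)) * (int (length (xs @ ys)) - int (length u))"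
      using less.hyps[of "xs @ ys"] w by simp
    moreover have "\<bar>int (occ p w) - int (occ p (xs @ ys))\<bar> \<le> 1 + int (length p)"
      using occ_delete[of p xs a ys] w by (auto simp: min_def split: if_splits)
    moreover have "(1 + int (length p)) * (int (length w) - int (length u))
      = (1 + int (length p)) * (int (length (xs @ ys)) - int (length u)) + (1 + int (length p))"
      using w by (simp add: algebra_simps)
    ultimately show ?thesis by linarith
  qed simp
qed

text \<open>A consequence of edit distance at most \<open>k\<close> that forgets the edit script. It
  is symmetric, and it suffices for lengths, for pattern counts and for counting neighbours.\<close>

definition close_words :: "nat \<Rightarrow> 'a list \<Rightarrow> 'a list \<Rightarrow> bool" where
  "close_words k v w \<longleftrightarrow> (\<exists>u. subseq u v \<and> subseq u w \<and> length v \<le> length u + k \<and> length w \<le> length u + k)"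

lemma edit_dist_close: "edit_dist v w \<le> k \<Longrightarrow> close_words k v w"
  using edit_path_common_subseq[OF edit_dist_path[of v w]] unfolding close_words_def by fastforce

lemma close_words_length:
  assumes "close_words k v w" shows "length v \<le> length w + k" "length w \<le> length v + k"
  using assms list_emb_length unfolding close_words_def by (fastforce)+

lemma close_words_occ:
  assumes "close_words k v w"
  shows "\<bar>real (occ p v) - real (occ p w)\<bar> \<le> 2 * (1 + real (length p)) * real k"
proof -
  obtain u where u: "subseq u v" "subseq u w" "length v \<le> length u + k" "length w \<le> length u + k"
    using assms by (auto simp: close_words_def)
  have "\<bar>int (occ p u) - int (occ p v)\<bar> \<le> (1 + int (length p)) * int k"
    by (rule order.trans[OF occ_subseq[OF u(1)]]) (use u in \<open>intro mult_left_mono, auto\<close>)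
  moreover have "\<bar>int (occ p u) - int (occ p w)\<bar> \<le> (1 + int (length p)) * int k"
    by (rule order.trans[OF occ_subseq[OF u(2)]]) (use u in \<open>intro mult_left_mono, auto\<close>)
  ultimately have "\<bar>int (occ p v) - int (occ p w)\<bar> \<le> 2 * (1 + int (length p)) * int k" by linarith
  hence "real_of_int \<bar>int (occ p v) - int (occ p w)\<bar> \<le> real_of_int (2 * (1 + int (length p)) * int k)"
    by (simp only: of_int_le_iff)
  thus ?thesis by simp
qed

text \<open>The weight \<open>t\<close> yields a bound \<open>t\<^sup>-\<^sup>k (1 + t)\<^sup>n\<close>, which is subexponential when \<open>k = o(n)\<close> and then \<open>t\<close> tends
  to 0. Counting edit scripts would give about \<open>n\<^sup>k\<close>, which is too much: \<open>g(n) ln n\<close> need not be \<open>o(n)\<close>.\<close>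

lemma card_dense_subseqs:
  assumes t: "0 < t" "t \<le> (1 :: real)"
  shows "finite {u. subseq u v \<and> length v \<le> length u + k} \<and>
    real (card {u. subseq u v \<and> length v \<le> length u + k}) * t ^ k \<le> (1 + t) ^ length v"
proof (induction v arbitrary: k)
  case Nil
  have "{u. subseq u [] \<and> length [] \<le> length u + k} = {[] :: 'a list}" by auto
  thus ?case using t by (simp add: power_le_one)
next
  case (Cons x v)
  let ?A = "\<lambda>v k. {u. subseq u v \<and> length v \<le> length u + k}"
  show ?case
  proof (cases k)
    case 0
    have "?A (x # v) 0 \<subseteq> (#) x ` ?A v 0"
    proof
      fix u assume "u \<in> ?A (x # v) 0"
      hence u: "subseq u (x # v)" "length u \<ge> length (x # v)" by auto
      hence "u = x # v" using subseq_same_length[OF u(1)] list_emb_length[OF u(1)] by simp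
      thus "u \<in> (#) x ` ?A v 0" by auto
    qed
    hence f: "finite (?A (x # v) 0)" and "card (?A (x # v) 0) \<le> card (?A v 0)"
      using Cons[of 0] by (auto intro: finite_subset surj_card_le)
    hence "real (card (?A (x # v) 0)) \<le> (1 + t) ^ length v" using Cons[of 0] by simp
    also have "\<dots> \<le> (1 + t) ^ length (x # v)" using t by (intro power_increasing) auto
    finally show ?thesis using f 0 by simp
  next
    case (Suc k')
    have sub: "?A (x # v) k \<subseteq> (#) x ` ?A v k \<union> ?A v k'"
    proof
      fix u assume "u \<in> ?A (x # v) k"
      hence u: "subseq u (x # v)" "length (x # v) \<le> length u + k" by auto
      show "u \<in> (#) x ` ?A v k \<union> ?A v k'"
      proof (cases "subseq u v")
        case True
        thus ?thesis using u Suc by auto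
      next
        case False
        then obtain u1 where "u = x # u1" "subseq u1 v" using u(1) by (cases u) (auto split: if_splits)
        thus ?thesis using u by auto
      qed
    qed
    have fin: "finite (?A v k)" "finite (?A v k')" using Cons by auto
    hence f: "finite (?A (x # v) k)" using sub by (auto intro: finite_subset)
    have "card (?A (x # v) k) \<le> card ((#) x ` ?A v k \<union> ?A v k')" using sub fin by (intro card_mono) auto
    also have "\<dots> \<le> card ((#) x ` ?A v k) + card (?A v k')" by (rule card_Un_le)
    also have "\<dots> \<le> card (?A v k) + card (?A v k')" using fin by (simp add: card_image_le)
    finally have "real (card (?A (x # v) k)) * t ^ k \<le> real (card (?A v k) + card (?A v k')) * t ^ k"
      using t by (intro mult_right_mono) auto
    also have "\<dots> = real (card (?A v k)) * t ^ k + t * (real (card (?A v k')) * t ^ k')"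
      by (simp add: Suc algebra_simps)
    also have "\<dots> \<le> (1 + t) ^ length v + t * (1 + t) ^ length v"
      using Cons t by (intro add_mono mult_left_mono) auto
    finally show ?thesis using f by (simp add: algebra_simps)
  qed
qed

text \<open>The first letter of \<open>w\<close> either matches the head of \<open>u\<close> or is
  an additional letter. The latter has \<open>m\<close> choices and uses up one of the
  \<open>j\<close> free places, hence a factor m t beside the factor 1 of a match.\<close>

lemma card_superseqs:
  assumes t: "0 < t" "t \<le> (1 :: real)" and n: "n \<le> length u + j"
  shows "real (card {w \<in> words m n. subseq u w}) * t ^ j \<le> (1 + real m * t) ^ n"
  using n
proof (induction n arbitrary: u j)
  case 0
  have "{w \<in> words m 0. subseq u w} \<subseteq> {[]}" by (auto simp: words_def)
  hence "card {w \<in> words m 0. subseq u w} \<le> 1" using card_mono[of "{[] :: nat list}" "{w \<in> words m 0. subseq u w}"] by simp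
  hence "real (card {w \<in> words m 0. subseq u w}) \<le> 1" by simp
  moreover have "t ^ j \<le> 1" using t by (intro power_le_one) auto
  ultimately have "real (card {w \<in> words m 0. subseq u w}) * t ^ j \<le> 1 * 1"
    using t by (intro mult_mono) auto
  thus ?case by simp
next
  case (Suc n)
  let ?B = "\<lambda>n u. {w \<in> words m n. subseq u w}"
  have fin: "finite (?B n u)" for n u by simp
  \<comment> \<open>The words whose first letter is additional, so that all of \<open>u\<close> must
    embed into the tail.\<close>
  define P where "P = (\<Union>y\<in>{1..m}. (#) y ` ?B n u)"
  have P: "real (card P) * t ^ j \<le> real m * t * (1 + real m * t) ^ n"
  proof (cases j)
    case 0
    have "?B n u = {}"
    proof -
      have False if "w \<in> ?B n u" for w
        using that Suc.prems 0 list_emb_length[of "(=)" u w] by (auto simp: words_def)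
      thus ?thesis by blast
    qed
    hence "P = {}" unfolding P_def by blast
    thus ?thesis using t by simp
  next
    case (Suc j')
    have "card P \<le> (\<Sum>y\<in>{1..m}. card ((#) y ` ?B n u))" unfolding P_def by (intro card_UN_le) simp
    also have "\<dots> \<le> (\<Sum>y\<in>{1..m}. card (?B n u))" using fin by (intro sum_mono card_image_le)
    finally have "real (card P) \<le> real m * real (card (?B n u))" by (simp flip: of_nat_mult)
    hence "real (card P) * t ^ j \<le> real m * real (card (?B n u)) * t ^ j" using t by (intro mult_right_mono) auto
    also have "\<dots> = real m * t * (real (card (?B n u)) * t ^ j')" by (simp add: Suc)
    also have "\<dots> \<le> real m * t * (1 + real m * t) ^ n"
      using Suc.IH[of u j'] Suc.prems \<open>j = Suc j'\<close> t by (intro mult_left_mono) auto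
    finally show ?thesis .
  qed
  have decomp: "\<exists>y w'. w = y # w' \<and> y \<in> {1..m} \<and> w' \<in> words m n" if "w \<in> words m (Suc n)" for w
    using that by (cases w) (auto simp: words_def)
  show ?case
  proof (cases u)
    case Nil
    have "?B (Suc n) u \<subseteq> P"
    proof
      fix w assume "w \<in> ?B (Suc n) u"
      then obtain y w' where "w = y # w'" "y \<in> {1..m}" "w' \<in> words m n" using decomp by blast
      thus "w \<in> P" unfolding P_def using Nil by auto
    qed
    hence "card (?B (Suc n) u) \<le> card P" by (intro card_mono) (auto simp: P_def)
    hence "real (card (?B (Suc n) u)) * t ^ j \<le> real (card P) * t ^ j" using t by (intro mult_right_mono) auto
    also have "\<dots> \<le> real m * t * (1 + real m * t) ^ n" by (rule P)
    also have "\<dots> \<le> (1 + real m * t) ^ Suc n" using t by (simp add: algebra_simps)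
    finally show ?thesis .
  next
    case (Cons x u1)
    have "?B (Suc n) u \<subseteq> (#) x ` ?B n u1 \<union> P"
    proof
      fix w assume w: "w \<in> ?B (Suc n) u"
      then obtain y w' where y: "w = y # w'" "y \<in> {1..m}" "w' \<in> words m n" using decomp by blast
      have "subseq (x # u1) (y # w')" using w y Cons by simp
      hence "(x = y \<and> subseq u1 w') \<or> subseq u w'" using Cons by (auto split: if_splits)
      thus "w \<in> (#) x ` ?B n u1 \<union> P" unfolding P_def using y by auto
    qed
    hence "card (?B (Suc n) u) \<le> card ((#) x ` ?B n u1 \<union> P)" by (intro card_mono) (auto simp: P_def)
    also have "\<dots> \<le> card ((#) x ` ?B n u1) + card P" by (rule card_Un_le)
    also have "\<dots> \<le> card (?B n u1) + card P" using fin by (simp add: card_image_le)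
    finally have "real (card (?B (Suc n) u)) * t ^ j \<le> real (card (?B n u1) + card P) * t ^ j"
      using t by (intro mult_right_mono) auto
    also have "\<dots> = real (card (?B n u1)) * t ^ j + real (card P) * t ^ j" by (simp add: algebra_simps)
    also have "\<dots> \<le> (1 + real m * t) ^ n + real m * t * (1 + real m * t) ^ n"
      using Suc.IH[of u1 j] Suc.prems Cons P by (intro add_mono) auto
    finally show ?thesis by (simp add: algebra_simps)
  qed
qed

text \<open>Every close \<open>w\<close> is reached from \<open>v\<close> through a common
  subsequence \<open>u\<close>: first \<open>u\<close> inside \<open>v\<close>, then
  \<open>w\<close> above \<open>u\<close>. Each of the two choices pays
  \<open>t ^ k\<close>.\<close>

lemma card_close_words:
  assumes t: "0 < t" "t \<le> (1 :: real)"
  shows "real (card {w \<in> words m n. close_words k w v}) * t ^ (2 * k) \<le> (1 + t) ^ length v * (1 + real m * t) ^ n"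
proof -
  let ?A = "{u. subseq u v \<and> length v \<le> length u + k}"
  let ?B = "\<lambda>u. {w \<in> words m n. subseq u w \<and> n \<le> length u + k}"
  have A: "finite ?A" "real (card ?A) * t ^ k \<le> (1 + t) ^ length v" using card_dense_subseqs[OF t] by auto
  have B: "real (card (?B u)) * t ^ k \<le> (1 + real m * t) ^ n" for u
  proof (cases "n \<le> length u + k")
    case True
    thus ?thesis using card_superseqs[OF t True, of m] by simp
  next
    case False
    thus ?thesis using t by simp
  qed
  have "{w \<in> words m n. close_words k w v} \<subseteq> (\<Union>u\<in>?A. ?B u)"
    by (auto simp: close_words_def words_def)
  hence "card {w \<in> words m n. close_words k w v} \<le> card (\<Union>u\<in>?A. ?B u)" using A by (intro card_mono) auto
  also have "\<dots> \<le> (\<Sum>u\<in>?A. card (?B u))" using A by (intro card_UN_le)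
  finally have "real (card {w \<in> words m n. close_words k w v}) * t ^ (2 * k) \<le> real (\<Sum>u\<in>?A. card (?B u)) * t ^ (2 * k)"
    using t by (intro mult_right_mono) (auto simp flip: of_nat_sum)
  also have "\<dots> = (\<Sum>u\<in>?A. t ^ k * (real (card (?B u)) * t ^ k))"
    unfolding of_nat_sum sum_distrib_right by (intro sum.cong) (simp_all add: mult_2 power_add)
  also have "\<dots> \<le> (\<Sum>u\<in>?A. t ^ k * (1 + real m * t) ^ n)"
    using B t by (intro sum_mono mult_left_mono) auto
  also have "\<dots> = (real (card ?A) * t ^ k) * (1 + real m * t) ^ n" by simp
  also have "\<dots> \<le> (1 + t) ^ length v * (1 + real m * t) ^ n" using A t by (intro mult_right_mono) auto
  finally show ?thesis .
qed

section \<open>Coding sequences of words by points\<close>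

text \<open>\<open>a j\<close> is the start of block \<open>j\<close>, and consecutive blocks are
  separated by gaps of at most \<tau> symbols. The position \<open>a K\<close> after the last gap is
  included, so every block has a right end.\<close>

definition block_code :: "nat \<Rightarrow> nat \<Rightarrow> (nat \<Rightarrow> nat list) \<Rightarrow> seq \<Rightarrow> (nat \<Rightarrow> nat) \<Rightarrow> bool" where
  "block_code \<tau> K v x a \<longleftrightarrow> a 0 = 0 \<and> (\<forall>j<K. word x (a j) (length (v j)) = v j \<and>
     a j + length (v j) \<le> a (Suc j) \<and> a (Suc j) \<le> a j + length (v j) + \<tau>)"

lemma block_code_bounds:
  assumes bc: "block_code \<tau> K v x a" and len: "\<And>j. j < K \<Longrightarrow> n \<le> length (v j) + g \<and> length (v j) \<le> n + g"
    and jl: "j + l \<le> K"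
  shows "a j + l * (n - g) \<le> a (j + l)" "a (j + l) \<le> a j + l * (n + g + \<tau>)"
proof -
  have "a j + l * (n - g) \<le> a (j + l) \<and> a (j + l) \<le> a j + l * (n + g + \<tau>)" using jl
  proof (induction l)
    case (Suc l)
    have s: "j + l < K" using Suc.prems by simp
    have "a (j + l) + length (v (j + l)) \<le> a (Suc (j + l))" "a (Suc (j + l)) \<le> a (j + l) + length (v (j + l)) + \<tau>"
      using bc s by (auto simp: block_code_def)
    moreover have "n - g \<le> length (v (j + l))" "length (v (j + l)) \<le> n + g" using len[OF s] by auto
    ultimately show ?case using Suc by simp
  qed simp
  thus "a j + l * (n - g) \<le> a (j + l)" "a (j + l) \<le> a j + l * (n + g + \<tau>)" by auto
qed

text \<open>The two counts differ only at starts from which the pattern would run over the right end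
  of the word, and there are at most \<open>length p\<close> of these.\<close>

lemma occ_word:
  "\<bar>(\<Sum>i<L. of_bool (word x (s + i) (length p) = p)) - real (occ p (word x s L))\<bar> \<le> real (length p)"
proof -
  have occ: "real (occ p (word x s L)) = (\<Sum>i<L. of_bool (take (length p) (drop i (word x s L)) = p))"
    unfolding occ_sum by simp
  have "\<bar>(\<Sum>i<L. of_bool (word x (s + i) (length p) = p)) - real (occ p (word x s L))\<bar>
    = \<bar>\<Sum>i<L. of_bool (word x (s + i) (length p) = p) - of_bool (take (length p) (drop i (word x s L)) = p) :: real\<bar>"
    unfolding occ sum_subtractf ..
  also have "\<dots> \<le> (\<Sum>i<L. of_bool (L < i + length p))"
  proof (rule order.trans[OF sum_abs sum_mono])
    fix i assume i: "i \<in> {..<L}"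
    have "take (length p) (drop i (word x s L)) = word x (s + i) (min (length p) (L - i))"
      by (simp only: drop_word take_word)
    thus "\<bar>of_bool (word x (s + i) (length p) = p) - of_bool (take (length p) (drop i (word x s L)) = p)\<bar> \<le> (of_bool (L < i + length p) :: real)"
      using i by (cases "L < i + length p") auto
  qed
  also have "\<dots> = real (card {i. i < L \<and> L < i + length p})"
    by (simp add: Int_def conj_commute)
  also have "\<dots> \<le> real (card {L - length p..<L})" by (intro of_nat_mono card_mono) auto
  also have "\<dots> \<le> real (length p)" by simp
  finally show ?thesis .
qed

text \<open>A window that starts inside block \<open>j\<close> is compared with the \<open>r\<close>
  blocks that follow. Each end may be displaced by one block length; drift adds g + \<tau> for each
  of the \<open>r\<close> blocks, and each block adds \<tau> for its gap, \<open>length p\<close>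
  for its boundary and \<open>E\<close> for the replacement of its word.\<close>

lemma window_estimate:
  assumes bc: "block_code \<tau> K v x a" and len: "\<And>j. j < K \<Longrightarrow> n \<le> length (v j) + g \<and> length (v j) \<le> n + g"
    and E: "\<And>j. j < K \<Longrightarrow> \<bar>real (occ p (v j)) - real (occ p (\<omega> j))\<bar> \<le> E"
    and gn: "g \<le> n" and jr: "j + r < K" and i: "a j \<le> i" "i < a (Suc j)"
  shows "\<bar>(\<Sum>i'<r * n. of_bool (word x (i + i') (length p) = p)) - (\<Sum>l<r. real (occ p (\<omega> (j + 1 + l))))\<bar>
    \<le> 2 * real (n + g + \<tau>) + real r * (real g + 2 * real \<tau> + real (length p) + E)"
proof -
  define b where "b i = (of_bool (word x i (length p) = p) :: real)" for i
  \<comment> \<open>The cumulative count of occurrences. It is 1-Lipschitz, so moving an endpoint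
    costs at most the distance moved.\<close>
  define F where "F e = (\<Sum>i<e. b i)" for e
  have b01: "0 \<le> b i" "b i \<le> 1" for i by (auto simp: b_def)
  have F_diff: "F (s + l) = F s + (\<Sum>i<l. b (s + i))" for s l
    by (induction l) (simp_all add: F_def)
  have lip1: "\<bar>F (s + l) - F s\<bar> \<le> real l" for s l
  proof -
    have "(\<Sum>i<l. b (s + i)) \<le> (\<Sum>i<l. 1)" by (intro sum_mono b01)
    moreover have "0 \<le> (\<Sum>i<l. b (s + i))" by (intro sum_nonneg b01)
    ultimately show ?thesis by (simp add: F_diff)
  qed
  have lip: "\<bar>F e - F s\<bar> \<le> \<bar>real e - real s\<bar>" for e s
    using lip1[of s "e - s"] lip1[of e "s - e"] by (cases "s \<le> e") auto
  have block: "\<bar>F (a (Suc k)) - F (a k) - real (occ p (v k))\<bar> \<le> real (length p) + real \<tau>" if k: "k < K" for k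
  proof -
    let ?L = "length (v k)"
    have w: "word x (a k) ?L = v k" "a k + ?L \<le> a (Suc k)" "a (Suc k) \<le> a k + ?L + \<tau>"
      using bc k by (auto simp: block_code_def)
    have 1: "\<bar>F (a (Suc k)) - F (a k + ?L)\<bar> \<le> real \<tau>" using lip[of "a (Suc k)" "a k + ?L"] w by auto
    have 2: "\<bar>(\<Sum>i<?L. b (a k + i)) - real (occ p (v k))\<bar> \<le> real (length p)"
      using occ_word[of x "a k" p ?L] w(1) by (simp add: b_def)
    show ?thesis using 1 2 F_diff[of "a k" ?L] by linarith
  qed
  have blocks: "\<bar>F (a (j + 1 + l)) - F (a (j + 1)) - (\<Sum>l'<l. real (occ p (\<omega> (j + 1 + l'))))\<bar> \<le> real l * (real \<tau> + real (length p) + E)"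
    if "l \<le> r" for l using that
  proof (induction l)
    case (Suc l)
    have k: "j + 1 + l < K" using Suc.prems jr by simp
    have "\<bar>F (a (j + 1 + l)) - F (a (j + 1)) - (\<Sum>l'<l. real (occ p (\<omega> (j + 1 + l'))))\<bar> \<le> real l * (real \<tau> + real (length p) + E)"
      using Suc by simp
    moreover have "\<bar>F (a (Suc (j + 1 + l))) - F (a (j + 1 + l)) - real (occ p (\<omega> (j + 1 + l)))\<bar> \<le> real \<tau> + real (length p) + E"
      using block[OF k] E[OF k] by linarith
    moreover have "real (Suc l) * (real \<tau> + real (length p) + E) = real l * (real \<tau> + real (length p) + E) + (real \<tau> + real (length p) + E)"
      by (simp add: algebra_simps)
    ultimately show ?case by simp
  qed simp
  have aj: "a (Suc j) \<le> a j + (n + g + \<tau>)"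
    using block_code_bounds(2)[OF bc len, of j 1] jr by simp
  have up: "a (j + 1 + r) \<le> a (j + 1) + r * (n + g + \<tau>)" and lo: "a (j + 1) + r * (n - g) \<le> a (j + 1 + r)"
    using block_code_bounds[OF bc len, of "j + 1" r] jr by auto
  have s: "\<bar>F (a (j + 1)) - F i\<bar> \<le> real (n + g + \<tau>)"
    using lip[of "a (j + 1)" i] i aj by (simp add: of_nat_diff)
  have rn: "real (r * n) = real r * real n" by simp
  have A1: "real (a (j + 1 + r)) \<le> real (a (j + 1)) + (real r * real n + real r * real g + real r * real \<tau>)"
  proof -
    have "real (a (j + 1 + r)) \<le> real (a (j + 1) + r * (n + g + \<tau>))" using up by (rule of_nat_mono)
    thus ?thesis by (simp add: distrib_left)
  qed
  have A2: "real (a (j + 1)) + (real r * real n - real r * real g) \<le> real (a (j + 1 + r))"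
  proof -
    have "real (a (j + 1) + r * (n - g)) \<le> real (a (j + 1 + r))" using lo by (rule of_nat_mono)
    thus ?thesis using gn by (simp add: of_nat_diff right_diff_distrib)
  qed
  have A3: "real i < real (a (j + 1))" "real (a (j + 1)) \<le> real i + real (n + g + \<tau>)" using i aj by auto
  have "0 \<le> real r * real \<tau>" "0 \<le> real (n + g + \<tau>)" by simp_all
  hence "\<bar>real i + real r * real n - real (a (j + 1 + r))\<bar> \<le> real (n + g + \<tau>) + (real r * real g + real r * real \<tau>)"
    using A1 A2 A3 by (intro abs_leI) linarith+
  hence "\<bar>real (i + r * n) - real (a (j + 1 + r))\<bar> \<le> real (n + g + \<tau>) + real r * (real g + real \<tau>)"
    by (simp add: distrib_left)
  with lip[of "i + r * n" "a (j + 1 + r)"]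
  have e: "\<bar>F (i + r * n) - F (a (j + 1 + r))\<bar> \<le> real (n + g + \<tau>) + real r * (real g + real \<tau>)" by linarith
  let ?S = "\<Sum>l<r. real (occ p (\<omega> (j + 1 + l)))"
  have tri: "\<bar>A + B + C\<bar> \<le> \<bar>A\<bar> + \<bar>B\<bar> + \<bar>C\<bar>" for A B C :: real by linarith
  have "(\<Sum>i'<r * n. b (i + i')) - ?S = (F (i + r * n) - F (a (j + 1 + r))) + (F (a (j + 1 + r)) - F (a (j + 1)) - ?S) + (F (a (j + 1)) - F i)"
    by (simp add: F_diff)
  hence "\<bar>(\<Sum>i'<r * n. b (i + i')) - ?S\<bar> \<le> \<bar>F (i + r * n) - F (a (j + 1 + r))\<bar> + \<bar>F (a (j + 1 + r)) - F (a (j + 1)) - ?S\<bar> + \<bar>F (a (j + 1)) - F i\<bar>"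
    using tri by metis
  also have "\<dots> \<le> (real (n + g + \<tau>) + real r * (real g + real \<tau>)) + real r * (real \<tau> + real (length p) + E) + real (n + g + \<tau>)"
    by (intro add_mono e s blocks) simp
  also have "\<dots> = 2 * real (n + g + \<tau>) + real r * (real g + 2 * real \<tau> + real (length p) + E)"
    by (simp add: algebra_simps)
  finally show ?thesis unfolding b_def .
qed

text \<open>Each time is charged to the block that contains it. A block contains at most n + g +
  \<tau> times, and at each of them the squared error is at most twice the squared window error plus
  twice the deviation of the following \<open>r\<close> words. The condition J + r < K keeps these
  words inside the coded part.\<close>

lemma code_average:
  fixes Q :: "(nat \<Rightarrow> nat list) pmf"
  assumes fin: "finite (set_pmf Q)"
    and bc: "\<And>\<omega>. \<omega> \<in> set_pmf Q \<Longrightarrow> block_code \<tau> K (v \<omega>) (x \<omega>) (a \<omega>)"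
    and len: "\<And>\<omega> j. \<omega> \<in> set_pmf Q \<Longrightarrow> j < K \<Longrightarrow> n \<le> length (v \<omega> j) + g \<and> length (v \<omega> j) \<le> n + g"
    and E: "\<And>\<omega> j. \<omega> \<in> set_pmf Q \<Longrightarrow> j < K \<Longrightarrow> \<bar>real (occ p (v \<omega> j)) - real (occ p (\<omega> j))\<bar> \<le> E"
    and gn: "g < n" and r: "r > 0" and JK: "J + r < K"
    and e: "(2 * real (n + g + \<tau>) + real r * (real g + 2 * real \<tau> + real (length p) + E)) / real (r * n) \<le> e"
    and \<delta>: "\<And>j. j < J \<Longrightarrow> measure_pmf.expectation Q (\<lambda>\<omega>. ((\<Sum>l<r. real (occ p (\<omega> (j + 1 + l)))) / real (r * n) - c)\<^sup>2) \<le> \<delta>"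
  shows "(\<Sum>i<J * (n - g). measure_pmf.expectation Q (\<lambda>\<omega>. (freq (r * n) p ((shift ^^ i) (x \<omega>)) - c)\<^sup>2))
    \<le> real J * real (n + g + \<tau>) * (2 * e\<^sup>2 + 2 * \<delta>)"
proof -
  define D where "D = n + g + \<tau>"
  define dev where "dev j \<omega> = ((\<Sum>l<r. real (occ p (\<omega> (j + 1 + l)))) / real (r * n) - c)\<^sup>2" for j \<omega>
  define \<phi> where "\<phi> \<omega> i = (freq (r * n) p ((shift ^^ i) (x \<omega>)) - c)\<^sup>2" for \<omega> i
  have rn: "real (r * n) > 0" using gn r by simp
  have pt: "(\<Sum>i<J * (n - g). \<phi> \<omega> i) \<le> (\<Sum>j<J. real D * (2 * e\<^sup>2 + 2 * dev j \<omega>))" if \<omega>: "\<omega> \<in> set_pmf Q" for \<omega>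
  proof -
    note bc' = bc[OF \<omega>] and len' = len[OF \<omega>] and E' = E[OF \<omega>]
    have a0: "a \<omega> 0 = 0" using bc' by (simp add: block_code_def)
    have aS: "a \<omega> j \<le> a \<omega> (Suc j)" "a \<omega> (Suc j) \<le> a \<omega> j + D" if "j < J" for j
      using block_code_bounds[OF bc' len', of j 1] that JK unfolding D_def by auto
    \<comment> \<open>The block positions depend on \<omega>, but n - g is a lower bound for all
      block lengths. So the range of times on the left is the same for all \<omega> and lies within
      the first \<open>J\<close> blocks.\<close>
    have "J * (n - g) \<le> a \<omega> J" using block_code_bounds(1)[OF bc' len', of 0 J] a0 JK by simp
    hence "(\<Sum>i<J * (n - g). \<phi> \<omega> i) \<le> (\<Sum>i<a \<omega> J. \<phi> \<omega> i)"
      by (intro sum_mono2) (auto simp: \<phi>_def)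
    also have "\<dots> = (\<Sum>j<J. \<Sum>i=a \<omega> j..<a \<omega> (Suc j). \<phi> \<omega> i)"
    proof -
      have "(\<Sum>i<a \<omega> J'. \<phi> \<omega> i) = (\<Sum>j<J'. \<Sum>i=a \<omega> j..<a \<omega> (Suc j). \<phi> \<omega> i)" if "J' \<le> J" for J' using that
      proof (induction J')
        case (Suc J')
        have "(\<Sum>i<a \<omega> (Suc J'). \<phi> \<omega> i) = (\<Sum>i<a \<omega> J'. \<phi> \<omega> i) + (\<Sum>i=a \<omega> J'..<a \<omega> (Suc J'). \<phi> \<omega> i)"
          using aS(1)[of J'] Suc.prems by (simp add: lessThan_atLeast0 sum.atLeastLessThan_concat)
        thus ?case using Suc by simp
      qed (simp add: a0)
      thus ?thesis by simp
    qed
    also have "\<dots> \<le> (\<Sum>j<J. real D * (2 * e\<^sup>2 + 2 * dev j \<omega>))"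
    proof (rule sum_mono)
      fix j assume j: "j \<in> {..<J}"
      have "(\<Sum>i=a \<omega> j..<a \<omega> (Suc j). \<phi> \<omega> i) \<le> (\<Sum>i=a \<omega> j..<a \<omega> (Suc j). 2 * e\<^sup>2 + 2 * dev j \<omega>)"
      proof (rule sum_mono)
        fix i assume i: "i \<in> {a \<omega> j..<a \<omega> (Suc j)}"
        let ?S = "\<Sum>l<r. real (occ p (\<omega> (j + 1 + l)))"
        have "\<bar>(\<Sum>i'<r * n. of_bool (word (x \<omega>) (i + i') (length p) = p)) - ?S\<bar>
            \<le> 2 * real (n + g + \<tau>) + real r * (real g + 2 * real \<tau> + real (length p) + E)"
          using i j JK gn by (intro window_estimate[OF bc' len' E']) auto
        moreover have "freq (r * n) p ((shift ^^ i) (x \<omega>)) = (\<Sum>i'<r * n. of_bool (word (x \<omega>) (i + i') (length p) = p)) / real (r * n)"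
          unfolding freq_def by simp
        ultimately have "\<bar>freq (r * n) p ((shift ^^ i) (x \<omega>)) - ?S / real (r * n)\<bar>
          \<le> (2 * real (n + g + \<tau>) + real r * (real g + 2 * real \<tau> + real (length p) + E)) / real (r * n)"
          using rn by (simp add: diff_divide_distrib[symmetric] abs_divide divide_right_mono del: of_nat_mult)
        hence "\<bar>freq (r * n) p ((shift ^^ i) (x \<omega>)) - ?S / real (r * n)\<bar> \<le> \<bar>e\<bar>" using e by linarith
        hence d2: "(freq (r * n) p ((shift ^^ i) (x \<omega>)) - ?S / real (r * n))\<^sup>2 \<le> e\<^sup>2"
          unfolding abs_le_square_iff .
        have sq: "(A + B)\<^sup>2 \<le> 2 * A\<^sup>2 + 2 * B\<^sup>2" for A B :: real
          using sum_squares_ge_zero[of "A - B" 0] by (simp add: power2_eq_square algebra_simps)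
        show "\<phi> \<omega> i \<le> 2 * e\<^sup>2 + 2 * dev j \<omega>"
          unfolding \<phi>_def dev_def
          using sq[of "freq (r * n) p ((shift ^^ i) (x \<omega>)) - ?S / real (r * n)" "?S / real (r * n) - c"] d2 by simp
      qed
      also have "\<dots> = real (a \<omega> (Suc j) - a \<omega> j) * (2 * e\<^sup>2 + 2 * dev j \<omega>)" by simp
      also have "\<dots> \<le> real D * (2 * e\<^sup>2 + 2 * dev j \<omega>)"
        using aS[of j] j by (intro mult_right_mono) (auto simp: dev_def)
      finally show "(\<Sum>i=a \<omega> j..<a \<omega> (Suc j). \<phi> \<omega> i) \<le> real D * (2 * e\<^sup>2 + 2 * dev j \<omega>)" .
    qed
    finally show ?thesis .
  qed
  have int: "integrable (measure_pmf Q) f" for f :: "(nat \<Rightarrow> nat list) \<Rightarrow> real"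
    by (rule integrable_measure_pmf_finite[OF fin])
  have "(\<Sum>i<J * (n - g). measure_pmf.expectation Q (\<lambda>\<omega>. \<phi> \<omega> i)) = measure_pmf.expectation Q (\<lambda>\<omega>. \<Sum>i<J * (n - g). \<phi> \<omega> i)"
    by (subst Bochner_Integration.integral_sum[OF int]) simp
  also have "\<dots> \<le> measure_pmf.expectation Q (\<lambda>\<omega>. \<Sum>j<J. real D * (2 * e\<^sup>2 + 2 * dev j \<omega>))"
    by (intro integral_mono_AE int AE_pmfI pt)
  also have "\<dots> = (\<Sum>j<J. real D * (2 * e\<^sup>2 + 2 * measure_pmf.expectation Q (dev j)))"
    using int by (subst Bochner_Integration.integral_sum[OF int]) simp
  also have "\<dots> \<le> (\<Sum>j<J. real D * (2 * e\<^sup>2 + 2 * \<delta>))"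
    using \<delta> unfolding dev_def by (intro sum_mono mult_left_mono add_left_mono) auto
  also have "\<dots> = real J * real (n + g + \<tau>) * (2 * e\<^sup>2 + 2 * \<delta>)" by (simp add: D_def)
  finally show ?thesis by (simp add: \<phi>_def)
qed

context subshift
begin

section \<open>From coded laws to the limit measure\<close>

lemma limit_integral_le:
  fixes \<Phi> :: "nat list \<Rightarrow> real"
  assumes fin: "\<And>J. finite (set_pmf (q J))" and qX: "\<And>J. set_pmf (q J) \<subseteq> X" and N0: "\<And>J. N J > 0"
    and bp: "\<nu> \<in> borel_prob_on X"
    and lim: "\<And>k B. (\<lambda>J. measure_pmf.prob (time_avg (N (r J)) (q (r J))) (cyl k B)) \<longlonglongrightarrow> measure \<nu> (cyl k B)"
    and bound: "\<And>J. (\<Sum>i<N J. measure_pmf.expectation (q J) (\<lambda>x. \<Phi> (word x i k))) \<le> real (N J) * b"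
  shows "(\<integral>x. \<Phi> (word x 0 k) \<partial>\<nu>) \<le> b"
proof -
  have le: "(\<Sum>w\<in>words m k. \<Phi> w * measure_pmf.prob (time_avg (N J) (q J)) (cyl k {w})) \<le> b" for J
  proof -
    have tX: "set_pmf (time_avg (N J) (q J)) \<subseteq> X"
      unfolding set_time_avg[OF N0] using qX shift_pow_X by fastforce
    have ex: "measure_pmf.expectation (q J) (\<lambda>x. \<Phi> (word x i k)) = (\<Sum>w\<in>words m k. \<Phi> w * measure_pmf.prob (q J) {x. word x i k = w})" for i
    proof -
      have "measure_pmf.expectation (q J) (\<lambda>x. \<Phi> (word x i k)) =
        measure_pmf.expectation (q J) (\<lambda>x. \<Sum>w\<in>words m k. \<Phi> w * indicator {x. word x i k = w} x)"
      proof (rule integral_cong_AE)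
        show "AE x in q J. \<Phi> (word x i k) = (\<Sum>w\<in>words m k. \<Phi> w * indicator {x. word x i k = w} x)"
        proof (rule AE_pmfI)
          fix x assume "x \<in> set_pmf (q J)"
          hence "word x i k \<in> words m k" using qX word_words by blast
          moreover have "(\<Sum>w\<in>words m k. \<Phi> w * indicator {x. word x i k = w} x) = (\<Sum>w\<in>words m k. if w = word x i k then \<Phi> w else 0)"
            by (intro sum.cong) (auto simp: indicator_def)
          ultimately show "\<Phi> (word x i k) = (\<Sum>w\<in>words m k. \<Phi> w * indicator {x. word x i k = w} x)" by simp
        qed
      qed auto
      also have "\<dots> = (\<Sum>w\<in>words m k. \<Phi> w * measure_pmf.prob (q J) {x. word x i k = w})"
        by (subst Bochner_Integration.integral_sum[OF integrable_measure_pmf_finite[OF fin]]) simp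
      finally show ?thesis .
    qed
    have "measure_pmf.prob (time_avg (N J) (q J)) (cyl k {w}) = (\<Sum>i<N J. measure_pmf.prob (q J) {x. word x i k = w}) / N J" for w
    proof -
      have "measure_pmf.prob (time_avg (N J) (q J)) {x. word x 0 k = w} = (\<Sum>i<N J. measure_pmf.prob (q J) {x. word x i k = w}) / N J"
        unfolding prob_time_avg[OF N0] by (simp add: vimage_def)
      thus ?thesis using prob_cyl_eq[OF tX, of k "{w}"] by simp
    qed
    hence "(\<Sum>w\<in>words m k. \<Phi> w * measure_pmf.prob (time_avg (N J) (q J)) (cyl k {w}))
      = (\<Sum>w\<in>words m k. \<Sum>i<N J. \<Phi> w * measure_pmf.prob (q J) {x. word x i k = w}) / N J"
      by (simp add: sum_divide_distrib sum_distrib_left)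
    also have "\<dots> = (\<Sum>i<N J. measure_pmf.expectation (q J) (\<lambda>x. \<Phi> (word x i k))) / N J"
      by (subst sum.swap) (simp add: ex)
    also have "\<dots> \<le> real (N J) * b / N J" using bound by (intro divide_right_mono) auto
    also have "\<dots> = b" using N0[of J] by simp
    finally show ?thesis .
  qed
  have "(\<lambda>J. \<Sum>w\<in>words m k. \<Phi> w * measure_pmf.prob (time_avg (N (r J)) (q (r J))) (cyl k {w}))
    \<longlonglongrightarrow> (\<Sum>w\<in>words m k. \<Phi> w * measure \<nu> (cyl k {w}))"
    by (intro tendsto_sum tendsto_mult tendsto_const lim)
  hence "(\<Sum>w\<in>words m k. \<Phi> w * measure \<nu> (cyl k {w})) \<le> b" by (rule LIMSEQ_le_const2) (use le in auto)
  thus ?thesis unfolding integral_word[OF bp] .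
qed

lemma integral_freq:
  assumes inv: "\<nu> \<in> invariant_measures X" and M: "M \<ge> 1"
  shows "(\<integral>x. freq M w x \<partial>\<nu>) = measure \<nu> (cyl (length w) {w})"
proof -
  note bp = invD[OF inv]
  interpret prob_space \<nu> using borel_probD[OF bp] by simp
  note [simp] = borel_probD(2)[OF bp]
  define Wi where "Wi i = {x \<in> X. word x i (length w) = w}" for i
  have Wi: "Wi i \<in> events" for i unfolding Wi_def using word_set_sets[OF bp, of i "length w" "{w}"] by simp
  have WiX: "Wi i \<inter> X = Wi i" for i by (auto simp: Wi_def)
  have p: "prob (Wi i) = prob (cyl (length w) {w})" for i
  proof -
    have "(shift ^^ i) -` cyl (length w) {w} \<inter> X = Wi i" using shift_pow_X by (auto simp: cyl_def Wi_def)
    thus ?thesis using inv_measure[OF inv cyl_sets[OF bp], of i] by metis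
  qed
  have "(\<integral>x. freq M w x \<partial>\<nu>) = (\<integral>x. (\<Sum>i<M. indicator (Wi i) x / real M) \<partial>\<nu>)"
    by (rule Bochner_Integration.integral_cong)
      (auto simp: freq_def Wi_def sum_divide_distrib indicator_def simp del: sum_of_bool_eq intro!: sum.cong)
  also have "\<dots> = (\<Sum>i<M. prob (Wi i) / real M)"
    using Wi WiX by (subst Bochner_Integration.integral_sum) (auto simp: emeasure_eq_measure)
  also have "\<dots> = prob (cyl (length w) {w})" unfolding p using M by simp
  finally show ?thesis .
qed

text \<open>Both bounds come from one identity: the mean square distance to \<open>c\<close> is the
  variance plus the squared distance of the mean from \<open>c\<close>.\<close>

lemma
  assumes inv: "\<nu> \<in> invariant_measures X" and M: "M \<ge> 1"
  shows deviation_le: "deviation \<nu> M w \<le> (\<integral>x. (freq M w x - c)\<^sup>2 \<partial>\<nu>)"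
    and measure_diff_le: "(measure \<nu> (cyl (length w) {w}) - c)\<^sup>2 \<le> (\<integral>x. (freq M w x - c)\<^sup>2 \<partial>\<nu>)"
proof -
  note bp = invD[OF inv]
  interpret prob_space \<nu> using borel_probD[OF bp] by simp
  let ?p = "measure \<nu> (cyl (length w) {w})"
  have i: "integrable \<nu> (\<lambda>x. (freq M w x - ?p)\<^sup>2)" "integrable \<nu> (freq M w)"
    by (intro integrable_continuous[OF _ bp] continuous_intros continuous_freq)+
  have "(\<integral>x. (freq M w x - c)\<^sup>2 \<partial>\<nu>) = (\<integral>x. (freq M w x - ?p)\<^sup>2 + (2 * (?p - c) * freq M w x + (c\<^sup>2 - ?p\<^sup>2)) \<partial>\<nu>)"
    by (simp add: power2_eq_square algebra_simps)
  also have "\<dots> = deviation \<nu> M w + (2 * (?p - c) * ?p + (c\<^sup>2 - ?p\<^sup>2))"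
    using i integral_freq[OF inv M, of w] by (simp add: deviation_def prob_space)
  also have "\<dots> = deviation \<nu> M w + (?p - c)\<^sup>2" by (simp add: power2_eq_square algebra_simps)
  finally have eq: "(\<integral>x. (freq M w x - c)\<^sup>2 \<partial>\<nu>) = deviation \<nu> M w + (?p - c)\<^sup>2" .
  have "deviation \<nu> M w \<ge> 0" by (simp add: deviation_def)
  thus "deviation \<nu> M w \<le> (\<integral>x. (freq M w x - c)\<^sup>2 \<partial>\<nu>)" "(?p - c)\<^sup>2 \<le> (\<integral>x. (freq M w x - c)\<^sup>2 \<partial>\<nu>)"
    using eq by auto
qed

lemma language_word: "w \<in> language X \<Longrightarrow> \<exists>x\<in>X. word x 0 (length w) = w"
proof -
  assume "w \<in> language X"
  hence "w \<in> language_n X (length w)" by (simp add: language_n_def)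
  then obtain x where "x \<in> X" "w = word x 0 (length w)" unfolding language_n_eq by blast
  thus ?thesis by metis
qed

end

section \<open>Gluing words and choosing coded points\<close>

locale approachable_shift = subshift +
  fixes G :: "nat list set" and \<tau> :: nat and g :: "nat \<Rightarrow> nat"
  assumes G_language: "G \<subseteq> language X"
    and spec: "u \<in> G \<Longrightarrow> v \<in> G \<Longrightarrow> \<exists>w\<in>language X. length w \<le> \<tau> \<and> u @ w @ v \<in> G"
    and g_lim: "(\<lambda>n. real (g n) / real n) \<longlonglongrightarrow> 0"
    and approx: "w \<in> language X \<Longrightarrow> \<exists>v\<in>G. edit_dist w v \<le> g (length w)"
begin

text \<open>The error of \<open>window_estimate\<close> per unit of window length, with
  \<open>E\<close> taken from \<open>close_words_occ\<close> for words at edit distance at most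
  \<open>g n\<close>.\<close>

abbreviation window_error :: "nat \<Rightarrow> nat \<Rightarrow> nat list \<Rightarrow> real" where
  "window_error n r p \<equiv> (2 * real (n + g n + \<tau>) + real r * (real (g n) + 2 * real \<tau> + real (length p)
    + 2 * (1 + real (length p)) * real (g n))) / real (r * n)"

lemma gluing:
  assumes v: "\<And>j. v j \<in> G"
  shows "\<exists>x\<in>X. \<exists>a. block_code \<tau> K v x a"
proof -
  \<comment> \<open>The glued word must stay in \<open>G\<close> so that it can be glued again. It
    carries K + 1 blocks because \<open>block_code\<close> for \<open>K\<close> blocks also refers
    to the position \<open>a K\<close>.\<close>
  have "\<exists>z\<in>G. \<exists>a. a 0 = 0 \<and> (\<forall>j\<le>K. take (length (v j)) (drop (a j) z) = v j \<and> a j + length (v j) \<le> length z)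
    \<and> (\<forall>j<K. a j + length (v j) \<le> a (Suc j) \<and> a (Suc j) \<le> a j + length (v j) + \<tau>) \<and> length z = a K + length (v K)"
  proof (induction K)
    case 0
    show ?case by (rule bexI[OF _ v[of 0]], rule exI[of _ "\<lambda>_. 0"]) auto
  next
    case (Suc K)
    then obtain z a where z: "z \<in> G" "a 0 = 0"
      "\<And>j. j \<le> K \<Longrightarrow> take (length (v j)) (drop (a j) z) = v j \<and> a j + length (v j) \<le> length z"
      "\<And>j. j < K \<Longrightarrow> a j + length (v j) \<le> a (Suc j) \<and> a (Suc j) \<le> a j + length (v j) + \<tau>"
      "length z = a K + length (v K)" by blast
    obtain w where w: "length w \<le> \<tau>" "z @ w @ v (Suc K) \<in> G" using spec[OF z(1) v[of "Suc K"]] by blast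
    define a' where "a' = a(Suc K := length z + length w)"
    show ?case
    proof (rule bexI[OF _ w(2)], rule exI[of _ a'], intro conjI allI impI)
      show "a' 0 = 0" using z(2) by (simp add: a'_def)
      fix j assume j: "j \<le> Suc K"
      show "take (length (v j)) (drop (a' j) (z @ w @ v (Suc K))) = v j"
        using z(3)[of j] j by (cases "j = Suc K") (auto simp: a'_def)
      show "a' j + length (v j) \<le> length (z @ w @ v (Suc K))"
        using z(3)[of j] j by (cases "j = Suc K") (auto simp: a'_def)
    next
      fix j assume j: "j < Suc K"
      show "a' j + length (v j) \<le> a' (Suc j)" "a' (Suc j) \<le> a' j + length (v j) + \<tau>"
        using z(4)[of j] z(5) w(1) j by (cases "j = K", auto simp: a'_def)+
    next
      show "length (z @ w @ v (Suc K)) = a' (Suc K) + length (v (Suc K))" by (simp add: a'_def)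
    qed
  qed
  then obtain z a where z: "z \<in> G" "a 0 = 0"
      "\<And>j. j \<le> K \<Longrightarrow> take (length (v j)) (drop (a j) z) = v j \<and> a j + length (v j) \<le> length z"
      "\<And>j. j < K \<Longrightarrow> a j + length (v j) \<le> a (Suc j) \<and> a (Suc j) \<le> a j + length (v j) + \<tau>" by blast
  obtain x where x: "x \<in> X" "word x 0 (length z) = z" using language_word z(1) G_language by blast
  have "word x (a j) (length (v j)) = v j" if "j < K" for j
  proof -
    have "take (length (v j)) (drop (a j) (word x 0 (length z))) = v j" using z(3)[of j] that x(2) by simp
    moreover have "a j + length (v j) \<le> length z" using z(3)[of j] that by simp
    ultimately show ?thesis by (simp add: drop_word take_word min_def split: if_splits)
  qed
  hence "block_code \<tau> K v x a" using z by (auto simp: block_code_def)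
  thus ?thesis using x(1) by blast
qed

definition apx :: "nat list \<Rightarrow> nat list" where
  "apx w = (SOME v. v \<in> G \<and> edit_dist w v \<le> g (length w))"

lemma
  assumes "w \<in> language X"
  shows apx_G: "apx w \<in> G" and apx_close: "close_words (g (length w)) w (apx w)"
proof -
  have "\<exists>v. v \<in> G \<and> edit_dist w v \<le> g (length w)" using approx[OF assms] by blast
  from someI_ex[OF this] show "apx w \<in> G" "close_words (g (length w)) w (apx w)"
    unfolding apx_def by (auto intro: edit_dist_close)
qed

text \<open>One point is fixed for each sequence of words, so that the coding is a function and laws
  on sequences can be pushed forward to \<open>X\<close>.\<close>

definition code_point :: "nat \<Rightarrow> (nat \<Rightarrow> nat list) \<Rightarrow> seq" where
  "code_point K \<omega> = (SOME x. x \<in> X \<and> (\<exists>a. block_code \<tau> K (\<lambda>j. apx (\<omega> j)) x a))"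

definition code_starts :: "nat \<Rightarrow> (nat \<Rightarrow> nat list) \<Rightarrow> nat \<Rightarrow> nat" where
  "code_starts K \<omega> = (SOME a. block_code \<tau> K (\<lambda>j. apx (\<omega> j)) (code_point K \<omega>) a)"

lemma
  assumes "\<And>j. \<omega> j \<in> language X"
  shows code_point_X: "code_point K \<omega> \<in> X"
    and code_block: "block_code \<tau> K (\<lambda>j. apx (\<omega> j)) (code_point K \<omega>) (code_starts K \<omega>)"
proof -
  have "\<exists>x. x \<in> X \<and> (\<exists>a. block_code \<tau> K (\<lambda>j. apx (\<omega> j)) x a)"
    using gluing[of "\<lambda>j. apx (\<omega> j)" K] apx_G assms by blast
  from someI_ex[OF this] have 1: "code_point K \<omega> \<in> X" "\<exists>a. block_code \<tau> K (\<lambda>j. apx (\<omega> j)) (code_point K \<omega>) a"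
    unfolding code_point_def by auto
  show "code_point K \<omega> \<in> X" by (rule 1)
  show "block_code \<tau> K (\<lambda>j. apx (\<omega> j)) (code_point K \<omega>) (code_starts K \<omega>)"
    unfolding code_starts_def by (rule someI_ex[OF 1(2)])
qed

lemma eventually_linear_g:
  fixes A B \<epsilon> :: real
  assumes "\<epsilon> > 0"
  shows "\<forall>\<^sub>F n in sequentially. A * real (g n) + B \<le> \<epsilon> * real n"
proof -
  have "(\<lambda>n. A * (real (g n) / real n) + B / real n) \<longlonglongrightarrow> A * 0 + 0"
    by (intro tendsto_intros g_lim lim_const_over_n)
  hence "\<forall>\<^sub>F n in sequentially. A * (real (g n) / real n) + B / real n < \<epsilon>"
    using assms by (intro order_tendstoD(2)[where y = "A * 0 + 0"]) auto
  thus ?thesis using eventually_gt_at_top[of 0]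
  proof eventually_elim
    case (elim n)
    hence "(A * (real (g n) / real n) + B / real n) * real n \<le> \<epsilon> * real n" by (intro mult_right_mono) auto
    thus ?case using elim by (simp add: field_simps)
  qed
qed

end

section \<open>Coding independent words\<close>

context subshift
begin

text \<open>The law under \<mu> of the initial word of length \<open>n\<close>, recast as a
  \<open>pmf\<close> so that independent copies are available as \<open>Pi_pmf\<close>.\<close>

definition word_law :: "seq measure \<Rightarrow> nat \<Rightarrow> nat list pmf" where
  "word_law \<mu> n = embed_pmf (\<lambda>w. if w \<in> words m n then measure \<mu> (cyl n {w}) else 0)"

lemma pmf_word_law:
  assumes bp: "\<mu> \<in> borel_prob_on X"
  shows "pmf (word_law \<mu> n) w = (if w \<in> words m n then measure \<mu> (cyl n {w}) else 0)"
  unfolding word_law_def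
proof (rule pmf_embed_pmf)
  have "(\<integral>\<^sup>+w. ennreal (if w \<in> words m n then measure \<mu> (cyl n {w}) else 0) \<partial>count_space UNIV)
    = (\<Sum>w\<in>words m n. ennreal (if w \<in> words m n then measure \<mu> (cyl n {w}) else 0))"
    by (rule nn_integral_count_space') auto
  also have "\<dots> = (\<Sum>w\<in>words m n. ennreal (measure \<mu> (cyl n {w})))" by simp
  also have "\<dots> = ennreal (\<Sum>w\<in>words m n. measure \<mu> (cyl n {w}))" by (rule sum_ennreal) simp
  also have "(\<Sum>w\<in>words m n. measure \<mu> (cyl n {w})) = 1"
    using integral_word[OF bp, of "\<lambda>_. 1" n] prob_space.prob_space[OF borel_probD(1)[OF bp]] by simp
  finally show "(\<integral>\<^sup>+w. ennreal (if w \<in> words m n then measure \<mu> (cyl n {w}) else 0) \<partial>count_space UNIV) = 1" by simp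
qed simp

lemma set_word_law:
  assumes bp: "\<mu> \<in> borel_prob_on X" shows "set_pmf (word_law \<mu> n) \<subseteq> language_n X n"
proof
  fix w assume "w \<in> set_pmf (word_law \<mu> n)"
  hence "pmf (word_law \<mu> n) w \<noteq> 0" by (simp add: set_pmf_iff)
  hence "measure \<mu> (cyl n {w}) \<noteq> 0" by (simp add: pmf_word_law[OF bp] split: if_splits)
  hence "cyl n {w} \<noteq> {}" by (metis measure_empty)
  thus "w \<in> language_n X n" unfolding language_n_eq cyl_def by blast
qed

lemma finite_word_law: "\<mu> \<in> borel_prob_on X \<Longrightarrow> finite (set_pmf (word_law \<mu> n))"
  using set_word_law finite_language_n finite_subset by metis

lemma expectation_word_law:
  fixes f :: "nat list \<Rightarrow> real"
  assumes bp: "\<mu> \<in> borel_prob_on X"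
  shows "measure_pmf.expectation (word_law \<mu> n) f = (\<integral>x. f (word x 0 n) \<partial>\<mu>)"
proof -
  have "measure_pmf.expectation (word_law \<mu> n) f = (\<Sum>w\<in>words m n. f w * pmf (word_law \<mu> n) w)"
    using set_word_law[OF bp] language_n_words by (intro integral_measure_pmf_real) auto
  also have "\<dots> = (\<Sum>w\<in>words m n. f w * measure \<mu> (cyl n {w}))"
    by (intro sum.cong) (auto simp: pmf_word_law[OF bp])
  also have "\<dots> = (\<integral>x. f (word x 0 n) \<partial>\<mu>)" by (rule integral_word[OF bp, symmetric])
  finally show ?thesis .
qed

text \<open>\<open>occ\<close> misses occurrences that cross the end of the word, which biases the
  frequency by at most length p / n; the mean of \<open>freq n p\<close> itself is exact by
  invariance.\<close>

lemma mean_occ: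
  assumes inv: "\<mu> \<in> invariant_measures X" and n: "n \<ge> 1"
  shows "\<bar>measure_pmf.expectation (word_law \<mu> n) (\<lambda>w. real (occ p w) / real n - measure \<mu> (cyl (length p) {p}))\<bar>
    \<le> real (length p) / real n"
proof -
  note bp = invD[OF inv]
  interpret prob_space \<mu> using borel_probD[OF bp] by simp
  let ?c = "measure \<mu> (cyl (length p) {p})"
  have i: "integrable \<mu> (freq n p)" "integrable \<mu> (\<lambda>x. real (occ p (word x 0 n)) / real n)"
    using integrable_continuous[OF _ bp] continuous_freq continuous_on_word[of "\<lambda>w. real (occ p w) / real n"] by auto
  have pt: "\<bar>real (occ p (word x 0 n)) / real n - freq n p x\<bar> \<le> real (length p) / real n" for x
  proof -
    have "\<bar>real (occ p (word x 0 n)) - (\<Sum>i<n. of_bool (word x i (length p) = p))\<bar> \<le> real (length p)"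
      using occ_word[of x 0 p n] by (simp add: abs_minus_commute)
    thus ?thesis unfolding freq_def diff_divide_distrib[symmetric] abs_divide using n
      by (simp add: divide_right_mono)
  qed
  have "measure_pmf.expectation (word_law \<mu> n) (\<lambda>w. real (occ p w) / real n - ?c)
      = (\<integral>x. real (occ p (word x 0 n)) / real n \<partial>\<mu>) - (\<integral>x. freq n p x \<partial>\<mu>)"
    unfolding expectation_word_law[OF bp] using i(2) integral_freq[OF inv n, of p] by (simp add: prob_space)
  also have "\<dots> = (\<integral>x. real (occ p (word x 0 n)) / real n - freq n p x \<partial>\<mu>)" using i by simp
  also have "\<bar>\<dots>\<bar> \<le> (\<integral>x. \<bar>real (occ p (word x 0 n)) / real n - freq n p x\<bar> \<partial>\<mu>)" by (rule integral_abs_bound)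
  also have "\<dots> \<le> (\<integral>x. real (length p) / real n \<partial>\<mu>)"
    using i pt by (intro integral_mono integrable_abs Bochner_Integration.integrable_diff) auto
  also have "\<dots> = real (length p) / real n" by (simp add: prob_space)
  finally show ?thesis .
qed

lemma finite_set_Pi_pmf: "finite A \<Longrightarrow> (\<And>x. x \<in> A \<Longrightarrow> finite (set_pmf (p x))) \<Longrightarrow> finite (set_pmf (Pi_pmf A d p))"
  by (subst set_Pi_pmf) auto

lemma expectation_Pi_two:
  fixes y :: "'b \<Rightarrow> real"
  assumes fin: "finite A" "finite (set_pmf P)" and uv: "u \<in> A" "v \<in> A" "u \<noteq> v"
  shows "measure_pmf.expectation (Pi_pmf A d (\<lambda>_. P)) (\<lambda>\<omega>. y (\<omega> u) * y (\<omega> v)) = (measure_pmf.expectation P y)\<^sup>2"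
proof -
  \<comment> \<open>The product formula for \<open>Pi_pmf\<close> needs nonnegative factors, hence the shift by \<open>C\<close>.\<close>
  define C where "C = (\<Sum>w\<in>set_pmf P. \<bar>y w\<bar>)"
  have C: "0 \<le> y w + C" if "w \<in> set_pmf P" for w
    using member_le_sum[OF that, of "\<lambda>w. \<bar>y w\<bar>"] fin(2) unfolding C_def by fastforce
  define f where "f i w = (if i = u \<or> i = v then y w + C else 1)" for i and w
  let ?Q = "Pi_pmf A d (\<lambda>_. P)" and ?m = "measure_pmf.expectation P y"
  have int: "integrable (measure_pmf ?Q) h" for h :: "('a \<Rightarrow> 'b) \<Rightarrow> real"
    by (intro integrable_measure_pmf_finite finite_set_Pi_pmf fin)
  have intP: "integrable (measure_pmf P) h" for h :: "'b \<Rightarrow> real"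
    by (rule integrable_measure_pmf_finite[OF fin(2)])
  have one: "measure_pmf.expectation ?Q (\<lambda>\<omega>. y (\<omega> i)) = ?m" if "i \<in> A" for i
  proof -
    have "measure_pmf.expectation ?Q (\<lambda>\<omega>. y (\<omega> i)) = measure_pmf.expectation (map_pmf (\<lambda>\<omega>. \<omega> i) ?Q) y" by simp
    also have "map_pmf (\<lambda>\<omega>. \<omega> i) ?Q = P" using that fin by (subst Pi_pmf_component) auto
    finally show ?thesis .
  qed
  have two: "(\<Prod>i\<in>A. h i) = h u * h v" if "\<And>i. i \<noteq> u \<Longrightarrow> i \<noteq> v \<Longrightarrow> h i = 1" for h :: "'a \<Rightarrow> real"
  proof -
    have "(\<Prod>i\<in>A. h i) = (\<Prod>i\<in>{u, v}. h i)"
      using that uv fin(1) by (intro prod.mono_neutral_right) auto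
    thus ?thesis using uv(3) by simp
  qed
  have "(\<Prod>i\<in>A. f i (\<omega> i)) = (y (\<omega> u) + C) * (y (\<omega> v) + C)" for \<omega>
    by (subst two) (auto simp: f_def)
  hence "measure_pmf.expectation ?Q (\<lambda>\<omega>. (y (\<omega> u) + C) * (y (\<omega> v) + C))
    = measure_pmf.expectation ?Q (\<lambda>\<omega>. \<Prod>i\<in>A. f i (\<omega> i))" by simp
  also have "\<dots> = (\<Prod>i\<in>A. measure_pmf.expectation P (f i))"
    using fin C by (intro expectation_prod_Pi_pmf integrable_measure_pmf_finite) (auto simp: f_def)
  also have "\<dots> = measure_pmf.expectation P (f u) * measure_pmf.expectation P (f v)"
  proof (rule two)
    fix i assume "i \<noteq> u" "i \<noteq> v"
    hence "f i = (\<lambda>_. 1)" by (auto simp: f_def)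
    thus "measure_pmf.expectation P (f i) = 1" by simp
  qed
  also have "\<dots> = (?m + C)\<^sup>2"
  proof -
    have "f u = (\<lambda>w. y w + C)" "f v = (\<lambda>w. y w + C)" by (auto simp: f_def)
    thus ?thesis using intP by (simp add: power2_eq_square)
  qed
  finally have "measure_pmf.expectation ?Q (\<lambda>\<omega>. (y (\<omega> u) + C) * (y (\<omega> v) + C)) = (?m + C)\<^sup>2" .
  moreover have "measure_pmf.expectation ?Q (\<lambda>\<omega>. (y (\<omega> u) + C) * (y (\<omega> v) + C))
    = measure_pmf.expectation ?Q (\<lambda>\<omega>. y (\<omega> u) * y (\<omega> v) + (C * y (\<omega> u) + (C * y (\<omega> v) + C\<^sup>2)))"
    by (simp add: algebra_simps power2_eq_square)
  moreover have "\<dots> = measure_pmf.expectation ?Q (\<lambda>\<omega>. y (\<omega> u) * y (\<omega> v)) + (C * ?m + (C * ?m + C\<^sup>2))"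
    using one[OF uv(1)] one[OF uv(2)] int by simp
  ultimately show ?thesis by (simp add: power2_eq_square algebra_simps)
qed

text \<open>The weak law of large numbers with biased summands: in the expanded square the
  \<open>r\<close> diagonal terms are at most 1 each and give 1 / r, the others are squares of the
  bias from \<open>mean_occ\<close>. The index shift j + 1 matches the blocks used in
  \<open>window_estimate\<close>.\<close>

lemma iid_deviation:
  assumes inv: "\<mu> \<in> invariant_measures X" and n: "n \<ge> 1" and r: "r \<ge> 1" and jr: "j + r < K"
  shows "measure_pmf.expectation (Pi_pmf {..<K} d (\<lambda>_. word_law \<mu> n))
     (\<lambda>\<omega>. ((\<Sum>l<r. real (occ p (\<omega> (j + 1 + l)))) / real (r * n) - measure \<mu> (cyl (length p) {p}))\<^sup>2)
     \<le> 1 / real r + (real (length p) / real n)\<^sup>2"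
proof -
  note bp = invD[OF inv]
  let ?Q = "Pi_pmf {..<K} d (\<lambda>_. word_law \<mu> n)"
  let ?c = "measure \<mu> (cyl (length p) {p})"
  interpret M: prob_space \<mu> using borel_probD[OF bp] by simp
  define y where "y w = real (occ p w) / real n - ?c" for w
  define b where "b = measure_pmf.expectation (word_law \<mu> n) y"
  have b: "b\<^sup>2 \<le> (real (length p) / real n)\<^sup>2"
    using mean_occ[OF inv n, of p] unfolding b_def y_def by (intro abs_le_square_iff[THEN iffD1]) simp
  have fin: "finite (set_pmf ?Q)" by (intro finite_set_Pi_pmf finite_word_law bp) simp
  have int: "integrable (measure_pmf ?Q) f" for f :: "(nat \<Rightarrow> nat list) \<Rightarrow> real"
    by (rule integrable_measure_pmf_finite[OF fin])
  have eq: "((\<Sum>l<r. real (occ p (\<omega> (j + 1 + l)))) / real (r * n) - ?c)\<^sup>2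
    = (\<Sum>l<r. \<Sum>l'<r. y (\<omega> (j + 1 + l)) * y (\<omega> (j + 1 + l'))) / (real r)\<^sup>2" for \<omega>
  proof -
    have "(\<Sum>l<r. real (occ p (\<omega> (j + 1 + l)))) / real (r * n) - ?c = (\<Sum>l<r. y (\<omega> (j + 1 + l))) / real r"
    proof -
      have "(\<Sum>l<r. y (\<omega> (j + 1 + l))) = (\<Sum>l<r. real (occ p (\<omega> (j + 1 + l)))) / real n - real r * ?c"
        by (simp add: y_def sum_subtractf sum_divide_distrib)
      thus ?thesis using r n by (simp add: diff_divide_distrib mult.commute)
    qed
    moreover have "(S / real r)\<^sup>2 = S * S / (real r)\<^sup>2" for S :: real by (simp add: power_divide power2_eq_square)
    ultimately show ?thesis by (simp only: sum_product)
  qed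
  have tm: "measure_pmf.expectation ?Q (\<lambda>\<omega>. y (\<omega> (j + 1 + l)) * y (\<omega> (j + 1 + l'))) \<le> (if l = l' then 1 else 0) + (real (length p) / real n)\<^sup>2"
    if l: "l < r" "l' < r" for l l'
  proof (cases "l = l'")
    case True
    have "set_pmf (word_law \<mu> n) \<subseteq> words m n" using set_word_law[OF bp] language_n_words by blast
    have "measure_pmf.expectation ?Q (\<lambda>\<omega>. y (\<omega> (j + 1 + l)) * y (\<omega> (j + 1 + l'))) \<le> measure_pmf.expectation ?Q (\<lambda>\<omega>. 1)"
    proof (intro integral_mono_AE int AE_pmfI)
      fix \<omega> assume "\<omega> \<in> set_pmf ?Q"
      hence "\<omega> (j + 1 + l) \<in> set_pmf (word_law \<mu> n)" using l jr by (auto simp: set_Pi_pmf PiE_dflt_def)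
      hence "length (\<omega> (j + 1 + l)) = n" using set_word_law[OF bp] by (auto simp: language_n_def)
      hence "real (occ p (\<omega> (j + 1 + l))) \<le> real n" using occ_le[of p "\<omega> (j + 1 + l)"] by simp
      hence "real (occ p (\<omega> (j + 1 + l))) / real n \<le> 1" "0 \<le> real (occ p (\<omega> (j + 1 + l))) / real n"
        using n by (auto simp: divide_le_eq_1)
      moreover have "0 \<le> ?c" "?c \<le> 1" using M.prob_le_1 by auto
      ultimately have "\<bar>y (\<omega> (j + 1 + l))\<bar> \<le> 1" unfolding y_def by (intro abs_leI) linarith+
      hence "(y (\<omega> (j + 1 + l)))\<^sup>2 \<le> 1" by (simp add: abs_square_le_1)
      thus "y (\<omega> (j + 1 + l)) * y (\<omega> (j + 1 + l')) \<le> 1" using True by (simp add: power2_eq_square)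
    qed
    thus ?thesis using True by (simp add: add_increasing2)
  next
    case False
    have "measure_pmf.expectation ?Q (\<lambda>\<omega>. y (\<omega> (j + 1 + l)) * y (\<omega> (j + 1 + l'))) = b\<^sup>2"
      unfolding b_def using l jr False finite_word_law[OF bp] by (intro expectation_Pi_two) auto
    thus ?thesis using b False by simp
  qed
  have "measure_pmf.expectation ?Q (\<lambda>\<omega>. ((\<Sum>l<r. real (occ p (\<omega> (j + 1 + l)))) / real (r * n) - ?c)\<^sup>2)
    = (\<Sum>l<r. \<Sum>l'<r. measure_pmf.expectation ?Q (\<lambda>\<omega>. y (\<omega> (j + 1 + l)) * y (\<omega> (j + 1 + l')))) / (real r)\<^sup>2"
    unfolding eq by (subst integral_divide_zero, subst Bochner_Integration.integral_sum[OF int], subst Bochner_Integration.integral_sum[OF int]) simp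
  also have "\<dots> \<le> (\<Sum>l<r. \<Sum>l'<r. (if l = l' then 1 else 0) + (real (length p) / real n)\<^sup>2) / (real r)\<^sup>2"
    using tm by (intro divide_right_mono sum_mono) auto
  also have "\<dots> = (real r + (real r)\<^sup>2 * (real (length p) / real n)\<^sup>2) / (real r)\<^sup>2"
  proof -
    have "(\<Sum>l<r. \<Sum>l'<r. (if l = l' then 1 else 0) + z) = real r + (real r)\<^sup>2 * z" for z
      by (simp add: sum.distrib power2_eq_square algebra_simps)
    thus ?thesis by (simp only:)
  qed
  also have "\<dots> = 1 / real r + (real (length p) / real n)\<^sup>2"
  proof -
    have "(real r + (real r)\<^sup>2 * z) / (real r)\<^sup>2 = 1 / real r + z" for z
      using r by (simp add: add_divide_distrib power2_eq_square)
    thus ?thesis .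
  qed
  finally show ?thesis .
qed

text \<open>Minus the logarithm of the product law is a sum of \<open>K\<close> terms with equal
  expectation. The default value on the remaining coordinates adds no entropy.\<close>

lemma iid_entropy:
  assumes bp: "\<mu> \<in> borel_prob_on X"
  shows "ent (fin_space (Pi_pmf {..<K} d (\<lambda>_. word_law \<mu> n))) (\<lambda>\<omega>. \<omega>) = real K * block_ent \<mu> n"
proof -
  let ?P = "word_law \<mu> n"
  let ?Q = "Pi_pmf {..<K} d (\<lambda>_. ?P)"
  have fP: "finite (set_pmf ?P)" by (rule finite_word_law[OF bp])
  have fin: "finite (set_pmf ?Q)" by (intro finite_set_Pi_pmf fP) simp
  have int: "integrable (measure_pmf ?Q) f" for f :: "(nat \<Rightarrow> nat list) \<Rightarrow> real"
    by (rule integrable_measure_pmf_finite[OF fin])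
  have b: "block_ent \<mu> n = measure_pmf.expectation ?P (\<lambda>w. - ln (pmf ?P w))"
  proof -
    have "measure_pmf.expectation ?P (\<lambda>w. - ln (pmf ?P w)) = (\<Sum>w\<in>words m n. - ln (pmf ?P w) * pmf ?P w)"
      using set_word_law[OF bp] language_n_words by (intro integral_measure_pmf_real) auto
    also have "\<dots> = block_ent \<mu> n"
      unfolding block_ent_sum[OF bp] by (intro sum.cong) (auto simp: pmf_word_law[OF bp] eta_def)
    finally show ?thesis by simp
  qed
  have "ent (fin_space ?Q) (\<lambda>\<omega>. \<omega>) = (\<Sum>\<omega>\<in>set_pmf ?Q. eta (pmf ?Q \<omega>))"
    by (subst ent_fin_space[OF fin]) (auto simp: vimage_def measure_pmf_single)
  also have "\<dots> = (\<Sum>\<omega>\<in>set_pmf ?Q. (\<Sum>j<K. - ln (pmf ?P (\<omega> j))) * pmf ?Q \<omega>)"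
  proof (intro sum.cong refl)
    fix \<omega> assume \<omega>: "\<omega> \<in> set_pmf ?Q"
    have pos: "pmf ?P (\<omega> j) > 0" if "j < K" for j
      using \<omega> that by (auto simp: set_Pi_pmf PiE_dflt_def pmf_positive_iff)
    have "pmf ?Q \<omega> = (\<Prod>j<K. pmf ?P (\<omega> j))"
      using \<omega> set_Pi_pmf_subset[of "{..<K}" d "\<lambda>_. ?P"] by (intro pmf_Pi') auto
    moreover have "ln (\<Prod>j<K. pmf ?P (\<omega> j)) = (\<Sum>j<K. ln (pmf ?P (\<omega> j)))"
    proof (rule ln_prod)
      fix j assume "j \<in> {..<K}"
      thus "pmf ?P (\<omega> j) \<noteq> 0" using pos[of j] by simp
    qed simp
    ultimately have "ln (pmf ?Q \<omega>) = (\<Sum>j<K. ln (pmf ?P (\<omega> j)))" by (simp only:)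
    thus "eta (pmf ?Q \<omega>) = (\<Sum>j<K. - ln (pmf ?P (\<omega> j))) * pmf ?Q \<omega>"
      by (simp add: eta_def sum_negf)
  qed
  also have "\<dots> = measure_pmf.expectation ?Q (\<lambda>\<omega>. \<Sum>j<K. - ln (pmf ?P (\<omega> j)))"
    by (rule integral_measure_pmf_real[symmetric, OF fin])
  also have "\<dots> = (\<Sum>j<K. measure_pmf.expectation ?Q (\<lambda>\<omega>. - ln (pmf ?P (\<omega> j))))"
    by (rule Bochner_Integration.integral_sum[OF int])
  also have "\<dots> = (\<Sum>j<K. block_ent \<mu> n)"
  proof (rule sum.cong[OF refl])
    fix j assume j: "j \<in> {..<K}"
    have "measure_pmf.expectation ?Q (\<lambda>\<omega>. - ln (pmf ?P (\<omega> j))) = measure_pmf.expectation (map_pmf (\<lambda>\<omega>. \<omega> j) ?Q) (\<lambda>w. - ln (pmf ?P w))"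
      by simp
    also have "map_pmf (\<lambda>\<omega>. \<omega> j) ?Q = ?P" using j by (subst Pi_pmf_component) auto
    finally show "measure_pmf.expectation ?Q (\<lambda>\<omega>. - ln (pmf ?P (\<omega> j))) = block_ent \<mu> n" using b by simp
  qed
  finally show ?thesis by simp
qed

end

section \<open>Limits of coded laws and fibres of the coding\<close>

context approachable_shift
begin

lemma apx_length:
  assumes "w \<in> language_n X n"
  shows "n \<le> length (apx w) + g n" "length (apx w) \<le> n + g n"
    and "\<bar>real (occ p (apx w)) - real (occ p w)\<bar> \<le> 2 * (1 + real (length p)) * real (g n)"
proof -
  have w: "w \<in> language X" "length w = n" using assms by (auto simp: language_n_def)
  note c = apx_close[OF w(1), unfolded w(2)]
  show "n \<le> length (apx w) + g n" "length (apx w) \<le> n + g n" using close_words_length[OF c] w(2) by auto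
  show "\<bar>real (occ p (apx w)) - real (occ p w)\<bar> \<le> 2 * (1 + real (length p)) * real (g n)"
    using close_words_occ[OF c, of p] by (simp add: abs_minus_commute)
qed

text \<open>The common part of the two constructions: the law \<open>Q J\<close> of the word
  sequence is left open, a product law in one case and a point mass in the other. The convergence on
  cylinders and the entropy clause of \<open>averaging\<close> are passed on, since the two cases
  use them differently.\<close>

lemma code_limit:
  fixes Q :: "nat \<Rightarrow> (nat \<Rightarrow> nat list) pmf" and c :: "nat list \<Rightarrow> real" and K :: "nat \<Rightarrow> nat"
  assumes fin: "\<And>J. finite (set_pmf (Q J))"
    and supp_all: "\<forall>J. \<forall>\<omega>\<in>set_pmf (Q J). \<forall>j. \<omega> j \<in> language_n X n"
    and n: "n \<ge> 1" "3 * g n + \<tau> \<le> n" and r: "r \<ge> 1"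
    and e: "\<And>p. p \<in> F \<Longrightarrow> window_error n r p \<le> e"
    and K: "\<And>J. Suc J + r < K J"
    and dev: "\<And>J j p. p \<in> F \<Longrightarrow> j < Suc J \<Longrightarrow>
      measure_pmf.expectation (Q J) (\<lambda>\<omega>. ((\<Sum>l<r. real (occ p (\<omega> (j + 1 + l)))) / real (r * n) - c p)\<^sup>2) \<le> \<delta>"
    and \<delta>: "\<delta> \<ge> 0"
  defines "q \<equiv> \<lambda>J. map_pmf (code_point (K J)) (Q J)" and "N \<equiv> \<lambda>J. Suc J * (n - g n)"
  shows "\<exists>s \<nu>. strict_mono (s :: nat \<Rightarrow> nat) \<and> \<nu> \<in> invariant_measures X \<and>
    (\<forall>k B. (\<lambda>J. measure_pmf.prob (time_avg (N (s J)) (q (s J))) (cyl k B)) \<longlonglongrightarrow> measure \<nu> (cyl k B)) \<and>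
    (\<forall>a b. (\<forall>J. a * real (N J) - b \<le> ent (fin_space (q J)) (\<lambda>x. word x 0 (N J))) \<longrightarrow> a \<le> entropy_rate \<nu>) \<and>
    (\<forall>p\<in>F. (\<integral>x. (freq (r * n) p x - c p)\<^sup>2 \<partial>\<nu>) \<le> 4 * e\<^sup>2 + 4 * \<delta>)"
proof -
  have gn: "g n < n" using n by simp
  have supp: "\<omega> j \<in> language_n X n" if "\<omega> \<in> set_pmf (Q J)" for \<omega> j J
    using supp_all that by blast
  have lang: "\<omega> j \<in> language X" if "\<omega> \<in> set_pmf (Q J)" for \<omega> j J
    using supp[OF that, of j] by (simp add: language_n_def)
  have qfin: "finite (set_pmf (q J))" for J unfolding q_def using fin by simp
  have qX: "set_pmf (q J) \<subseteq> X" for J unfolding q_def using code_point_X lang by auto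
  have N0: "N J > 0" for J unfolding N_def using gn by simp
  have NJ: "J \<le> N J" for J
  proof -
    have "J * 1 \<le> Suc J * (n - g n)" using gn by (intro mult_le_mono) auto
    thus ?thesis by (simp add: N_def)
  qed
  have Ninf: "filterlim N at_top sequentially"
    by (rule filterlim_at_top_mono[OF filterlim_ident]) (simp add: NJ)
  obtain s \<nu> where s: "strict_mono (s :: nat \<Rightarrow> nat)" and inv: "\<nu> \<in> invariant_measures X"
    and lim: "\<And>k B. (\<lambda>J. measure_pmf.prob (time_avg (N (s J)) (q (s J))) (cyl k B)) \<longlonglongrightarrow> measure \<nu> (cyl k B)"
    and en: "\<And>a b. (\<forall>J. a * real (N J) - b \<le> ent (fin_space (q J)) (\<lambda>x. word x 0 (N J))) \<Longrightarrow> a \<le> entropy_rate \<nu>"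
    using averaging[of q N, OF qfin qX N0 Ninf] by blast
  have "(\<integral>x. (freq (r * n) p x - c p)\<^sup>2 \<partial>\<nu>) \<le> 4 * e\<^sup>2 + 4 * \<delta>" if p: "p \<in> F" for p
  proof -
    obtain \<Phi> where \<Phi>: "\<And>x. freq (r * n) p x = \<Phi> (word x 0 (r * n + length p))" using freq_word by blast
    have "(\<integral>x. (\<Phi> (word x 0 (r * n + length p)) - c p)\<^sup>2 \<partial>\<nu>) \<le> 4 * e\<^sup>2 + 4 * \<delta>"
    proof (rule limit_integral_le[where q = q and N = N and r = s and \<Phi> = "\<lambda>w. (\<Phi> w - c p)\<^sup>2", OF qfin qX N0 invD[OF inv] lim])
      fix J
      let ?K = "K J"
      have "(\<Sum>i<N J. measure_pmf.expectation (q J) (\<lambda>x. (\<Phi> (word x i (r * n + length p)) - c p)\<^sup>2))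
        = (\<Sum>i<Suc J * (n - g n). measure_pmf.expectation (Q J) (\<lambda>\<omega>. (freq (r * n) p ((shift ^^ i) (code_point ?K \<omega>)) - c p)\<^sup>2))"
        unfolding \<Phi> q_def N_def by simp
      also have "\<dots> \<le> real (Suc J) * real (n + g n + \<tau>) * (2 * e\<^sup>2 + 2 * \<delta>)"
      proof (rule code_average[where v = "\<lambda>\<omega> j. apx (\<omega> j)" and a = "code_starts ?K" and K = ?K
            and E = "2 * (1 + real (length p)) * real (g n)", OF fin _ _ _ gn _ _ e[OF p] dev[OF p]])
        fix \<omega> assume \<omega>: "\<omega> \<in> set_pmf (Q J)"
        show "block_code \<tau> ?K (\<lambda>j. apx (\<omega> j)) (code_point ?K \<omega>) (code_starts ?K \<omega>)"
          by (rule code_block) (rule lang[OF \<omega>])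
        fix j
        show "n \<le> length (apx (\<omega> j)) + g n \<and> length (apx (\<omega> j)) \<le> n + g n"
          using apx_length[OF supp[OF \<omega>, of j]] by simp
        show "\<bar>real (occ p (apx (\<omega> j))) - real (occ p (\<omega> j))\<bar> \<le> 2 * (1 + real (length p)) * real (g n)"
          by (rule apx_length(3)[OF supp[OF \<omega>]])
      qed (use r K in auto)
      \<comment> \<open>The longest block with its gap is at most twice the shortest block, by 3
        g(n) + \<tau> <= n. This doubling produces the constants 4.\<close>
      also have "\<dots> \<le> real (Suc J) * (2 * real (n - g n)) * (2 * e\<^sup>2 + 2 * \<delta>)"
        using n \<delta> by (intro mult_right_mono mult_left_mono) (auto simp: of_nat_diff)
      also have "\<dots> = real (N J) * (4 * e\<^sup>2 + 4 * \<delta>)"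
      proof -
        have "real (N J) = real (Suc J) * real (n - g n)" unfolding N_def by (rule of_nat_mult)
        thus ?thesis by (simp add: algebra_simps del: of_nat_Suc)
      qed
      finally show "(\<Sum>i<N J. measure_pmf.expectation (q J) (\<lambda>x. (\<Phi> (word x i (r * n + length p)) - c p)\<^sup>2))
        \<le> real (N J) * (4 * e\<^sup>2 + 4 * \<delta>)" .
    qed
    thus ?thesis unfolding \<Phi> .
  qed
  thus ?thesis using s inv lim en by blast
qed

text \<open>The lengths of the glued blocks and of the gaps determine the blocks \<open>apx (\<omega> j)\<close> inside \<open>z\<close>, and each block
  is edit-close to few words of length \<open>n\<close>.\<close>

lemma code_fibre_card:
  assumes supp_all: "\<forall>\<omega>\<in>\<Omega>. \<forall>j. \<omega> j \<in> language_n X n" and out_all: "\<forall>\<omega>\<in>\<Omega>. \<forall>j\<ge>K. \<omega> j = d"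
    and B: "\<And>v. length v \<le> n + g n \<Longrightarrow> real (card {w \<in> words m n. close_words (g n) w v}) \<le> B"
  shows "real (card {\<omega> \<in> \<Omega>. word (code_point K \<omega>) 0 (K * (n + g n + \<tau>)) = z}) \<le> ((real (n + g n + \<tau>) + 1)\<^sup>2 * B) ^ K"
proof -
  have \<Omega>: "\<omega> j \<in> language_n X n" if "\<omega> \<in> \<Omega>" for \<omega> j using supp_all that by blast
  have out: "\<omega> j = d" if "\<omega> \<in> \<Omega>" "j \<ge> K" for \<omega> j using out_all that by blast
  define D where "D = n + g n + \<tau>"
  define S where "S = (PiE {..<K} (\<lambda>_. {..n + g n} \<times> {..D}) :: (nat \<Rightarrow> nat \<times> nat) set)"
  define u where "u s j = take (fst (s j)) (drop (\<Sum>i<j. snd (s i)) z)" for s :: "nat \<Rightarrow> nat \<times> nat" and j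
  \<comment> \<open>Coordinates from \<open>K\<close> on are fixed to the default, so each choice of
    lengths leaves only finitely many sequences.\<close>
  define T where "T s = PiE_dflt {..<K} d (\<lambda>j. {w \<in> words m n. close_words (g n) w (u s j)})" for s
  have finS: "finite S" unfolding S_def by (intro finite_PiE) auto
  have finT: "finite (T s)" for s unfolding T_def by (intro finite_PiE_dflt) auto
  have "{\<omega> \<in> \<Omega>. word (code_point K \<omega>) 0 (K * D) = z} \<subseteq> (\<Union>s\<in>S. T s)"
  proof
    fix \<omega> assume "\<omega> \<in> {\<omega> \<in> \<Omega>. word (code_point K \<omega>) 0 (K * D) = z}"
    hence \<omega>: "\<omega> \<in> \<Omega>" and z: "word (code_point K \<omega>) 0 (K * D) = z" by auto
    have lang: "\<omega> j \<in> language X" for j using \<Omega>[OF \<omega>, of j] by (simp add: language_n_def)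
    let ?x = "code_point K \<omega>" and ?a = "code_starts K \<omega>"
    have bc: "block_code \<tau> K (\<lambda>j. apx (\<omega> j)) ?x ?a" by (rule code_block[OF lang])
    have len: "n \<le> length (apx (\<omega> j)) + g n \<and> length (apx (\<omega> j)) \<le> n + g n" for j
      using apx_length[OF \<Omega>[OF \<omega>, of j]] by simp
    have a0: "?a 0 = 0" and st: "\<And>j. j < K \<Longrightarrow> word ?x (?a j) (length (apx (\<omega> j))) = apx (\<omega> j) \<and>
       ?a j + length (apx (\<omega> j)) \<le> ?a (Suc j) \<and> ?a (Suc j) \<le> ?a j + length (apx (\<omega> j)) + \<tau>"
      using bc by (auto simp: block_code_def)
    define s where "s = (\<lambda>j\<in>{..<K}. (length (apx (\<omega> j)), ?a (Suc j) - ?a j))"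
    have sS: "s \<in> S" unfolding S_def
    proof (rule PiE_I)
      fix j assume "j \<in> {..<K}"
      hence "?a (Suc j) - ?a j \<le> D" "length (apx (\<omega> j)) \<le> n + g n" using st[of j] len[of j] by (auto simp: D_def)
      thus "s j \<in> {..n + g n} \<times> {..D}" using \<open>j \<in> {..<K}\<close> by (simp add: s_def)
    qed (simp add: s_def)
    have aj: "?a j = (\<Sum>i<j. snd (s i))" if "j \<le> K" for j using that
    proof (induction j)
      case (Suc j)
      have "?a j \<le> ?a (Suc j)" using st[of j] Suc.prems by auto
      thus ?case using Suc by (simp add: s_def)
    qed (simp add: a0)
    have uj: "u s j = apx (\<omega> j)" if j: "j < K" for j
    proof -
      \<comment> \<open>The recorded word has length K * D so that all \<open>K\<close> blocks lie
        inside it, whatever their positions.\<close>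
      have "?a (Suc j) \<le> 0 + Suc j * D"
        using block_code_bounds(2)[OF bc len, of 0 "Suc j"] a0 j by (simp add: D_def)
      also have "\<dots> \<le> K * D" using j by (simp del: mult_Suc)
      finally have "?a j + length (apx (\<omega> j)) \<le> K * D" using st[OF j] by linarith
      hence "length (apx (\<omega> j)) \<le> K * D - ?a j" by linarith
      hence "take (length (apx (\<omega> j))) (drop (?a j) z) = word ?x (?a j) (length (apx (\<omega> j)))"
        unfolding z[symmetric] by (simp add: drop_word take_word min_def)
      thus ?thesis unfolding u_def using aj[of j] st[OF j] j by (simp add: s_def)
    qed
    have "\<omega> \<in> T s" unfolding T_def PiE_dflt_def
    proof (rule CollectI, intro allI conjI impI)
      fix j assume j: "j \<in> {..<K}"
      have l: "length (\<omega> j) = n" "\<omega> j \<in> words m n" using \<Omega>[OF \<omega>, of j] language_n_words by (auto simp: language_n_def)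
      have "close_words (g n) (\<omega> j) (apx (\<omega> j))" using apx_close[OF lang, of j] l by simp
      thus "\<omega> j \<in> {w \<in> words m n. close_words (g n) w (u s j)}" using l uj j by simp
    qed (use out[OF \<omega>] in auto)
    thus "\<omega> \<in> (\<Union>s\<in>S. T s)" using sS by blast
  qed
  hence "card {\<omega> \<in> \<Omega>. word (code_point K \<omega>) 0 (K * D) = z} \<le> card (\<Union>s\<in>S. T s)"
    using finS finT by (intro card_mono) auto
  also have "\<dots> \<le> (\<Sum>s\<in>S. card (T s))" using finS by (rule card_UN_le)
  finally have "real (card {\<omega> \<in> \<Omega>. word (code_point K \<omega>) 0 (K * D) = z}) \<le> (\<Sum>s\<in>S. real (card (T s)))"
    by (simp flip: of_nat_sum)
  also have "\<dots> \<le> (\<Sum>s\<in>S. B ^ K)"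
  proof (rule sum_mono)
    fix s assume s: "s \<in> S"
    have "real (card (T s)) = (\<Prod>j<K. real (card {w \<in> words m n. close_words (g n) w (u s j)}))"
      unfolding T_def by (subst card_PiE_dflt) auto
    also have "\<dots> \<le> (\<Prod>j<K. B)"
    proof (rule prod_mono, intro conjI)
      fix j assume "j \<in> {..<K}"
      hence "fst (s j) \<le> n + g n" using s unfolding S_def by (auto dest!: PiE_mem[where x = j])
      hence "length (u s j) \<le> n + g n" by (simp add: u_def)
      thus "real (card {w \<in> words m n. close_words (g n) w (u s j)}) \<le> B" by (rule B)
    qed auto
    finally show "real (card (T s)) \<le> B ^ K" by simp
  qed
  also have "\<dots> = real (card S) * B ^ K" by simp
  also have "\<dots> \<le> ((real D + 1)\<^sup>2) ^ K * B ^ K"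
  proof (rule mult_right_mono)
    \<comment> \<open>The hypothesis on \<open>B\<close>, applied to the empty word, shows that
      \<open>B\<close> is nonnegative.\<close>
    have "real (card {w \<in> words m n. close_words (g n) w []}) \<le> B" by (rule B) simp
    hence "0 \<le> B" using of_nat_0_le_iff order.trans by blast
    thus "0 \<le> B ^ K" by simp
    have "card S = ((n + g n + 1) * (D + 1)) ^ K" unfolding S_def by (subst card_PiE) auto
    hence "real (card S) = (real (n + g n + 1) * (real D + 1)) ^ K"
      by (simp only: of_nat_power of_nat_mult of_nat_add of_nat_1)
    also have "\<dots> \<le> ((real D + 1) * (real D + 1)) ^ K"
      by (intro power_mono mult_right_mono) (auto simp: D_def)
    finally show "real (card S) \<le> ((real D + 1)\<^sup>2) ^ K" by (simp add: power2_eq_square)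
  qed
  finally show ?thesis unfolding D_def by (simp add: power_mult_distrib)
qed

end

section \<open>Nearly ergodic measures and measures of low entropy\<close>

lemma sum_full_period:
  fixes f :: "nat \<Rightarrow> real"
  shows "(\<Sum>l<r. f ((j + l) mod r)) = (\<Sum>l<r. f l)"
proof (induction j)
  case (Suc j)
  define h where "h l = f ((j + l) mod r)" for l
  have "(\<Sum>l<r. f ((Suc j + l) mod r)) = (\<Sum>l<r. h (Suc l))" by (simp add: h_def)
  also have "\<dots> = (\<Sum>l<Suc r. h l) - h 0" by (subst sum.lessThan_Suc_shift) simp
  also have "\<dots> = (\<Sum>l<r. h l)" by (simp add: h_def)
  finally show ?case using Suc by (simp add: h_def)
qed simp

lemma exists_le_expectation:
  fixes f :: "'a \<Rightarrow> real"
  assumes fin: "finite (set_pmf Q)" and c: "measure_pmf.expectation Q f \<le> c"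
  shows "\<exists>\<omega>\<in>set_pmf Q. f \<omega> \<le> c"
proof (rule ccontr)
  assume n: "\<not> ?thesis"
  define e where "e = Min (f ` set_pmf Q)"
  have "e \<in> f ` set_pmf Q" unfolding e_def using fin set_pmf_not_empty by (intro Min_in) auto
  hence "c < e" using n by fastforce
  have "measure_pmf.expectation Q (\<lambda>_. e) \<le> measure_pmf.expectation Q f"
    using fin by (intro integral_mono_AE integrable_measure_pmf_finite AE_pmfI) (auto simp: e_def)
  thus False using c \<open>c < e\<close> by simp
qed

text \<open>Displays a stretch of the coded point as blocks and gap words in turn, so that for a
  periodic sequence of blocks only the gap words remain to be counted.\<close>

lemma word_concat_blocks:
  assumes bc: "block_code \<tau> K v x a" and jk: "j + k \<le> K"
  shows "a j \<le> a (j + k) \<and> word x (a j) (a (j + k) - a j) = concat (map (\<lambda>l. v (j + l) @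
    word x (a (j + l) + length (v (j + l))) (a (Suc (j + l)) - a (j + l) - length (v (j + l)))) [0..<k])"
  using jk
proof (induction k)
  case (Suc k)
  let ?i = "j + k"
  have i: "word x (a ?i) (length (v ?i)) = v ?i" "a ?i + length (v ?i) \<le> a (Suc ?i)"
    using bc Suc.prems by (auto simp: block_code_def)
  have aj: "a j \<le> a ?i" using Suc by simp
  have "a (Suc ?i) - a j = (a ?i - a j) + (length (v ?i) + (a (Suc ?i) - a ?i - length (v ?i)))"
    using aj i(2) by simp
  hence "word x (a j) (a (Suc ?i) - a j) = word x (a j) (a ?i - a j) @ word x (a ?i) (length (v ?i) + (a (Suc ?i) - a ?i - length (v ?i)))"
    using aj by (simp only: word_append) simp
  also have "word x (a ?i) (length (v ?i) + (a (Suc ?i) - a ?i - length (v ?i))) = v ?i @ word x (a ?i + length (v ?i)) (a (Suc ?i) - a ?i - length (v ?i))"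
    by (simp only: word_append i(1))
  finally show ?case using Suc aj i(2) by simp
qed simp

section \<open>Choice of parameters and the two constructions\<close>

context approachable_shift
begin

text \<open>The two window ends take up at most 4 n symbols out of r n, so \<open>r\<close> is
  chosen first. All other errors are affine in g(n), per block of length \<open>n\<close>, and
  vanish as \<open>n\<close> grows with \<open>r\<close> fixed.\<close>

lemma eventually_parameters:
  fixes \<eta> :: real
  assumes \<eta>: "0 < \<eta>" "\<eta> \<le> 1" and F: "finite F"
  shows "\<exists>r\<ge>1. \<forall>\<^sub>F n in sequentially. n \<ge> 1 \<and> 3 * g n + \<tau> \<le> n \<and>
    (\<forall>p\<in>F. window_error n r p \<le> \<eta> \<and>
      1 / real r + (real (length p) / real n)\<^sup>2 \<le> \<eta>)"
proof -
  \<comment> \<open>The ends then cost at most 4 / r <= \<eta> / 2, which leaves \<eta> / 2 for the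
    drift.\<close>
  obtain r :: nat where r: "real r > 8 / \<eta>" using reals_Archimedean2 by blast
  have "8 / \<eta> > 0" using \<eta> by simp
  hence r1: "r \<ge> 1" using r by (cases r) auto
  have r8: "1 / real r \<le> \<eta> / 8"
  proof -
    have "8 < \<eta> * real r" using r \<eta> by (simp add: field_simps)
    thus ?thesis using r1 \<eta> by (simp add: field_simps)
  qed
  define L where "L = (\<Sum>p\<in>F. real (length p))"
  have L: "real (length p) \<le> L" if "p \<in> F" for p
    unfolding L_def using F that by (intro member_le_sum) auto
  have L0: "L \<ge> 0" unfolding L_def by (intro sum_nonneg) auto
  have e2: "\<eta> / 2 > 0" using \<eta> by simp
  have "\<forall>\<^sub>F n in sequentially. 3 * real (g n) + real \<tau> \<le> 1 * real n"
    by (rule eventually_linear_g) simp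
  moreover have "\<forall>\<^sub>F n in sequentially. (1 + 2 * (1 + L)) * real (g n) + (2 * real \<tau> + L) \<le> \<eta> / 2 * real n"
    by (rule eventually_linear_g[OF e2])
  moreover have "\<forall>\<^sub>F n in sequentially. 0 * real (g n) + L \<le> \<eta> / 2 * real n"
    by (rule eventually_linear_g[OF e2])
  ultimately have "\<forall>\<^sub>F n in sequentially. n \<ge> 1 \<and> 3 * g n + \<tau> \<le> n \<and>
    (\<forall>p\<in>F. window_error n r p \<le> \<eta> \<and>
      1 / real r + (real (length p) / real n)\<^sup>2 \<le> \<eta>)"
    using eventually_ge_at_top[of 1]
  proof eventually_elim
    case (elim n)
    have n: "real n > 0" using elim by simp
    have "real (3 * g n + \<tau>) \<le> real n" using elim by simp
    hence gn: "3 * g n + \<tau> \<le> n" by (simp only: of_nat_le_iff)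
    show ?case
    proof (intro conjI ballI)
      show "n \<ge> 1" "3 * g n + \<tau> \<le> n" using elim gn by auto
      fix p assume p: "p \<in> F"
      have "real (g n) + 2 * real \<tau> + real (length p) + 2 * (1 + real (length p)) * real (g n)
        \<le> real (g n) + 2 * real \<tau> + L + 2 * (1 + L) * real (g n)"
        using L[OF p] by (intro add_mono mult_right_mono) auto
      also have "\<dots> \<le> \<eta> / 2 * real n" using elim by (simp add: algebra_simps)
      finally have a: "real r * (real (g n) + 2 * real \<tau> + real (length p) + 2 * (1 + real (length p)) * real (g n))
         \<le> real r * (\<eta> / 2 * real n)" by (intro mult_left_mono) auto
      have "2 * real (n + g n + \<tau>) \<le> 4 * real n" using gn by simp
      also have "\<dots> = (1 / real r) * (4 * real (r * n))" using r1 by simp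
      also have "\<dots> \<le> (\<eta> / 8) * (4 * real (r * n))" using r8 by (intro mult_right_mono) auto
      finally have "2 * real (n + g n + \<tau>) + real r * (real (g n) + 2 * real \<tau> + real (length p) + 2 * (1 + real (length p)) * real (g n))
        \<le> \<eta> * real (r * n)" using a by (simp add: algebra_simps)
      thus "window_error n r p \<le> \<eta>"
        using n r1 by (simp add: divide_le_eq del: of_nat_mult)
      have "real (length p) \<le> \<eta> / 2 * real n" using L[OF p] elim by simp
      hence "real (length p) / real n \<le> \<eta> / 2" using n by (simp add: divide_le_eq)
      hence "(real (length p) / real n)\<^sup>2 \<le> (\<eta> / 2)\<^sup>2" using n by (intro power_mono) auto
      also have "\<dots> \<le> \<eta> / 2"
      proof -
        have "(\<eta> / 2) * (\<eta> / 2) \<le> (\<eta> / 2) * 1" using \<eta> by (intro mult_left_mono) auto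
        thus ?thesis by (simp add: power2_eq_square)
      qed
      finally show "1 / real r + (real (length p) / real n)\<^sup>2 \<le> \<eta>" using r8 \<eta> by linarith
    qed
  qed
  thus ?thesis using r1 by blast
qed

text \<open>The bound of \<open>card_close_words\<close> for radius \<open>g n\<close>, with the
  length of the centre replaced by its maximum n + g n.\<close>

definition ball_bound :: "real \<Rightarrow> nat \<Rightarrow> real" where
  "ball_bound t n = (1 + t) ^ (n + g n) * (1 + real m * t) ^ n / t ^ (2 * g n)"

lemma card_ball_bound:
  assumes t: "0 < t" "t \<le> 1" and v: "length v \<le> n + g n"
  shows "real (card {w \<in> words m n. close_words (g n) w v}) \<le> ball_bound t n"
proof -
  have "real (card {w \<in> words m n. close_words (g n) w v}) * t ^ (2 * g n) \<le> (1 + t) ^ length v * (1 + real m * t) ^ n"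
    by (rule card_close_words[OF t])
  also have "\<dots> \<le> (1 + t) ^ (n + g n) * (1 + real m * t) ^ n"
    using t v by (intro mult_right_mono power_increasing) auto
  finally show ?thesis unfolding ball_bound_def using t by (simp add: pos_le_divide_eq)
qed

lemma ball_bound_pos: "0 < t \<Longrightarrow> 0 < ball_bound t n"
  unfolding ball_bound_def by (intro divide_pos_pos mult_pos_pos zero_less_power) (auto intro: add_pos_nonneg)

lemma ln_ball_bound:
  assumes t: "0 < t"
  shows "ln (ball_bound t n) \<le> real (n + g n) * t + real n * (real m * t) + 2 * real (g n) * - ln t"
proof -
  have mt: "0 < 1 + real m * t" using t by (intro add_pos_nonneg) auto
  have "ln (ball_bound t n) = real (n + g n) * ln (1 + t) + real n * ln (1 + real m * t) + 2 * real (g n) * - ln t"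
    unfolding ball_bound_def using t mt by (simp add: ln_div ln_mult ln_realpow)
  also have "\<dots> \<le> real (n + g n) * t + real n * (real m * t) + 2 * real (g n) * - ln t"
    using t by (intro add_mono mult_left_mono ln_add_one_self_le_self) auto
  finally show ?thesis .
qed

text \<open>The entropy lost per block is o(n): the choice of block length and distance costs about
  2 ln n, the edit ball costs \<open>ln (ball_bound t n)\<close>, and cutting the coded word to its
  guaranteed length costs (2 g(n) + \<tau>) ln m. Here \<open>t\<close> is fixed first; afterwards
  -ln t is a constant and its multiple of g(n) is sublinear.\<close>

lemma eventually_multiplicity:
  assumes e: "(\<epsilon> :: real) > 0"
  shows "\<exists>t>0. t \<le> 1 \<and> (\<forall>\<^sub>F n in sequentially.
    ln ((real (n + g n + \<tau>) + 1)\<^sup>2 * ball_bound t n) + (2 * real (g n) + real \<tau>) * ln (real m) \<le> \<epsilon> * real n)"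
proof -
  \<comment> \<open>With n + g(n) <= 2 n, the terms linear in \<open>t\<close> sum to at most n t (2
    + m), hence this denominator.\<close>
  define t where "t = min 1 (\<epsilon> / (4 * (2 + real m)))"
  have m2: "2 + real m > 0" by simp
  have t: "t > 0" "t \<le> 1" "t * (2 + real m) \<le> \<epsilon> / 4"
  proof -
    show "t > 0" "t \<le> 1" using e m2 by (auto simp: t_def)
    have "t * (2 + real m) \<le> \<epsilon> / (4 * (2 + real m)) * (2 + real m)"
      using m2 by (intro mult_right_mono) (auto simp: t_def)
    also have "\<dots> = \<epsilon> / 4"
    proof -
      have "\<epsilon> / (4 * c) * c = \<epsilon> / 4" if "c > 0" for c using that by simp
      from this[OF m2] show ?thesis .
    qed
    finally show "t * (2 + real m) \<le> \<epsilon> / 4" .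
  qed
  have e4: "\<epsilon> / 4 > 0" "\<epsilon> / 8 > 0" using e by auto
  have 1: "\<forall>\<^sub>F n in sequentially. 3 * real (g n) + real \<tau> \<le> 1 * real n"
    by (rule eventually_linear_g) simp
  have 2: "\<forall>\<^sub>F n in sequentially. (2 * ln (real m) + 2 * - ln t) * real (g n) + (real \<tau> * ln (real m) + 2 * ln 3) \<le> \<epsilon> / 4 * real n"
    by (rule eventually_linear_g[OF e4(1)])
  have "((\<lambda>n. ln (real n) / real n) \<longlongrightarrow> 0) sequentially"
    by (rule filterlim_compose[OF ln_x_over_x_tendsto_0 filterlim_real_sequentially])
  hence 3: "\<forall>\<^sub>F n in sequentially. ln (real n) / real n < \<epsilon> / 8" by (rule order_tendstoD) (rule e4(2))
  have "\<forall>\<^sub>F n in sequentially.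
    ln ((real (n + g n + \<tau>) + 1)\<^sup>2 * ball_bound t n) + (2 * real (g n) + real \<tau>) * ln (real m) \<le> \<epsilon> * real n"
    using 1 2 3 eventually_ge_at_top[of 1]
  proof eventually_elim
    case (elim n)
    have n: "real n \<ge> 1" using elim by simp
    let ?D = "real (n + g n + \<tau>) + 1"
    have D: "0 < ?D" "?D \<le> 3 * real n" using elim by auto
    have "ln (?D\<^sup>2 * ball_bound t n) = 2 * ln ?D + ln (ball_bound t n)"
      using D ball_bound_pos[OF t(1), of n] by (simp add: ln_mult ln_realpow)
    also have "2 * ln ?D \<le> 2 * (ln 3 + ln (real n))"
    proof -
      have "ln ?D \<le> ln (3 * real n)" using D by simp
      also have "\<dots> = ln 3 + ln (real n)" using n by (simp add: ln_mult)
      finally show ?thesis by simp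
    qed
    also have "ln (ball_bound t n) \<le> real n * (t * (2 + real m)) + 2 * real (g n) * - ln t"
    proof -
      have "real (n + g n) * t + real n * (real m * t) \<le> (2 * real n) * t + real n * (real m * t)"
        using elim t by (intro add_right_mono mult_right_mono) auto
      also have "\<dots> = real n * (t * (2 + real m))" by (simp add: algebra_simps)
      finally show ?thesis using ln_ball_bound[OF t(1), of n] by linarith
    qed
    also have "real n * (t * (2 + real m)) \<le> real n * (\<epsilon> / 4)" using t(3) by (intro mult_left_mono) auto
    finally have "ln (?D\<^sup>2 * ball_bound t n) \<le> 2 * (ln 3 + ln (real n)) + (real n * (\<epsilon> / 4) + 2 * real (g n) * - ln t)" by simp
    hence 4: "ln (?D\<^sup>2 * ball_bound t n) \<le> 2 * ln 3 + 2 * ln (real n) + \<epsilon> * real n / 4 - 2 * (real (g n) * ln t)"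
      by (simp add: algebra_simps)
    have 5: "ln (real n) \<le> \<epsilon> * real n / 8" using elim n by (simp add: field_simps)
    have 6: "2 * (real (g n) * ln (real m)) - 2 * (real (g n) * ln t) + (real \<tau> * ln (real m) + 2 * ln 3) \<le> \<epsilon> * real n / 4"
      using elim(2) by (simp add: algebra_simps)
    have 7: "(2 * real (g n) + real \<tau>) * ln (real m) = 2 * (real (g n) * ln (real m)) + real \<tau> * ln (real m)"
      by (simp add: algebra_simps)
    have "0 \<le> \<epsilon> * real n" using e by simp
    thus ?case using 4 5 6 7 by linarith
  qed
  thus ?thesis using t by blast
qed

text \<open>Independent words retain the block entropy of \<mu> while the law of large numbers
  removes the variance in long windows. The loss of entropy comes only from the fibres of the coding
  and from irregular block lengths.\<close>

theorem near_ergodic: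
  assumes inv: "\<mu> \<in> invariant_measures X" and F: "finite F" and e: "\<epsilon> > 0"
  shows "\<exists>\<nu>\<in>invariant_measures X. entropy_rate \<mu> - \<epsilon> \<le> entropy_rate \<nu> \<and>
    (\<exists>M\<ge>1. \<forall>p\<in>F. (\<integral>x. (freq M p x - measure \<mu> (cyl (length p) {p}))\<^sup>2 \<partial>\<nu>) < \<epsilon>)"
proof -
  note bp = invD[OF inv]
  \<comment> \<open>Since \<eta>^2 <= \<eta>, the bound 4 \<eta>^2 + 4 \<eta> from
    \<open>code_limit\<close> is at most \<epsilon> / 2.\<close>
  define \<eta> where "\<eta> = min 1 (\<epsilon> / 16)"
  have \<eta>: "0 < \<eta>" "\<eta> \<le> 1" "\<eta> \<le> \<epsilon> / 16" using e by (auto simp: \<eta>_def)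
  obtain r where r: "r \<ge> 1" and ev: "\<forall>\<^sub>F n in sequentially. n \<ge> 1 \<and> 3 * g n + \<tau> \<le> n \<and>
    (\<forall>p\<in>F. window_error n r p \<le> \<eta> \<and>
      1 / real r + (real (length p) / real n)\<^sup>2 \<le> \<eta>)"
    using eventually_parameters[OF \<eta>(1,2) F] by blast
  obtain t where t: "0 < t" "t \<le> 1" and ev2: "\<forall>\<^sub>F n in sequentially.
    ln ((real (n + g n + \<tau>) + 1)\<^sup>2 * ball_bound t n) + (2 * real (g n) + real \<tau>) * ln (real m) \<le> \<epsilon> * real n"
    using eventually_multiplicity[OF e] by blast
  obtain n where n: "n \<ge> 1" "3 * g n + \<tau> \<le> n"
    and par: "\<And>p. p \<in> F \<Longrightarrow> window_error n r p \<le> \<eta>"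
      "\<And>p. p \<in> F \<Longrightarrow> 1 / real r + (real (length p) / real n)\<^sup>2 \<le> \<eta>"
    and mul: "ln ((real (n + g n + \<tau>) + 1)\<^sup>2 * ball_bound t n) + (2 * real (g n) + real \<tau>) * ln (real m) \<le> \<epsilon> * real n"
    using eventually_happens'[OF sequentially_bot eventually_conj[OF ev ev2]] by blast
  have gn: "g n < n" using n by simp
  obtain w0 where w0: "w0 \<in> language_n X n" using language_n_ne by blast
  \<comment> \<open>Time averages run over \<open>Suc J\<close> blocks; \<open>r\<close> further
    blocks serve the windows that start in the last of these, and one more makes the inequality
    strict.\<close>
  define K where "K J = Suc J + r + 1" for J
  define Q where "Q J = Pi_pmf {..<K J} w0 (\<lambda>_. word_law \<mu> n)" for J
  define q where "q J = map_pmf (code_point (K J)) (Q J)" for J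
  define N where "N J = Suc J * (n - g n)" for J
  have fin: "finite (set_pmf (Q J))" for J
    unfolding Q_def by (intro finite_set_Pi_pmf finite_word_law bp) simp
  have out: "\<omega> j = w0" if "\<omega> \<in> set_pmf (Q J)" "j \<ge> K J" for \<omega> j J
    using that unfolding Q_def by (auto simp: set_Pi_pmf PiE_dflt_def)
  have supp: "\<omega> j \<in> language_n X n" if "\<omega> \<in> set_pmf (Q J)" for \<omega> j J
  proof (cases "j < K J")
    case True
    thus ?thesis using that set_word_law[OF bp] unfolding Q_def by (auto simp: set_Pi_pmf PiE_dflt_def)
  qed (use out[OF that] w0 in auto)
  hence supp_all: "\<forall>J. \<forall>\<omega>\<in>set_pmf (Q J). \<forall>j. \<omega> j \<in> language_n X n" by blast
  have dev: "measure_pmf.expectation (Q J) (\<lambda>\<omega>. ((\<Sum>l<r. real (occ p (\<omega> (j + 1 + l)))) / real (r * n) - measure \<mu> (cyl (length p) {p}))\<^sup>2) \<le> \<eta>"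
    if "p \<in> F" "j < Suc J" for J j p
    using iid_deviation[OF inv n(1) r, of j "K J" w0 p] par(2)[OF that(1)] that(2) unfolding Q_def K_def by simp
  have KJ: "Suc J + r < K J" for J by (simp add: K_def)
  obtain \<nu> where \<nu>: "\<nu> \<in> invariant_measures X"
    and en: "\<And>a b. (\<forall>J. a * real (N J) - b \<le> ent (fin_space (q J)) (\<lambda>x. word x 0 (N J))) \<Longrightarrow> a \<le> entropy_rate \<nu>"
    and fr: "\<And>p. p \<in> F \<Longrightarrow> (\<integral>x. (freq (r * n) p x - measure \<mu> (cyl (length p) {p}))\<^sup>2 \<partial>\<nu>) \<le> 4 * \<eta>\<^sup>2 + 4 * \<eta>"
    using code_limit[of Q n r F \<eta> K "\<lambda>p. measure \<mu> (cyl (length p) {p})" \<eta>, OF fin supp_all n r par(1) KJ dev less_imp_le[OF \<eta>(1)]]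
    unfolding q_def[symmetric] N_def[symmetric] by blast
  have "4 * \<eta>\<^sup>2 + 4 * \<eta> < \<epsilon>"
  proof -
    have "\<eta>\<^sup>2 \<le> \<eta>" using \<eta> by (simp add: power2_eq_square mult_left_le)
    thus ?thesis using \<eta> e by linarith
  qed
  hence fr': "\<forall>p\<in>F. (\<integral>x. (freq (r * n) p x - measure \<mu> (cyl (length p) {p}))\<^sup>2 \<partial>\<nu>) < \<epsilon>"
    using fr by fastforce
  have "entropy_rate \<mu> - \<epsilon> \<le> entropy_rate \<nu>"
  proof -
    define D where "D = n + g n + \<tau>"
    define C where "C = (real D + 1)\<^sup>2 * ball_bound t n"
    have C0: "C > 0" unfolding C_def using ball_bound_pos[OF t(1), of n] by (intro mult_pos_pos) auto
    \<comment> \<open>\<open>A\<close> is the net entropy per block: ln C pays for the fibres of the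
      coding, and D - (n - g n) = 2 g(n) + \<tau> symbols are cut off. The extra r + 1 blocks enter
      only through the constant \<open>b\<close>.\<close>
    define A where "A = block_ent \<mu> n - ln C - (2 * real (g n) + real \<tau>) * ln (real m)"
    define b where "b = (real r + 1) * (block_ent \<mu> n - ln C) - (real r + 1) * real D * ln (real m)"
    have qfin: "finite (set_pmf (q J))" for J unfolding q_def using fin by simp
    have lang: "\<omega> j \<in> language X" if "\<omega> \<in> set_pmf (Q J)" for \<omega> j J
      using supp[OF that, of j] by (simp add: language_n_def)
    have qX: "set_pmf (q J) \<subseteq> X" for J unfolding q_def using code_point_X lang by auto
    have low: "real (Suc J) * A + b \<le> ent (fin_space (q J)) (\<lambda>x. word x 0 (N J))" for J
    proof -
      interpret QJ: prob_space "fin_space (Q J)" by (rule prob_space_fin_space)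
      define N' where "N' = K J * D"
      have NN: "N J \<le> N'"
      proof -
        have "Suc J * (n - g n) \<le> K J * D" unfolding K_def D_def by (intro mult_le_mono) auto
        thus ?thesis by (simp add: N_def N'_def)
      qed
      let ?Y = "\<lambda>\<omega>. word (code_point (K J) \<omega>) 0 N'"
      have "ent (fin_space (Q J)) (\<lambda>\<omega>. \<omega>) \<le> ent (fin_space (Q J)) ?Y + ln (C ^ K J)"
      proof (rule QJ.ent_le_fibres)
        show "simple_function (fin_space (Q J)) (\<lambda>\<omega>. \<omega>)" "simple_function (fin_space (Q J)) ?Y"
          by (rule simple_fin_space[OF fin])+
        show "0 < C ^ K J" using C0 by simp
        fix \<omega> assume "\<omega> \<in> space (fin_space (Q J))"
        have "(\<lambda>\<omega>. \<omega>) ` (?Y -` {?Y \<omega>} \<inter> space (fin_space (Q J))) = {\<omega>' \<in> set_pmf (Q J). word (code_point (K J) \<omega>') 0 N' = ?Y \<omega>}"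
          by auto
        moreover have "real (card {\<omega>' \<in> set_pmf (Q J). word (code_point (K J) \<omega>') 0 N' = ?Y \<omega>}) \<le> C ^ K J"
          using code_fibre_card[of "set_pmf (Q J)" n "K J" w0 "ball_bound t n" "?Y \<omega>"] supp out card_ball_bound[OF t]
          unfolding N'_def D_def C_def by blast
        ultimately show "real (card ((\<lambda>\<omega>. \<omega>) ` (?Y -` {?Y \<omega>} \<inter> space (fin_space (Q J))))) \<le> C ^ K J" by simp
      qed
      moreover have "ent (fin_space (Q J)) (\<lambda>\<omega>. \<omega>) = real (K J) * block_ent \<mu> n"
        unfolding Q_def by (rule iid_entropy[OF bp])
      moreover have "ent (fin_space (Q J)) ?Y = ent (fin_space (q J)) (\<lambda>x. word x 0 N')"
      proof -
        have "?Y ` set_pmf (Q J) \<subseteq> words m N'" using word_words code_point_X lang by blast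
        hence "ent (fin_space (Q J)) ?Y = (\<Sum>v\<in>words m N'. eta (measure_pmf.prob (Q J) (?Y -` {v})))"
          by (intro ent_fin_space) auto
        also have "\<dots> = ent (fin_space (q J)) (\<lambda>x. word x 0 N')"
          unfolding ent_fin_word[OF qX] unfolding q_def by (simp add: vimage_def)
        finally show ?thesis .
      qed
      moreover have "ent (fin_space (q J)) (\<lambda>x. word x 0 N') \<le> ent (fin_space (q J)) (\<lambda>x. word x 0 (N J)) + real (N' - N J) * ln (real m)"
        using ent_word_subadd[OF qfin, of J 0 "N J" "N' - N J"] ent_word_le[OF qfin qX, of J "0 + N J" "N' - N J"] NN by simp
      moreover have "ln (C ^ K J) = real (K J) * ln C" using C0 by (simp add: ln_realpow)
      ultimately have "real (K J) * block_ent \<mu> n \<le> ent (fin_space (q J)) (\<lambda>x. word x 0 (N J)) + real (N' - N J) * ln (real m) + real (K J) * ln C"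
        by linarith
      moreover have "real (N' - N J) = real (Suc J) * (2 * real (g n) + real \<tau>) + (real r + 1) * real D"
      proof -
        have "real N' = (real (Suc J) + (real r + 1)) * real D" unfolding N'_def K_def by (simp add: algebra_simps)
        moreover have "real (N J) = real (Suc J) * (real n - real (g n))"
          unfolding N_def of_nat_mult using gn by (simp add: of_nat_diff)
        moreover have "real D = real n + real (g n) + real \<tau>" by (simp add: D_def)
        ultimately show ?thesis using NN by (simp add: of_nat_diff algebra_simps)
      qed
      moreover have "real (K J) = real (Suc J) + (real r + 1)" by (simp add: K_def)
      ultimately show ?thesis unfolding A_def b_def by (simp add: algebra_simps)
    qed
    have ng: "real (n - g n) > 0" "real (n - g n) \<le> real n" using gn by auto
    have NJ: "real (N J) = real (Suc J) * real (n - g n)" for J unfolding N_def by (rule of_nat_mult)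
    have E1: "A / real (n - g n) \<le> entropy_rate \<nu>"
    proof (rule en[of _ "- b"], rule allI)
      fix J
      have "A / real (n - g n) * real (N J) = real (Suc J) * A" unfolding NJ using ng by simp
      thus "A / real (n - g n) * real (N J) - - b \<le> ent (fin_space (q J)) (\<lambda>x. word x 0 (N J))" using low[of J] by simp
    qed
    have E2: "0 \<le> entropy_rate \<nu>"
    proof (rule en[of _ 0], rule allI)
      fix J
      interpret prob_space "fin_space (q J)" by (rule prob_space_fin_space)
      show "0 * real (N J) - 0 \<le> ent (fin_space (q J)) (\<lambda>x. word x 0 (N J))" using ent_nonneg by simp
    qed
    have E3: "real n * (entropy_rate \<mu> - \<epsilon>) \<le> A"
      using mul entropy_rate_le[OF inv, of n] unfolding A_def C_def D_def by (simp add: algebra_simps)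
    \<comment> \<open>Dividing by n - g(n) instead of \<open>n\<close> is an advantage only for a
      nonnegative target; a negative one follows from nonnegativity of entropy.\<close>
    show ?thesis
    proof (cases "0 \<le> entropy_rate \<mu> - \<epsilon>")
      case True
      have "(entropy_rate \<mu> - \<epsilon>) * real (n - g n) \<le> (entropy_rate \<mu> - \<epsilon>) * real n"
        using True ng by (intro mult_left_mono) auto
      also have "\<dots> \<le> A" using E3 by (simp add: mult.commute)
      finally have "entropy_rate \<mu> - \<epsilon> \<le> A / real (n - g n)" using ng(1) by (simp only: pos_le_divide_eq)
      thus ?thesis using E1 by (rule order.trans)
    next
      case False
      thus ?thesis using E2 by linarith
    qed
  qed
  moreover have "r * n \<ge> 1" using r n(1) by (simp add: Suc_le_eq)
  ultimately show ?thesis using \<nu> fr' by blast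
qed

lemma locate_block:
  assumes "a 0 = (0 :: nat)" "i < a k" shows "\<exists>j<k. a j \<le> i \<and> i < a (Suc j)"
  using assms(2)
proof (induction k)
  case (Suc k)
  thus ?case by (cases "i < a k") (auto intro: less_SucI)
qed (use assms(1) in simp)

text \<open>Gluing a periodic sequence of \<open>n\<close>-words does not give a periodic point, as the gap words may vary. But a word of
  length \<open>s (n - g n)\<close> in the coded point is determined by its phase, its offset and at most \<open>s + 1\<close> gap words.\<close>

theorem low_entropy:
  assumes inv: "\<mu> \<in> invariant_measures X" and F: "finite F" and e: "\<epsilon> > 0"
  shows "\<exists>\<nu>\<in>invariant_measures X. entropy_rate \<nu> \<le> \<epsilon> \<and>
    (\<exists>M\<ge>1. \<forall>p\<in>F. (\<integral>x. (freq M p x - measure \<mu> (cyl (length p) {p}))\<^sup>2 \<partial>\<nu>) < \<epsilon>)"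
proof -
  note bp = invD[OF inv]
  let ?c = "\<lambda>p. measure \<mu> (cyl (length p) {p})"
  define cF where "cF = real (card F)"
  have cF: "0 \<le> cF" by (simp add: cF_def)
  \<comment> \<open>One sequence has to serve all patterns in \<open>F\<close>, so the sum of their
    errors is controlled and the number of patterns enters; the summand 1 covers an empty
    \<open>F\<close>.\<close>
  define \<eta> where "\<eta> = min 1 (\<epsilon> / (8 * (cF + 1)))"
  have \<eta>: "0 < \<eta>" "\<eta> \<le> 1" using e cF by (auto simp: \<eta>_def)
  have \<eta>2: "4 * \<eta>\<^sup>2 + 4 * (cF * \<eta>) < \<epsilon>"
  proof -
    have "\<eta> \<le> \<epsilon> / (8 * (cF + 1))" by (simp add: \<eta>_def)
    hence "\<eta> * (8 * (cF + 1)) \<le> \<epsilon>" using cF by (simp add: pos_le_divide_eq)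
    moreover have "\<eta>\<^sup>2 \<le> \<eta>" using \<eta> by (simp add: power2_eq_square mult_left_le)
    ultimately show ?thesis using e by (simp add: algebra_simps)
  qed
  define Gaps where "Gaps = (\<Union>l\<le>\<tau>. words m l)"
  have finG: "finite Gaps" by (simp add: Gaps_def)
  have "[] \<in> Gaps" by (auto simp: Gaps_def words_def)
  hence G1: "real (card Gaps) \<ge> 1" using finG card_gt_0_iff[of Gaps] by (auto simp: Suc_le_eq)
  obtain r where r: "r \<ge> 1" and ev: "\<forall>\<^sub>F n in sequentially. n \<ge> 1 \<and> 3 * g n + \<tau> \<le> n \<and>
    (\<forall>p\<in>F. window_error n r p \<le> \<eta> \<and>
      1 / real r + (real (length p) / real n)\<^sup>2 \<le> \<eta>)"
    using eventually_parameters[OF \<eta> F] by blast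
  have "\<epsilon> / 2 > 0" using e by simp
  \<comment> \<open>The factor 4 pays for s + 1 <= 2 s and for n <= 2 (n - g n) in the final
    count.\<close>
  hence ev2: "\<forall>\<^sub>F n in sequentially. 0 * real (g n) + 4 * ln (real (card Gaps)) \<le> \<epsilon> / 2 * real n"
    by (rule eventually_linear_g)
  obtain n where n: "n \<ge> 1" "3 * g n + \<tau> \<le> n"
    and par: "\<And>p. p \<in> F \<Longrightarrow> window_error n r p \<le> \<eta>"
      "\<And>p. p \<in> F \<Longrightarrow> 1 / real r + (real (length p) / real n)\<^sup>2 \<le> \<eta>"
    and gap: "4 * ln (real (card Gaps)) \<le> \<epsilon> / 2 * real n"
    using eventually_happens'[OF sequentially_bot eventually_conj[OF ev ev2]] by auto
  have gn: "g n < n" using n by simp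
  define D where "D = n + g n + \<tau>"
  define R where "R = real r * (real D + 1)"
  have R: "R \<ge> 1"
  proof -
    have "1 * 1 \<le> real r * (real D + 1)" using r by (intro mult_mono) auto
    thus ?thesis by (simp add: R_def)
  qed
  \<comment> \<open>Phase and offset, counted by \<open>R\<close>, are paid once for the whole word,
    the gap words once for each block. A word of \<open>s\<close> blocks dilutes the former.\<close>
  obtain s :: nat where s: "real s > 2 * ln R / \<epsilon>" using reals_Archimedean2 by blast
  have "2 * ln R / \<epsilon> \<ge> 0" using R e by simp
  hence s1: "s \<ge> 1" using s by (cases s) auto
  obtain w0 where w0: "w0 \<in> language_n X n" using language_n_ne by blast
  \<comment> \<open>\<open>iid_deviation\<close> looks at the coordinates 1, ..., r, hence r + 1
    coordinates; coordinate 0 is not part of the period.\<close>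
  define Q0 where "Q0 = Pi_pmf {..<r + 1} w0 (\<lambda>_. word_law \<mu> n)"
  have fin0: "finite (set_pmf Q0)" unfolding Q0_def by (intro finite_set_Pi_pmf finite_word_law bp) simp
  define err where "err p \<omega> = ((\<Sum>l<r. real (occ p (\<omega> (0 + 1 + l)))) / real (r * n) - ?c p)\<^sup>2" for p and \<omega> :: "nat \<Rightarrow> nat list"
  have "measure_pmf.expectation Q0 (\<lambda>\<omega>. \<Sum>p\<in>F. err p \<omega>) = (\<Sum>p\<in>F. measure_pmf.expectation Q0 (err p))"
    by (rule Bochner_Integration.integral_sum[OF integrable_measure_pmf_finite[OF fin0]])
  also have "\<dots> \<le> (\<Sum>p\<in>F. \<eta>)"
  proof (rule sum_mono)
    fix p assume "p \<in> F"
    thus "measure_pmf.expectation Q0 (err p) \<le> \<eta>"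
      using iid_deviation[OF inv n(1) r, of 0 "r + 1" w0 p] par(2)[of p] unfolding Q0_def err_def[abs_def] by simp
  qed
  also have "\<dots> = cF * \<eta>" by (simp add: cF_def)
  \<comment> \<open>Some realisation is no worse than the mean. Keeping this single one removes the
    entropy of the random choice.\<close>
  finally obtain \<omega>0 where \<omega>0: "\<omega>0 \<in> set_pmf Q0" "(\<Sum>p\<in>F. err p \<omega>0) \<le> cF * \<eta>"
    using exists_le_expectation[OF fin0] by blast
  define b where "b l = \<omega>0 (Suc l)" for l
  have b: "b l \<in> language_n X n" if "l < r" for l
    using \<omega>0(1) that set_word_law[OF bp] unfolding b_def Q0_def by (auto simp: set_Pi_pmf PiE_dflt_def)
  \<comment> \<open>Any \<open>r\<close> consecutive words make up a full period, so every window
    has the same error as the chosen realisation.\<close>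
  define \<omega> where "\<omega> j = b (j mod r)" for j
  have \<omega>: "\<omega> j \<in> language_n X n" for j unfolding \<omega>_def using r by (intro b) simp
  \<comment> \<open>The \<open>s\<close> extra blocks ensure that a word of length \<open>L\<close>
    starting in one of the first \<open>Suc J\<close> blocks ends inside the coded part.\<close>
  define K where "K J = Suc J + r + s" for J
  define Q where "Q J = return_pmf \<omega>" for J :: nat
  define q where "q J = map_pmf (code_point (K J)) (Q J)" for J
  define N where "N J = Suc J * (n - g n)" for J
  have fin: "finite (set_pmf (Q J))" for J by (simp add: Q_def)
  have supp_all: "\<forall>J. \<forall>\<omega>'\<in>set_pmf (Q J). \<forall>j. \<omega>' j \<in> language_n X n"
    using \<omega> by (simp add: Q_def)
  have KJ: "Suc J + r < K J" for J using s1 by (simp add: K_def)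
  have dev: "measure_pmf.expectation (Q J) (\<lambda>\<omega>. ((\<Sum>l<r. real (occ p (\<omega> (j + 1 + l)))) / real (r * n) - ?c p)\<^sup>2) \<le> cF * \<eta>"
    if "p \<in> F" "j < Suc J" for J j p
  proof -
    have "(\<Sum>l<r. real (occ p (\<omega> (j + 1 + l)))) = (\<Sum>l<r. real (occ p (b l)))"
      unfolding \<omega>_def using sum_full_period[of "\<lambda>l. real (occ p (b l))" "j + 1" r] .
    hence "measure_pmf.expectation (Q J) (\<lambda>\<omega>. ((\<Sum>l<r. real (occ p (\<omega> (j + 1 + l)))) / real (r * n) - ?c p)\<^sup>2) = err p \<omega>0"
      by (simp add: Q_def err_def b_def)
    also have "\<dots> \<le> (\<Sum>p\<in>F. err p \<omega>0)" using F that(1) by (intro member_le_sum) (auto simp: err_def)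
    finally show ?thesis using \<omega>0(2) by simp
  qed
  obtain s' \<nu> where \<nu>: "\<nu> \<in> invariant_measures X"
    and lim: "\<And>k B. (\<lambda>J. measure_pmf.prob (time_avg (N (s' J)) (q (s' J))) (cyl k B)) \<longlonglongrightarrow> measure \<nu> (cyl k B)"
    and fr: "\<And>p. p \<in> F \<Longrightarrow> (\<integral>x. (freq (r * n) p x - ?c p)\<^sup>2 \<partial>\<nu>) \<le> 4 * \<eta>\<^sup>2 + 4 * (cF * \<eta>)"
    using code_limit[of Q n r F \<eta> K ?c "cF * \<eta>", OF fin supp_all n r par(1) KJ dev mult_nonneg_nonneg[OF cF less_imp_le[OF \<eta>(1)]]]
    unfolding q_def[symmetric] N_def[symmetric] by blast
  have fr': "\<forall>p\<in>F. (\<integral>x. (freq (r * n) p x - ?c p)\<^sup>2 \<partial>\<nu>) < \<epsilon>" using fr \<eta>2 by fastforce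
  define L where "L = s * (n - g n)"
  \<comment> \<open>\<open>c\<close> is the phase of the first block, \<open>d\<close> the offset in
    it and \<open>gs\<close> the gap words. Starting inside a block and covering \<open>s\<close>
    minimal block lengths takes s + 1 blocks.\<close>
  define W where "W = (\<lambda>(c, d, gs). take L (drop d (concat (map (\<lambda>l. apx (b ((c + l) mod r)) @ gs ! l) [0..<Suc s]))))
     ` ({..<r} \<times> {..D} \<times> {gs. set gs \<subseteq> Gaps \<and> length gs = Suc s})"
  have finW: "finite W" unfolding W_def using finG by (intro finite_imageI finite_cartesian_product finite_lists_length_eq) auto
  have cardW: "real (card W) \<le> R * real (card Gaps) ^ Suc s"
  proof -
    have "card W \<le> card ({..<r} \<times> {..D} \<times> {gs. set gs \<subseteq> Gaps \<and> length gs = Suc s})"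
      unfolding W_def using finG by (intro card_image_le finite_cartesian_product finite_lists_length_eq) auto
    also have "\<dots> = r * ((D + 1) * card Gaps ^ Suc s)"
      by (simp add: card_cartesian_product card_lists_length_eq[OF finG])
    finally have "real (card W) \<le> real (r * ((D + 1) * card Gaps ^ Suc s))" by (rule of_nat_mono)
    also have "\<dots> = R * real (card Gaps) ^ Suc s"
      unfolding R_def by (simp only: of_nat_mult of_nat_add of_nat_power of_nat_1 mult.assoc)
    finally show ?thesis .
  qed
  have inW: "word (code_point (K J) \<omega>) i L \<in> W" if i: "i < N J" for i J
  proof -
    let ?x = "code_point (K J) \<omega>" and ?a = "code_starts (K J) \<omega>"
    have lang: "\<omega> j \<in> language X" for j using \<omega>[of j] by (simp add: language_n_def)
    have bc: "block_code \<tau> (K J) (\<lambda>j. apx (\<omega> j)) ?x ?a" and xX: "?x \<in> X"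
      by (rule code_block[OF lang], rule code_point_X[OF lang])
    have len: "n \<le> length (apx (\<omega> j)) + g n \<and> length (apx (\<omega> j)) \<le> n + g n" for j
      using apx_length[OF \<omega>[of j]] by simp
    have a0: "?a 0 = 0" using bc by (simp add: block_code_def)
    have "N J \<le> ?a (Suc J)" using block_code_bounds(1)[OF bc len, of 0 "Suc J"] a0 by (simp add: N_def K_def)
    then obtain j where j: "j < Suc J" "?a j \<le> i" "i < ?a (Suc j)" using locate_block[of ?a i "Suc J"] a0 i by auto
    define d where "d = i - ?a j"
    define gp where "gp k = word ?x (?a k + length (apx (\<omega> k))) (?a (Suc k) - ?a k - length (apx (\<omega> k)))" for k
    have "?a (Suc j) \<le> ?a j + D" using block_code_bounds(2)[OF bc len, of j 1] j KJ[of J] by (simp add: D_def)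
    hence dD: "d \<le> D" using j by (simp add: d_def)
    have gp: "gp k \<in> Gaps" if "k < K J" for k
    proof -
      have "?a (Suc k) - ?a k - length (apx (\<omega> k)) \<le> \<tau>" using bc that by (auto simp: block_code_def)
      thus ?thesis unfolding gp_def Gaps_def using word_words[OF xX] by blast
    qed
    define gs where "gs = map (\<lambda>l. gp (j + l)) [0..<Suc s]"
    have gs: "set gs \<subseteq> Gaps" "length gs = Suc s"
      using gp j(1) by (auto simp: gs_def K_def)
    have jK: "j + Suc s \<le> K J" using j(1) r by (simp add: K_def)
    have "map (\<lambda>l. apx (\<omega> (j + l)) @ gp (j + l)) [0..<Suc s] = map (\<lambda>l. apx (b ((j mod r + l) mod r)) @ gs ! l) [0..<Suc s]"
    proof (rule map_cong[OF refl])
      fix l assume "l \<in> set [0..<Suc s]"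
      hence l: "l < Suc s" by (simp only: set_upt) simp
      have "gs ! l = gp (j + l)" unfolding gs_def using l by (subst nth_map) (auto simp del: upt_Suc)
      moreover have "\<omega> (j + l) = b ((j mod r + l) mod r)" unfolding \<omega>_def by (simp add: mod_add_left_eq)
      ultimately show "apx (\<omega> (j + l)) @ gp (j + l) = apx (b ((j mod r + l) mod r)) @ gs ! l" by simp
    qed
    moreover have "word ?x (?a j) (?a (j + Suc s) - ?a j) = concat (map (\<lambda>l. apx (\<omega> (j + l)) @ gp (j + l)) [0..<Suc s])"
      using word_concat_blocks[OF bc jK] unfolding gp_def by blast
    ultimately have W1: "word ?x (?a j) (?a (j + Suc s) - ?a j) = concat (map (\<lambda>l. apx (b ((j mod r + l) mod r)) @ gs ! l) [0..<Suc s])"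
      by (simp only:)
    have "?a (Suc j) + L \<le> ?a (j + Suc s)"
      using block_code_bounds(1)[OF bc len, of "Suc j" s] jK by (simp add: L_def)
    hence "L \<le> (?a (j + Suc s) - ?a j) - d" using j by (simp add: d_def)
    hence "take L (drop d (word ?x (?a j) (?a (j + Suc s) - ?a j))) = word ?x i L"
      using j(2) by (simp add: drop_word take_word d_def min_absorb1)
    hence "word ?x i L = take L (drop d (concat (map (\<lambda>l. apx (b ((j mod r + l) mod r)) @ gs ! l) [0..<Suc s])))"
      unfolding W1 by simp
    moreover have "(j mod r, d, gs) \<in> {..<r} \<times> {..D} \<times> {gs. set gs \<subseteq> Gaps \<and> length gs = Suc s}"
      using r dD gs by simp
    ultimately show ?thesis unfolding W_def by (intro image_eqI[of _ _ "(j mod r, d, gs)"]) simp_all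
  qed
  have lang: "\<omega> j \<in> language X" for j using \<omega>[of j] by (simp add: language_n_def)
  have N0: "N J > 0" for J unfolding N_def using gn by simp
  have sq: "set_pmf (q J) = {code_point (K J) \<omega>}" for J by (simp add: q_def Q_def)
  have tX: "set_pmf (time_avg (N J) (q J)) \<subseteq> X" for J
    unfolding set_time_avg[OF N0] sq using code_point_X[OF lang] shift_pow_X by auto
  have "ent (fin_space (time_avg (N J) (q J))) (\<lambda>x. word x 0 L) \<le> ln (R * real (card Gaps) ^ Suc s)" for J
  proof -
    interpret prob_space "fin_space (time_avg (N J) (q J))" by (rule prob_space_fin_space)
    have fs: "finite (set_pmf (time_avg (N J) (q J)))" unfolding set_time_avg[OF N0] sq by simp
    have sub: "(\<lambda>x. word x 0 L) ` space (fin_space (time_avg (N J) (q J))) \<subseteq> W"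
      unfolding space_fin_space set_time_avg[OF N0] sq using inW by auto
    have "ent (fin_space (time_avg (N J) (q J))) (\<lambda>x. word x 0 L) \<le> ln (real (card W))"
      by (rule ent_le_ln_card[OF simple_fin_space[OF fs] finW sub])
    also have "\<dots> \<le> ln (R * real (card Gaps) ^ Suc s)"
    proof -
      have "W \<noteq> {}" using sub not_empty by auto
      hence "0 < real (card W)" using finW by (simp add: card_gt_0_iff)
      thus ?thesis using cardW by (intro ln_mono) linarith+
    qed
    finally show ?thesis .
  qed
  hence "\<exists>N'. \<forall>J\<ge>N'. ent (fin_space (time_avg (N (s' J)) (q (s' J)))) (\<lambda>x. word x 0 L) \<le> ln (R * real (card Gaps) ^ Suc s)"
    by blast
  \<comment> \<open>For a fixed length the block entropy is continuous along the limit, and one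
    length suffices because entropy per symbol is an infimum over lengths.\<close>
  with block_ent_tendsto[of "\<lambda>J. time_avg (N (s' J)) (q (s' J))", OF tX invD[OF \<nu>] lim, of L]
  have "block_ent \<nu> L \<le> ln (R * real (card Gaps) ^ Suc s)" by (rule LIMSEQ_le_const2)
  also have "\<dots> = ln R + (real s + 1) * ln (real (card Gaps))"
    using R G1 by (subst ln_mult) (auto simp: ln_realpow simp del: power_Suc)
  finally have up: "entropy_rate \<nu> * real L \<le> ln R + (real s + 1) * ln (real (card Gaps))"
    using entropy_rate_le[OF \<nu>, of L] by linarith
  have "ln R + (real s + 1) * ln (real (card Gaps)) \<le> \<epsilon> * real L"
  proof -
    have ng: "real n \<le> 2 * real (n - g n)" "1 \<le> real (n - g n)" using n gn by (auto simp: of_nat_diff)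
    have "2 * ln R \<le> \<epsilon> * real s" using s e by (simp add: pos_divide_less_eq mult.commute)
    also have "\<dots> \<le> \<epsilon> * (real s * real (n - g n))" using e ng(2) by (intro mult_left_mono) (auto simp: mult_le_cancel_left1)
    finally have 1: "2 * ln R \<le> \<epsilon> * real L" by (simp add: L_def)
    have lnG: "0 \<le> ln (real (card Gaps))" using G1 by simp
    have "(real s + 1) * ln (real (card Gaps)) \<le> (2 * real s) * ln (real (card Gaps))"
      using s1 lnG by (intro mult_right_mono) auto
    also have "\<dots> = real s / 2 * (4 * ln (real (card Gaps)))" by simp
    also have "\<dots> \<le> real s / 2 * (\<epsilon> / 2 * (2 * real (n - g n)))"
    proof (intro mult_left_mono)
      have "\<epsilon> / 2 * real n \<le> \<epsilon> / 2 * (2 * real (n - g n))" using ng(1) e by (intro mult_left_mono) auto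
      thus "4 * ln (real (card Gaps)) \<le> \<epsilon> / 2 * (2 * real (n - g n))" using gap by linarith
    qed simp
    also have "\<dots> = \<epsilon> * real L / 2" by (simp add: L_def)
    finally show ?thesis using 1 by linarith
  qed
  with up have "entropy_rate \<nu> * real L \<le> \<epsilon> * real L" by linarith
  moreover have "real L > 0" using s1 gn by (simp add: L_def)
  ultimately have "entropy_rate \<nu> \<le> \<epsilon>" by simp
  moreover have "r * n \<ge> 1" using r n(1) by (simp add: Suc_le_eq)
  ultimately show ?thesis using \<nu> fr' by blast
qed

end

section \<open>Residuality\<close>

context approachable_shift
begin

lemma square_less_imp_abs_less: "(a :: real)\<^sup>2 < b \<Longrightarrow> b \<le> c\<^sup>2 \<Longrightarrow> 0 \<le> c \<Longrightarrow> \<bar>a\<bar> < c"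
  by (metis abs_of_nonneg order_less_le_trans power2_abs power2_less_imp_less)

definition slice :: "real \<Rightarrow> seq measure set" where
  "slice \<alpha> = {\<mu> \<in> invariant_measures X. \<alpha> \<le> entropy_rate \<mu>}"

lemma slice_prob: "slice \<alpha> \<subseteq> borel_prob_on X"
  using invD by (auto simp: slice_def)

lemma topspace_slice: "topspace (subtopology (weak_star_topology X) (slice \<alpha>)) = slice \<alpha>"
  by (simp add: topspace_weak_star)

text \<open>Upper semicontinuity in the form used here: by Fekete's lemma the rate lies below
  \<open>c\<close> exactly if some block entropy lies below c n, and each block entropy is
  continuous.\<close>

lemma open_low_entropy:
  "openin (subtopology (weak_star_topology X) (slice \<alpha>)) {\<mu> \<in> slice \<alpha>. entropy_rate \<mu> < c}"
proof -
  let ?T = "subtopology (weak_star_topology X) (slice \<alpha>)"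
  have iff: "entropy_rate \<mu> < c \<longleftrightarrow> (\<exists>n\<ge>1. block_ent \<mu> n \<in> {..<c * real n})" if "\<mu> \<in> slice \<alpha>" for \<mu>
  proof
    have inv: "\<mu> \<in> invariant_measures X" using that by (simp add: slice_def)
    assume "entropy_rate \<mu> < c"
    hence "\<forall>\<^sub>F n in sequentially. block_ent \<mu> n / real n < c" using entropy_rate_lim[OF inv] by (rule order_tendstoD[rotated])
    hence "\<forall>\<^sub>F n in sequentially. block_ent \<mu> n / real n < c \<and> n \<ge> 1" using eventually_ge_at_top[of 1] by eventually_elim simp
    then obtain n where "block_ent \<mu> n / real n < c" "n \<ge> 1" using eventually_happens'[OF sequentially_bot] by blast
    thus "\<exists>n\<ge>1. block_ent \<mu> n \<in> {..<c * real n}" by (intro exI[of _ n]) (simp add: pos_divide_less_eq)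
  next
    have inv: "\<mu> \<in> invariant_measures X" using that by (simp add: slice_def)
    assume "\<exists>n\<ge>1. block_ent \<mu> n \<in> {..<c * real n}"
    then obtain n where n: "n \<ge> 1" "block_ent \<mu> n < c * real n" by auto
    hence "entropy_rate \<mu> * real n < c * real n" using entropy_rate_le[OF inv, of n] by linarith
    thus "entropy_rate \<mu> < c" using n by simp
  qed
  have "{\<mu> \<in> slice \<alpha>. entropy_rate \<mu> < c} = (\<Union>n\<in>{1..}. {\<mu> \<in> topspace ?T. block_ent \<mu> n \<in> {..<c * real n}})"
    unfolding topspace_slice using iff by auto
  moreover have "openin ?T {\<mu> \<in> topspace ?T. block_ent \<mu> n \<in> {..<c * real n}}" for n
    by (rule openin_continuous_map_preimage[OF continuous_block_ent[OF slice_prob]]) simp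
  ultimately show ?thesis by auto
qed

lemma open_small_deviation:
  "openin (subtopology (weak_star_topology X) (slice \<alpha>)) {\<mu> \<in> slice \<alpha>. \<exists>M\<ge>1. (\<Sum>w\<in>words m k. deviation \<mu> M w) < c}"
proof -
  let ?T = "subtopology (weak_star_topology X) (slice \<alpha>)"
  have "{\<mu> \<in> slice \<alpha>. \<exists>M\<ge>1. (\<Sum>w\<in>words m k. deviation \<mu> M w) < c}
    = (\<Union>M\<in>{1..}. {\<mu> \<in> topspace ?T. (\<Sum>w\<in>words m k. deviation \<mu> M w) \<in> {..<c}})"
    unfolding topspace_slice by auto
  moreover have "openin ?T {\<mu> \<in> topspace ?T. (\<Sum>w\<in>words m k. deviation \<mu> M w) \<in> {..<c}}" for M
    by (rule openin_continuous_map_preimage[OF continuous_map_sum[OF finite_words continuous_deviation[OF slice_prob]]]) simp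
  ultimately show ?thesis by auto
qed

lemma dense_in_slice:
  assumes A: "A \<subseteq> slice \<alpha>"
    and app: "\<And>\<mu> F \<epsilon>. \<mu> \<in> slice \<alpha> \<Longrightarrow> finite F \<Longrightarrow> \<epsilon> > 0 \<Longrightarrow>
      \<exists>\<nu>\<in>A. \<forall>w\<in>F. \<bar>measure \<nu> (cyl (length w) {w}) - measure \<mu> (cyl (length w) {w})\<bar> < \<epsilon>"
  shows "subtopology (weak_star_topology X) (slice \<alpha>) closure_of A = topspace (subtopology (weak_star_topology X) (slice \<alpha>))"
  unfolding dense_intersects_open
proof (intro allI impI, elim conjE)
  fix U assume U: "openin (subtopology (weak_star_topology X) (slice \<alpha>)) U" "U \<noteq> {}"
  then obtain U' where U': "openin (weak_star_topology X) U'" "U = U' \<inter> slice \<alpha>"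
    by (auto simp: openin_subtopology)
  then obtain \<mu> where \<mu>: "\<mu> \<in> U'" "\<mu> \<in> slice \<alpha>" using U(2) by blast
  obtain F \<epsilon> where F: "finite F" "\<epsilon> > 0" "\<And>\<nu>. \<nu> \<in> borel_prob_on X \<Longrightarrow>
    (\<forall>w\<in>F. \<bar>measure \<nu> (cyl (length w) {w}) - measure \<mu> (cyl (length w) {w})\<bar> < \<epsilon>) \<Longrightarrow> \<nu> \<in> U'"
    using weak_star_nbhd[OF U'(1) \<mu>(1)] \<mu>(2) slice_prob by blast
  obtain \<nu> where \<nu>: "\<nu> \<in> A" "\<forall>w\<in>F. \<bar>measure \<nu> (cyl (length w) {w}) - measure \<mu> (cyl (length w) {w})\<bar> < \<epsilon>"
    using app[OF \<mu>(2) F(1,2)] by blast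
  have "\<nu> \<in> slice \<alpha>" using \<nu>(1) A by blast
  moreover have "\<nu> \<in> U'" using F(3)[OF _ \<nu>(2)] calculation slice_prob by blast
  ultimately have "\<nu> \<in> A \<inter> U" using \<nu>(1) U'(2) by simp
  thus "A \<inter> U \<noteq> {}" by blast
qed

text \<open>A nearby measure of very small entropy may leave the slice. Mixing it with \<mu> raises
  the entropy back to \<alpha> and only brings the measure closer to \<mu>.\<close>

lemma dense_low_entropy:
  assumes \<alpha>: "0 \<le> \<alpha>" and \<delta>: "\<delta> > 0"
    and \<mu>: "\<mu> \<in> slice \<alpha>" and F: "finite F" and e: "\<epsilon> > 0"
  shows "\<exists>\<nu>\<in>{\<nu> \<in> slice \<alpha>. entropy_rate \<nu> < \<alpha> + \<delta>}.
    \<forall>w\<in>F. \<bar>measure \<nu> (cyl (length w) {w}) - measure \<mu> (cyl (length w) {w})\<bar> < \<epsilon>"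
proof -
  have inv: "\<mu> \<in> invariant_measures X" and h: "\<alpha> \<le> entropy_rate \<mu>" using \<mu> by (auto simp: slice_def)
  define \<eta> where "\<eta> = min (\<delta> / 2) (\<epsilon>\<^sup>2)"
  have \<eta>: "\<eta> > 0" "\<eta> < \<delta>" "\<eta> \<le> \<epsilon>\<^sup>2" using \<delta> e by (auto simp: \<eta>_def)
  obtain \<nu> M where \<nu>: "\<nu> \<in> invariant_measures X" "entropy_rate \<nu> \<le> \<eta>" and M: "M \<ge> 1"
    and fr: "\<And>p. p \<in> F \<Longrightarrow> (\<integral>x. (freq M p x - measure \<mu> (cyl (length p) {p}))\<^sup>2 \<partial>\<nu>) < \<eta>"
    using low_entropy[OF inv F \<eta>(1)] by blast
  have cl: "\<bar>measure \<nu> (cyl (length p) {p}) - measure \<mu> (cyl (length p) {p})\<bar> < \<epsilon>" if "p \<in> F" for p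
    using order.strict_trans1[OF measure_diff_le[OF \<nu>(1) M] fr[OF that]] \<eta>(3) e
    by (intro square_less_imp_abs_less) auto
  show ?thesis
  proof (cases "\<alpha> \<le> entropy_rate \<nu>")
    case True
    hence "\<nu> \<in> {\<nu> \<in> slice \<alpha>. entropy_rate \<nu> < \<alpha> + \<delta>}" using \<nu> \<eta> \<alpha> by (simp add: slice_def)
    thus ?thesis using cl by blast
  next
    case False
    \<comment> \<open>The solution of t h(\<mu>) + (1 - t) h(\<nu>) = \<alpha>, which lies in [0, 1]
      because h(\<nu>) < \<alpha> <= h(\<mu>).\<close>
    define t where "t = (\<alpha> - entropy_rate \<nu>) / (entropy_rate \<mu> - entropy_rate \<nu>)"
    have d: "entropy_rate \<mu> - entropy_rate \<nu> > 0" using False h by simp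
    have t: "0 \<le> t" "t \<le> 1" using False h d by (auto simp: t_def)
    obtain \<kappa> where \<kappa>: "\<kappa> \<in> invariant_measures X"
      and mix: "\<And>A. A \<in> sets (restrict_space borel X) \<Longrightarrow> measure \<kappa> A = t * measure \<mu> A + (1 - t) * measure \<nu> A"
      using mixture_exists[OF inv \<nu>(1) t] by blast
    have "entropy_rate \<kappa> = t * (entropy_rate \<mu> - entropy_rate \<nu>) + entropy_rate \<nu>"
      using entropy_rate_affine[OF inv \<nu>(1) t \<kappa> mix] by (simp add: algebra_simps)
    also have "t * (entropy_rate \<mu> - entropy_rate \<nu>) = \<alpha> - entropy_rate \<nu>" using d by (simp add: t_def)
    finally have "entropy_rate \<kappa> = \<alpha>" by simp
    hence "\<kappa> \<in> {\<nu> \<in> slice \<alpha>. entropy_rate \<nu> < \<alpha> + \<delta>}" using \<kappa> \<delta> by (simp add: slice_def)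
    moreover have "\<bar>measure \<kappa> (cyl (length p) {p}) - measure \<mu> (cyl (length p) {p})\<bar> < \<epsilon>" if "p \<in> F" for p
    proof -
      have "cyl (length p) {p} \<in> sets (restrict_space borel X)"
        using cyl_sets[OF invD[OF inv]] borel_probD(3)[OF invD[OF inv]] by simp
      hence "measure \<kappa> (cyl (length p) {p}) - measure \<mu> (cyl (length p) {p})
        = (1 - t) * (measure \<nu> (cyl (length p) {p}) - measure \<mu> (cyl (length p) {p}))"
        unfolding mix[OF \<open>cyl (length p) {p} \<in> sets (restrict_space borel X)\<close>] by (simp add: algebra_simps)
      hence "\<bar>measure \<kappa> (cyl (length p) {p}) - measure \<mu> (cyl (length p) {p})\<bar>
        = (1 - t) * \<bar>measure \<nu> (cyl (length p) {p}) - measure \<mu> (cyl (length p) {p})\<bar>" using t by (simp add: abs_mult)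
      also have "\<dots> \<le> 1 * \<bar>measure \<nu> (cyl (length p) {p}) - measure \<mu> (cyl (length p) {p})\<bar>"
        using t by (intro mult_right_mono) auto
      finally show ?thesis using cl[OF that] by simp
    qed
    ultimately show ?thesis by blast
  qed
qed

lemma dense_small_deviation:
  assumes \<alpha>: "\<alpha> < htop X" and \<delta>: "\<delta> > 0"
    and \<mu>: "\<mu> \<in> slice \<alpha>" and F: "finite F" and e: "\<epsilon> > 0"
  shows "\<exists>\<nu>\<in>{\<nu> \<in> slice \<alpha>. \<exists>M\<ge>1. (\<Sum>w\<in>words m k. deviation \<nu> M w) < \<delta>}.
    \<forall>w\<in>F. \<bar>measure \<nu> (cyl (length w) {w}) - measure \<mu> (cyl (length w) {w})\<bar> < \<epsilon>"
proof -
  have inv: "\<mu> \<in> invariant_measures X" and h: "\<alpha> \<le> entropy_rate \<mu>" using \<mu> by (auto simp: slice_def)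
  \<comment> \<open>\<open>near_ergodic\<close> loses some entropy, so there must be room above
    \<alpha>. A small admixture of \<rho> creates it; here \<alpha> < \<open>htop X\<close>
    enters.\<close>
  obtain \<rho> where \<rho>: "\<rho> \<in> invariant_measures X" "\<alpha> < entropy_rate \<rho>"
    using large_entropy_measure \<alpha> by (meson order.strict_trans2)
  define t where "t = max (1 / 2) (1 - \<epsilon> / 4)"
  have t: "0 \<le> t" "t \<le> 1" "t < 1" using e by (auto simp: t_def)
  have "1 - \<epsilon> / 4 \<le> t" by (simp add: t_def)
  hence t4: "1 - t \<le> \<epsilon> / 4" by linarith
  obtain \<kappa> where \<kappa>: "\<kappa> \<in> invariant_measures X"
    and mix: "\<And>A. A \<in> sets (restrict_space borel X) \<Longrightarrow> measure \<kappa> A = t * measure \<mu> A + (1 - t) * measure \<rho> A"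
    using mixture_exists[OF inv \<rho>(1) t(1,2)] by blast
  have "t * \<alpha> + (1 - t) * \<alpha> < t * entropy_rate \<mu> + (1 - t) * entropy_rate \<rho>"
    using h \<rho>(2) t by (intro add_le_less_mono mult_left_mono mult_strict_left_mono) auto
  hence hk: "\<alpha> < entropy_rate \<kappa>"
    using entropy_rate_affine[OF inv \<rho>(1) t(1,2) \<kappa> mix] by (simp add: algebra_simps)
  have ck: "\<bar>measure \<kappa> (cyl (length p) {p}) - measure \<mu> (cyl (length p) {p})\<bar> \<le> \<epsilon> / 4" for p
  proof -
    let ?C = "cyl (length p) {p}"
    have C: "?C \<in> sets (restrict_space borel X)"
      using cyl_sets[OF invD[OF inv]] borel_probD(3)[OF invD[OF inv]] by simp
    have "measure \<kappa> ?C - measure \<mu> ?C = (1 - t) * (measure \<rho> ?C - measure \<mu> ?C)"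
      unfolding mix[OF C] by (simp add: algebra_simps)
    hence "\<bar>measure \<kappa> ?C - measure \<mu> ?C\<bar> = (1 - t) * \<bar>measure \<rho> ?C - measure \<mu> ?C\<bar>" using t by (simp add: abs_mult)
    also have "\<dots> \<le> (1 - t) * 1"
    proof (rule mult_left_mono)
      have "measure \<rho> ?C \<le> 1" "measure \<mu> ?C \<le> 1"
        using prob_space.prob_le_1 borel_probD(1) invD inv \<rho>(1) by blast+
      thus "\<bar>measure \<rho> ?C - measure \<mu> ?C\<bar> \<le> 1" using measure_nonneg[of \<rho> ?C] measure_nonneg[of \<mu> ?C] by linarith
    qed (use t in auto)
    finally show ?thesis using t4 by simp
  qed
  define c where "c = real (card (words m k)) + 1"
  have c: "c > 0" by (simp add: c_def add_nonneg_pos)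
  \<comment> \<open>The three bounds keep the new measure in the slice, keep it within \<epsilon> /
    2 of \<kappa> on the cylinders in \<open>F\<close>, and make the deviations sum to less than
    \<delta>.\<close>
  define \<eta> where "\<eta> = min (entropy_rate \<kappa> - \<alpha>) (min ((\<epsilon> / 2)\<^sup>2) (\<delta> / c))"
  have \<eta>: "\<eta> > 0" "\<eta> \<le> entropy_rate \<kappa> - \<alpha>" "\<eta> \<le> (\<epsilon> / 2)\<^sup>2" "\<eta> \<le> \<delta> / c" using hk e \<delta> c by (auto simp: \<eta>_def)
  \<comment> \<open>The patterns in \<open>F\<close> control closeness, those in
    \<open>words m k\<close> the deviations.\<close>
  have "finite (F \<union> words m k)" using F by simp
  from near_ergodic[OF \<kappa> this \<eta>(1)] obtain \<nu> M where \<nu>: "\<nu> \<in> invariant_measures X" "entropy_rate \<kappa> - \<eta> \<le> entropy_rate \<nu>" and M: "M \<ge> 1"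
    and fr: "\<And>p. p \<in> F \<union> words m k \<Longrightarrow> (\<integral>x. (freq M p x - measure \<kappa> (cyl (length p) {p}))\<^sup>2 \<partial>\<nu>) < \<eta>"
    by blast
  have cl: "\<bar>measure \<nu> (cyl (length p) {p}) - measure \<mu> (cyl (length p) {p})\<bar> < \<epsilon>" if "p \<in> F" for p
  proof -
    have "\<bar>measure \<nu> (cyl (length p) {p}) - measure \<kappa> (cyl (length p) {p})\<bar> < \<epsilon> / 2"
      using order.strict_trans1[OF measure_diff_le[OF \<nu>(1) M] fr[of p]] that \<eta>(3) e
      by (intro square_less_imp_abs_less) auto
    thus ?thesis using ck[of p] e by linarith
  qed
  have "(\<Sum>w\<in>words m k. deviation \<nu> M w) \<le> (\<Sum>w\<in>words m k. \<eta>)"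
    using order.trans[OF deviation_le[OF \<nu>(1) M] less_imp_le[OF fr]] by (intro sum_mono) auto
  also have "\<dots> < c * \<eta>" using \<eta>(1) by (simp add: c_def algebra_simps)
  also have "\<dots> \<le> \<delta>" using \<eta>(4) c by (simp add: pos_le_divide_eq mult.commute)
  finally have "(\<Sum>w\<in>words m k. deviation \<nu> M w) < \<delta>" .
  moreover have "\<nu> \<in> slice \<alpha>" using \<nu> \<eta>(2) by (simp add: slice_def)
  ultimately show ?thesis using M cl by blast
qed

theorem residual_ergodic:
  assumes \<alpha>: "0 \<le> \<alpha>" "\<alpha> < htop X"
  shows "residual_in (subtopology (weak_star_topology X) {\<mu> \<in> invariant_measures X. ks_entropy X \<mu> \<ge> \<alpha>})
    {\<mu> \<in> ergodic_measures X. ks_entropy X \<mu> = \<alpha>}"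
proof -
  have slice: "{\<mu> \<in> invariant_measures X. ks_entropy X \<mu> \<ge> \<alpha>} = slice \<alpha>"
    using ks_entropy_eq by (auto simp: slice_def)
  let ?T = "subtopology (weak_star_topology X) (slice \<alpha>)"
  define U where "U n = {\<mu> \<in> slice \<alpha>. entropy_rate \<mu> < \<alpha> + 1 / real (Suc n)}" for n :: nat
  define V where "V k j = {\<mu> \<in> slice \<alpha>. \<exists>M\<ge>1. (\<Sum>w\<in>words m k. deviation \<mu> M w) < 1 / real (Suc j)}" for k j :: nat
  define Fam where "Fam = range U \<union> (\<lambda>(k, j). V k j) ` UNIV"
  have "countable Fam" by (simp add: Fam_def)
  moreover have "openin ?T (U n) \<and> ?T closure_of (U n) = topspace ?T" for n
    unfolding U_def by (intro conjI open_low_entropy dense_in_slice dense_low_entropy \<alpha>) auto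
  moreover have "openin ?T (V k j) \<and> ?T closure_of (V k j) = topspace ?T" for k j
    unfolding V_def by (intro conjI open_small_deviation dense_in_slice dense_small_deviation \<alpha>) auto
  moreover have "\<forall>W\<in>Fam. (\<exists>n. W = U n) \<or> (\<exists>k j. W = V k j)" unfolding Fam_def by auto
  ultimately have "countable Fam \<and> (\<forall>W\<in>Fam. openin ?T W \<and> ?T closure_of W = topspace ?T)" by metis
  moreover have "topspace ?T \<inter> \<Inter>Fam \<subseteq> {\<mu> \<in> ergodic_measures X. ks_entropy X \<mu> = \<alpha>}"
  proof
    fix \<mu> assume "\<mu> \<in> topspace ?T \<inter> \<Inter>Fam"
    hence \<mu>: "\<mu> \<in> slice \<alpha>" "\<And>n. \<mu> \<in> U n" "\<And>k j. \<mu> \<in> V k j"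
      unfolding Fam_def topspace_slice by blast+
    have inv: "\<mu> \<in> invariant_measures X" using \<mu>(1) by (simp add: slice_def)
    have "\<mu> \<in> ergodic_measures X"
      by (rule ergodic_if_small_deviation[OF inv]) (use \<mu>(3) in \<open>auto simp: V_def\<close>)
    moreover have "entropy_rate \<mu> = \<alpha>"
    proof (rule antisym)
      show "\<alpha> \<le> entropy_rate \<mu>" using \<mu>(1) by (simp add: slice_def)
      show "entropy_rate \<mu> \<le> \<alpha>"
      proof (rule field_le_epsilon)
        fix e :: real assume "e > 0"
        then obtain n where "1 / real (Suc n) < e" using reals_Archimedean[of e] by (auto simp: inverse_eq_divide)
        thus "entropy_rate \<mu> \<le> \<alpha> + e" using \<mu>(2)[of n] unfolding U_def by simp
      qed
    qed
    ultimately show "\<mu> \<in> {\<mu> \<in> ergodic_measures X. ks_entropy X \<mu> = \<alpha>}" using ks_entropy_eq[OF inv] by simp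
  qed
  moreover have "{\<mu> \<in> ergodic_measures X. ks_entropy X \<mu> = \<alpha>} \<subseteq> topspace ?T"
  proof
    fix \<mu> assume "\<mu> \<in> {\<mu> \<in> ergodic_measures X. ks_entropy X \<mu> = \<alpha>}"
    hence "\<mu> \<in> invariant_measures X" "ks_entropy X \<mu> = \<alpha>" by (simp_all add: ergodic_measures_def)
    thus "\<mu> \<in> topspace ?T" unfolding topspace_slice by (simp add: slice_def ks_entropy_eq)
  qed
  ultimately show ?thesis unfolding residual_in_def slice by blast
qed

end

theorem theorem3p1:
  fixes m :: nat and X :: "seq set" and G :: "nat list set"
  assumes "shift_space m X"
    and "G \<subseteq> language X"
    and "W_specification X G"
    and "edit_approachable X G"
  shows "\<forall>\<alpha>::real. 0 \<le> \<alpha> \<and> \<alpha> < htop X \<longrightarrow>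
     residual_in
       (subtopology (weak_star_topology X) {\<mu> \<in> invariant_measures X. ks_entropy X \<mu> \<ge> \<alpha>})
       {\<mu> \<in> ergodic_measures X. ks_entropy X \<mu> = \<alpha>}"
proof -
  obtain \<tau> where \<tau>: "\<forall>u\<in>G. \<forall>v\<in>G. \<exists>w\<in>language X. length w \<le> \<tau> \<and> u @ w @ v \<in> G"
    using assms(3) by (auto simp: W_specification_def)
  obtain g where g: "(\<lambda>n. real (g n) / real n) \<longlonglongrightarrow> 0" "\<forall>w\<in>language X. \<exists>v\<in>G. edit_dist w v \<le> g (length w)"
    using assms(4) by (auto simp: edit_approachable_def)
  interpret approachable_shift m X G \<tau> g
  proof
    show "shift_space m X" by (rule assms(1))
    show "G \<subseteq> language X" by (rule assms(2))
    show "(\<lambda>n. real (g n) / real n) \<longlonglongrightarrow> 0" by (rule g(1))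
    show "\<exists>w\<in>language X. length w \<le> \<tau> \<and> u @ w @ v \<in> G" if "u \<in> G" "v \<in> G" for u v
      using \<tau> that by blast
    show "\<exists>v\<in>G. edit_dist w v \<le> g (length w)" if "w \<in> language X" for w
      using g(2) that by blast
  qed
  show ?thesis using residual_ergodic by blast
qed

end
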